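(* Let $I=[0,1]$, let $\{I_i\}_i$ be a finite partition of $I$ (up to finitely many points) by open intervals, and let $T\colon \bigcup_i I_i\to I$ be a map. Suppose that: - for some $\beta>0$ and for every $i$, the map $T\colon I_i\to T(I_i)$ extends to a $C^{1+\beta}$ diffeomorphism on $\overline{I_i}$ (onto its image); - the Lebesgue measure $m$ on $I$ is $T$-invariant; - the transfer operator $L$ associated with $T$, with respect to $m$, preserves a Banach space of functions $B$ that is continuously embedded in $L^1(I)$, and the operator $L\colon B\to B$ is bounded; - there are $C\ge 0$ and $s\in(0,1)$ such that for every interval $J\subset I$ we have $1_J\in B$ and $\|1_J\|_B\le C|J|^{1-s}$. Then the Besov space $B^s_{1,1}$ is continuously embedded in $B$. If furthermore $s<\beta$, then $$r_{ess}(L,B)\ \ge\ \frac{1}{\Theta^\infty(1-s)},$$ and every $\lambda\in\mathbb{C}$ with $|\lambda|<1/\Theta^\infty(1-s)$ is an eigenvalue of $L$ on $B$ with an infinite-dimensional eigenspace.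
   Context: $|A|$ denotes the Lebesgue measure of a set $A$; functions are complex-valued and identified when equal $m$-a.e. Transfer operator: $L\colon L^1(I)\to L^1(I)$, $(L\phi)(x)=\sum_{T(y)=x}\phi(y)/|DT(y)|$; equivalently $\int \psi\, L\phi\,dm=\int (\psi\circ T)\,\phi\,dm$ for all $\psi\in L^\infty(I)$, $\phi\in L^1(I)$. A Banach space of functions continuously embedded in $L^1(I)$ is a complex linear subspace $B\subset L^1(I)$ with a complete norm $\|\cdot\|_B$ such that the inclusion into $L^1(I)$ is bounded. "$L$ preserves $B$" means $L(B)\subset B$. $\Theta^\infty$: let $\mathcal{P}^k=\{I^k_i\}_i$ be the collection of (open) intervals of monotonicity of $T^k$, i.e. the domains of the branches of $T^k$. Put $\theta^k_i=\sup_{x\in I^k_i}1/|DT^k(x)|$, and for $\gamma>0$ put $\Theta^k(\gamma)=\sum_i(\theta^k_i)^\gamma$. This is sub-multiplicative in $k$, and $\Theta^\infty(\gamma)=\lim_{k\to\infty}(\Theta^k(\gamma))^{1/k}$. Essential spectral radius: $r_{ess}(L,B)$ is the infimum of the $r\ge0$ such that every point of the spectrum of $L\colon B\to B$ with modulus $>r$ is an isolated eigenvalue of finite algebraic multiplicity. Besov space: for $s\in(0,1)$, $B^s_{1,1}=B^s_{1,1}(I)$ is the classical Besov space on $I$, which is described (with equivalent norm) as the space of all $\psi\in L^1(I)$ that can be written as $\psi=\sum_{n=0}^\infty c_n|Q_n|^{s-1}1_{Q_n}$ with convergence in $L^1(I)$, where the $Q_n$ are subintervals of $I$ of positive length, $c_n\in\mathbb{C}$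 and $\sum_n|c_n|<\infty$; the norm is $|\psi|_{B^s_{1,1}(I)}=\inf\sum_n|c_n|$ over all such representations.
   Formalization: The claim that every λ with |λ|<1/Θ^∞(1-s) is an eigenvalue with infinite-dimensional eigenspace is stated only for T not injective on the union of the I_i; for injective T (e.g. the identity, B=L^1) L is an L^1 isometry, so λ=0 is not an eigenvalue and the claim fails. *)

theory Defs
  imports "HOL-Analysis.Analysis" "HOL-Library.Disjoint_Sets"
begin

abbreviation mI :: "real measure" where
  "mI \<equiv> lebesgue_on {0..1}"

abbreviation length_of :: "real set \<Rightarrow> real" where
  "length_of J \<equiv> measure lebesgue J"

section \<open>Piecewise smooth maps\<close>

definition interval_partition :: "real set set \<Rightarrow> bool" where
  "interval_partition P \<longleftrightarrow>
     finite P \<and>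
     (\<forall>J\<in>P. J \<subseteq> {0..1} \<and> (\<exists>a b. a < b \<and> J = {a<..<b})) \<and>
     disjoint P \<and>
     finite ({0..1} - \<Union>P)"

text \<open>Regularity of (possibly non-integer) order \<open>r > 0\<close>: write \<open>r = k + a\<close> with \<open>k\<close> a natural
  number and \<open>0 < a \<le> 1\<close>; the \<open>k\<close>-th derivative (one-sided at boundary points of \<open>S\<close>) exists and
  is \<open>a\<close>-Hoelder. For \<open>0 < \<beta> \<le> 1\<close> and \<open>r = 1 + \<beta>\<close> this says that the first derivative is
  \<open>\<beta>\<close>-Hoelder; at integer \<open>r\<close> it is the larger class \<open>C\<^sup>k\<^sup>,\<^sup>1\<close> with \<open>k = r - 1\<close>.\<close>

definition holder_class :: "real \<Rightarrow> real set \<Rightarrow> (real \<Rightarrow> real) \<Rightarrow> bool" where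
  "holder_class r S f \<longleftrightarrow>
     (let k = nat (\<lceil>r\<rceil> - 1) in
      \<exists>D :: nat \<Rightarrow> real \<Rightarrow> real.
        (\<forall>x\<in>S. D 0 x = f x) \<and>
        (\<forall>j<k. \<forall>x\<in>S. (D j has_real_derivative D (Suc j) x) (at x within S)) \<and>
        (\<exists>H. \<forall>x\<in>S. \<forall>y\<in>S. \<bar>D k x - D k y\<bar> \<le> H * \<bar>x - y\<bar> powr (r - real k)))"

definition holder_diffeo :: "real \<Rightarrow> real set \<Rightarrow> (real \<Rightarrow> real) \<Rightarrow> bool" where
  "holder_diffeo r S g \<longleftrightarrow>
     inj_on g S \<and> holder_class r S g \<and> holder_class r (g ` S) (the_inv_into S g)"

definition preserves_lebesgue :: "real set set \<Rightarrow> (real \<Rightarrow> real) \<Rightarrow> bool" where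
  "preserves_lebesgue P T \<longleftrightarrow>
     T \<in> measurable (lebesgue_on (\<Union>P)) mI \<and> distr (lebesgue_on (\<Union>P)) mI T = mI"

definition transfer_op :: "real set set \<Rightarrow> (real \<Rightarrow> real) \<Rightarrow> (real \<Rightarrow> complex) \<Rightarrow> real \<Rightarrow> complex" where
  "transfer_op P T \<phi> x = (\<Sum>y | y \<in> \<Union>P \<and> T y = x. \<phi> y / of_real \<bar>deriv T y\<bar>)"

section \<open>The growth rate of the branches\<close>

text \<open>The branches of \<open>T ^^ k\<close> are its restrictions to the nonempty cylinders of length \<open>k\<close>. On a
  cylinder no iterate before the last leaves \<open>\<Union>P\<close>, and for \<open>k > 0\<close> cylinders are open, so
  \<open>deriv (T ^^ k)\<close> there does not depend on the values of \<open>T\<close> off \<open>\<Union>P\<close>.\<close>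

definition monotonicity_intervals :: "real set set \<Rightarrow> (real \<Rightarrow> real) \<Rightarrow> nat \<Rightarrow> real set set" where
  "monotonicity_intervals P T k =
     {J. J \<noteq> {} \<and> (\<exists>w :: nat \<Rightarrow> real set. (\<forall>j<k. w j \<in> P) \<and>
                 J = {x \<in> {0..1}. \<forall>j<k. (T ^^ j) x \<in> w j})}"

definition theta :: "(real \<Rightarrow> real) \<Rightarrow> nat \<Rightarrow> real set \<Rightarrow> real" where
  "theta T k J = (SUP x\<in>J. 1 / \<bar>deriv (T ^^ k) x\<bar>)"

definition Theta :: "real set set \<Rightarrow> (real \<Rightarrow> real) \<Rightarrow> nat \<Rightarrow> real \<Rightarrow> real" where
  "Theta P T k \<gamma> = (\<Sum>J \<in> monotonicity_intervals P T k. theta T k J powr \<gamma>)"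

definition Theta_infty :: "real set set \<Rightarrow> (real \<Rightarrow> real) \<Rightarrow> real \<Rightarrow> real" where
  "Theta_infty P T \<gamma> = lim (\<lambda>k. root k (Theta P T k \<gamma>))"

section \<open>Banach spaces of functions in \<open>L\<^sup>1(I)\<close> and operators on them\<close>

text \<open>Elements of \<open>L\<^sup>1(I)\<close> are handled through representatives: a space of functions is a set \<open>B\<close> of
  representatives closed under modification on null sets, and its norm \<open>N\<close> is invariant under such
  modifications. Equality in the space is equality almost everywhere with respect to \<open>mI\<close>.\<close>

definition eq_ae :: "(real \<Rightarrow> complex) \<Rightarrow> (real \<Rightarrow> complex) \<Rightarrow> bool" where
  "eq_ae f g \<longleftrightarrow> (AE x in mI. f x = g x)"

definition L1_norm :: "(real \<Rightarrow> complex) \<Rightarrow> real" where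
  "L1_norm f = (\<integral>x. cmod (f x) \<partial>mI)"

definition banach_function_space ::
    "(real \<Rightarrow> complex) set \<Rightarrow> ((real \<Rightarrow> complex) \<Rightarrow> real) \<Rightarrow> bool" where
  "banach_function_space B N \<longleftrightarrow>
     (\<forall>f\<in>B. integrable mI f) \<and>
     (\<forall>f\<in>B. \<forall>g. eq_ae f g \<longrightarrow> g \<in> B \<and> N g = N f) \<and>
     (\<lambda>x. 0) \<in> B \<and>
     (\<forall>f\<in>B. \<forall>g\<in>B. (\<lambda>x. f x + g x) \<in> B \<and> N (\<lambda>x. f x + g x) \<le> N f + N g) \<and>
     (\<forall>c. \<forall>f\<in>B. (\<lambda>x. c * f x) \<in> B \<and> N (\<lambda>x. c * f x) = cmod c * N f) \<and>
     (\<forall>f\<in>B. 0 \<le> N f \<and> (N f = 0 \<longleftrightarrow> eq_ae f (\<lambda>x. 0))) \<and>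
     (\<forall>F :: nat \<Rightarrow> real \<Rightarrow> complex. (\<forall>n. F n \<in> B) \<and>
        (\<forall>e>0. \<exists>M. \<forall>m\<ge>M. \<forall>n\<ge>M. N (\<lambda>x. F m x - F n x) < e) \<longrightarrow>
        (\<exists>f\<in>B. (\<lambda>n. N (\<lambda>x. F n x - f x)) \<longlonglongrightarrow> 0)) \<and>
     (\<exists>K. \<forall>f\<in>B. L1_norm f \<le> K * N f)"

text \<open>Below, \<open>A\<close> is assumed to map \<open>B\<close> into itself. The second conjunct expresses both
  injectivity of \<open>z - A\<close> on \<open>B\<close> and boundedness of its inverse.\<close>

definition spectrum_on ::
    "(real \<Rightarrow> complex) set \<Rightarrow> ((real \<Rightarrow> complex) \<Rightarrow> real) \<Rightarrow>
     ((real \<Rightarrow> complex) \<Rightarrow> real \<Rightarrow> complex) \<Rightarrow> complex set" where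
  "spectrum_on B N A =
     {z. \<not> ((\<forall>g\<in>B. \<exists>f\<in>B. eq_ae (\<lambda>x. z * f x - A f x) g) \<and>
            (\<exists>K. \<forall>f\<in>B. N f \<le> K * N (\<lambda>x. z * f x - A f x)))}"

definition eigenspace ::
    "(real \<Rightarrow> complex) set \<Rightarrow> ((real \<Rightarrow> complex) \<Rightarrow> real \<Rightarrow> complex) \<Rightarrow> complex \<Rightarrow>
     (real \<Rightarrow> complex) set" where
  "eigenspace B A z = {f \<in> B. eq_ae (A f) (\<lambda>x. z * f x)}"

definition is_eigenvalue ::
    "(real \<Rightarrow> complex) set \<Rightarrow> ((real \<Rightarrow> complex) \<Rightarrow> real \<Rightarrow> complex) \<Rightarrow> complex \<Rightarrow> bool" where
  "is_eigenvalue B A z \<longleftrightarrow> (\<exists>f \<in> eigenspace B A z. \<not> eq_ae f (\<lambda>x. 0))"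

definition gen_eigenspace ::
    "(real \<Rightarrow> complex) set \<Rightarrow> ((real \<Rightarrow> complex) \<Rightarrow> real \<Rightarrow> complex) \<Rightarrow> complex \<Rightarrow>
     (real \<Rightarrow> complex) set" where
  "gen_eigenspace B A z =
     {f \<in> B. \<exists>k. eq_ae (((\<lambda>g x. A g x - z * g x) ^^ k) f) (\<lambda>x. 0)}"

definition fin_dim_ae :: "(real \<Rightarrow> complex) set \<Rightarrow> bool" where
  "fin_dim_ae E \<longleftrightarrow>
     (\<exists>F. finite F \<and> F \<subseteq> E \<and>
        (\<forall>f\<in>E. \<exists>c :: (real \<Rightarrow> complex) \<Rightarrow> complex. eq_ae f (\<lambda>x. \<Sum>g\<in>F. c g * g x)))"

definition isolated_finite_eigenvalue ::
    "(real \<Rightarrow> complex) set \<Rightarrow> ((real \<Rightarrow> complex) \<Rightarrow> real) \<Rightarrow>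
     ((real \<Rightarrow> complex) \<Rightarrow> real \<Rightarrow> complex) \<Rightarrow> complex \<Rightarrow> bool" where
  "isolated_finite_eigenvalue B N A z \<longleftrightarrow>
     \<not> z islimpt spectrum_on B N A \<and> is_eigenvalue B A z \<and> fin_dim_ae (gen_eigenspace B A z)"

definition ess_spectral_radius ::
    "(real \<Rightarrow> complex) set \<Rightarrow> ((real \<Rightarrow> complex) \<Rightarrow> real) \<Rightarrow>
     ((real \<Rightarrow> complex) \<Rightarrow> real \<Rightarrow> complex) \<Rightarrow> real" where
  "ess_spectral_radius B N A =
     Inf {r. 0 \<le> r \<and>
        (\<forall>z \<in> spectrum_on B N A. r < cmod z \<longrightarrow> isolated_finite_eigenvalue B N A z)}"

section \<open>The Besov space \<open>B\<^sup>s\<^sub>1\<^sub>,\<^sub>1\<close> by atomic decomposition\<close>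

definition besov_representation ::
    "real \<Rightarrow> (real \<Rightarrow> complex) \<Rightarrow> (nat \<Rightarrow> complex) \<Rightarrow> (nat \<Rightarrow> real set) \<Rightarrow> bool" where
  "besov_representation s \<psi> c Q \<longleftrightarrow>
     (\<forall>n. is_interval (Q n) \<and> Q n \<subseteq> {0..1} \<and> 0 < length_of (Q n)) \<and>
     summable (\<lambda>n. cmod (c n)) \<and>
     (\<lambda>M. L1_norm (\<lambda>x. \<psi> x -
         (\<Sum>n<M. c n * of_real (length_of (Q n) powr (s - 1)) * indicator (Q n) x)))
       \<longlonglongrightarrow> 0"

definition besov_space :: "real \<Rightarrow> (real \<Rightarrow> complex) set" where
  "besov_space s = {\<psi>. integrable mI \<psi> \<and> (\<exists>c Q. besov_representation s \<psi> c Q)}"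

definition besov_norm :: "real \<Rightarrow> (real \<Rightarrow> complex) \<Rightarrow> real" where
  "besov_norm s \<psi> = Inf {\<Sum>n. cmod (c n) | c. \<exists>Q. besov_representation s \<psi> c Q}"

end

theory Submission
  imports Defs
begin

text \<open>The cylinder \<open>J\<close> of length \<open>k\<close> meets the preimage of an interval \<open>Q\<close> under \<open>T ^^ k\<close> in an
  interval of length at most \<open>theta T k J * length_of Q\<close>. Summing over \<open>J\<close>, composition with
  \<open>T ^^ k\<close> costs at most a factor \<open>Theta P T k (1 - s)\<close> in the norm of atomic sums. Because Lebesgue
  measure is invariant, the transfer operator \<open>L\<close> satisfies \<open>L (\<phi> \<circ> T) = \<phi>\<close>, so if \<open>L \<phi> = 0\<close> then
  \<open>\<Sum>k. z ^ k * (\<phi> \<circ> T ^^ k)\<close> is an eigenfunction for \<open>z\<close> whenever \<open>\<bar>z\<bar> < 1 / Theta_infty P T (1 - s)\<close>.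
  If two branches of \<open>T\<close> overlap, many such \<open>\<phi>\<close> arise as \<open>\<bar>T'\<bar>\<close> on one branch minus \<open>\<bar>T'\<bar>\<close> on the other.

  If \<open>T\<close> is injective, \<open>L\<close> is an isometry of \<open>L\<^sup>1\<close> and the bound to be shown is at most 1. Were it
  violated, \<open>1\<close> would be an isolated eigenvalue of finite multiplicity. Finite multiplicity forbids
  that an iterate of \<open>T\<close> is the identity; hence some interval takes arbitrarily long to return, which
  yields a wave packet whose spectral measure charges any given arc of the unit circle. Resolvent bounds on an arc
  near \<open>1\<close> forbid this.\<close>

text \<open>For injective \<open>T\<close> no \<open>z\<close> with modulus below 1 is an
  eigenvalue, since \<open>L\<close> is then isometric in \<open>L1_norm\<close>. The eigenvalue
  claim is therefore confined to noninjective \<open>T\<close>, and the essential radius needs a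
  separate argument in the other case. The identity \<open>L (\<phi> \<circ> T) = \<phi>\<close>
  says that \<open>1 / \<bar>T'\<bar>\<close> sums to 1 over almost every fibre; it comes from
  differentiating the length of the preimage of \<open>{0..t}\<close> in \<open>t\<close>.
  Differences of plain indicators need not lie in the kernel: the factor
  \<open>\<bar>T'\<bar>\<close> is what cancels the weights. It is only Hoelder, and
  \<open>s < \<beta>\<close> is what lets it be built from atoms. In the injective case elements of
  \<open>B\<close> are only known to be in \<open>L\<^sup>1\<close>, so \<open>L\<^sup>2\<close>
  arguments are run on a bounded packet, paired with \<open>L\<^sup>1\<close> solutions of the
  resolvent equation. The packet is \<open>M + 1\<close> disjoint copies of one interval with phases
  \<open>\<mu> ^ p\<close>; its correlation with its own shift is \<open>\<mu> * M / (M + 1)\<close>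
  of its squared norm, so its spectral mass must lie near \<open>\<mu>\<close> once \<open>M\<close>
  is large. The centre \<open>\<mu>\<close> differs from 1 because 1 is an eigenvalue: only a
  punctured neighbourhood of 1 offers resolvents.\<close>

section \<open>Linear dependence and infinite dimension\<close>

lemma homogeneous_nontrivial_solution:
  fixes c :: "'i \<Rightarrow> 'g \<Rightarrow> 'k::field"
  assumes "finite F" "finite A" "card F < card A"
  shows "\<exists>a. (\<exists>i\<in>A. a i \<noteq> 0) \<and> (\<forall>g\<in>F. (\<Sum>i\<in>A. a i * c i g) = 0)"
  using assms
proof (induction F arbitrary: A c rule: finite_induct)
  case empty
  then obtain i where "i \<in> A" by fastforce
  then show ?case by (intro exI[of _ "\<lambda>_. 1"]) auto
next
  case (insert g F)
  show ?case
  proof (cases "\<forall>i\<in>A. c i g = 0")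
    case True
    have "card F < card A" using insert by simp
    from insert.IH[OF insert.prems(1) this] obtain a where
      a: "\<exists>i\<in>A. a i \<noteq> 0" "\<forall>g\<in>F. (\<Sum>i\<in>A. a i * c i g) = 0" by blast
    then show ?thesis using True by (intro exI[of _ a]) auto
  next
    case False
    then obtain p where p: "p \<in> A" "c p g \<noteq> 0" by blast
    \<comment> \<open>Gaussian elimination with pivot \<open>p\<close>: equation \<open>g\<close> is
      solved for the unknown \<open>p\<close>, and \<open>c'\<close> holds the coefficients of the
      remaining equations after this substitution. Back-substitution defines
      \<open>b\<close>.\<close>
    define A' where "A' = A - {p}"
    define c' where "c' = (\<lambda>i h. c i h - c i g / c p g * c p h)"
    have "finite A'" "card F < card A'" using insert p by (auto simp: A'_def)
    from insert.IH[OF this, of c'] obtain a where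
      a: "\<exists>i\<in>A'. a i \<noteq> 0" "\<forall>g\<in>F. (\<Sum>i\<in>A'. a i * c' i g) = 0" by blast
    define b where "b = (\<lambda>i. if i = p then - (\<Sum>i\<in>A'. a i * (c i g / c p g)) else a i)"
    have eq: "(\<Sum>i\<in>A. b i * c i h) = (\<Sum>i\<in>A'. a i * c' i h)" for h
    proof -
      have "(\<Sum>i\<in>A. b i * c i h) = b p * c p h + (\<Sum>i\<in>A'. b i * c i h)"
        unfolding A'_def using insert.prems p by (simp add: sum.remove)
      also have "(\<Sum>i\<in>A'. b i * c i h) = (\<Sum>i\<in>A'. a i * c i h)"
        by (rule sum.cong) (auto simp: b_def A'_def)
      also have "b p * c p h = - (\<Sum>i\<in>A'. a i * (c i g / c p g) * c p h)"
        by (simp add: b_def sum_distrib_right)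
      finally show ?thesis
        by (simp add: c'_def algebra_simps sum_subtractf)
    qed
    have "(\<Sum>i\<in>A'. a i * c' i g) = 0"
      using p by (simp add: c'_def)
    moreover have "\<exists>i\<in>A. b i \<noteq> 0" using a(1) by (auto simp: b_def A'_def)
    ultimately show ?thesis using a(2) eq by (intro exI[of _ b]) auto
  qed
qed

text \<open>Expanding one more of the \<open>e i\<close> than \<open>F\<close> has elements gives
  more unknowns than equations, hence a nontrivial relation. Only finitely many almost-everywhere
  identities are combined, so their null sets unite to a null set.\<close>

lemma not_fin_dim_ae:
  fixes e :: "nat \<Rightarrow> real \<Rightarrow> complex"
  assumes "\<And>i. e i \<in> E"
    and indep: "\<And>n a. eq_ae (\<lambda>x. \<Sum>i<n. a i * e i x) (\<lambda>x. 0) \<Longrightarrow> \<forall>i<n. a i = 0"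
  shows "\<not> fin_dim_ae E"
proof
  assume "fin_dim_ae E"
  then obtain F where F: "finite F" "F \<subseteq> E"
    "\<forall>f\<in>E. \<exists>c. eq_ae f (\<lambda>x. \<Sum>g\<in>F. c g * g x)"
    unfolding fin_dim_ae_def by blast
  have "\<forall>i. \<exists>c. eq_ae (e i) (\<lambda>x. \<Sum>g\<in>F. c g * g x)" using F assms(1) by blast
  then obtain c where c: "\<And>i. eq_ae (e i) (\<lambda>x. \<Sum>g\<in>F. c i g * g x)" by metis
  obtain a where a: "\<exists>i\<in>{..<Suc (card F)}. a i \<noteq> 0"
    "\<forall>g\<in>F. (\<Sum>i\<in>{..<Suc (card F)}. a i * c i g) = 0"
    using homogeneous_nontrivial_solution[OF F(1), of "{..<Suc (card F)}" c] by auto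
  have "AE x in mI. \<forall>i\<in>{..<Suc (card F)}. e i x = (\<Sum>g\<in>F. c i g * g x)"
    using c by (intro AE_finite_allI) (auto simp: eq_ae_def)
  then have "eq_ae (\<lambda>x. \<Sum>i<Suc (card F). a i * e i x) (\<lambda>x. 0)"
    unfolding eq_ae_def
  proof eventually_elim
    case (elim x)
    have "(\<Sum>i<Suc (card F). a i * e i x) = (\<Sum>i<Suc (card F). \<Sum>g\<in>F. a i * c i g * g x)"
      using elim by (intro sum.cong) (auto simp: sum_distrib_left mult.assoc)
    also have "\<dots> = (\<Sum>g\<in>F. (\<Sum>i<Suc (card F). a i * c i g) * g x)"
      unfolding sum_distrib_right by (rule sum.swap)
    also have "\<dots> = 0" using a(2) by simp
    finally show ?case .
  qed
  from indep[OF this] a(1) show False by auto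
qed

section \<open>Banach function spaces\<close>

lemma L1_norm_triangle:
  assumes "integrable mI f" "integrable mI g"
  shows "L1_norm (\<lambda>x. f x + g x) \<le> L1_norm f + L1_norm g"
proof -
  have "L1_norm (\<lambda>x. f x + g x) \<le> (\<integral>x. cmod (f x) + cmod (g x) \<partial>mI)"
    unfolding L1_norm_def using assms by (intro integral_mono) (auto intro: norm_triangle_ineq)
  also have "\<dots> = L1_norm f + L1_norm g"
    unfolding L1_norm_def using assms by (intro Bochner_Integration.integral_add) auto
  finally show ?thesis .
qed

lemma L1_norm_eq_0:
  assumes "integrable mI f" "L1_norm f = 0"
  shows "eq_ae f (\<lambda>x. 0)"
proof -
  have "AE x in mI. cmod (f x) = 0"
    using assms integral_nonneg_eq_0_iff_AE[of mI "\<lambda>x. cmod (f x)"] by (auto simp: L1_norm_def)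
  then show ?thesis unfolding eq_ae_def by eventually_elim auto
qed

locale function_space =
  fixes B :: "(real \<Rightarrow> complex) set" and N :: "(real \<Rightarrow> complex) \<Rightarrow> real"
  assumes bfs: "banach_function_space B N"
begin

lemma integrable_mem: "f \<in> B \<Longrightarrow> integrable mI f"
  and mem_ae: "f \<in> B \<Longrightarrow> eq_ae f g \<Longrightarrow> g \<in> B"
  and N_ae: "f \<in> B \<Longrightarrow> eq_ae f g \<Longrightarrow> N g = N f"
  and zero_mem: "(\<lambda>x. 0) \<in> B"
  and add_mem: "f \<in> B \<Longrightarrow> g \<in> B \<Longrightarrow> (\<lambda>x. f x + g x) \<in> B"
  and N_add: "f \<in> B \<Longrightarrow> g \<in> B \<Longrightarrow> N (\<lambda>x. f x + g x) \<le> N f + N g"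
  and scale_mem: "f \<in> B \<Longrightarrow> (\<lambda>x. c * f x) \<in> B"
  and N_scale: "f \<in> B \<Longrightarrow> N (\<lambda>x. c * f x) = cmod c * N f"
  and N_nonneg: "f \<in> B \<Longrightarrow> 0 \<le> N f"
  and N_eq_0: "f \<in> B \<Longrightarrow> N f = 0 \<longleftrightarrow> eq_ae f (\<lambda>x. 0)"
  using bfs unfolding banach_function_space_def by blast+

lemma complete:
  assumes "\<And>n. F n \<in> B" "\<And>e. 0 < e \<Longrightarrow> \<exists>M. \<forall>m\<ge>M. \<forall>n\<ge>M. N (\<lambda>x. F m x - F n x) < e"
  shows "\<exists>f\<in>B. (\<lambda>n. N (\<lambda>x. F n x - f x)) \<longlonglongrightarrow> 0"
proof -
  have "\<forall>F :: nat \<Rightarrow> real \<Rightarrow> complex. (\<forall>n. F n \<in> B) \<and>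
        (\<forall>e>0. \<exists>M. \<forall>m\<ge>M. \<forall>n\<ge>M. N (\<lambda>x. F m x - F n x) < e) \<longrightarrow>
        (\<exists>f\<in>B. (\<lambda>n. N (\<lambda>x. F n x - f x)) \<longlonglongrightarrow> 0)"
    using bfs unfolding banach_function_space_def by (elim conjE)
  from this[rule_format, of F] show ?thesis using assms by simp
qed

lemma N_zero: "N (\<lambda>x. 0) = 0"
  using N_eq_0[OF zero_mem] by (simp add: eq_ae_def)

lemma diff_mem: "f \<in> B \<Longrightarrow> g \<in> B \<Longrightarrow> (\<lambda>x. f x - g x) \<in> B"
  using add_mem[of f "\<lambda>x. -1 * g x"] scale_mem[of g "-1"] by simp

lemma N_diff: "f \<in> B \<Longrightarrow> g \<in> B \<Longrightarrow> N (\<lambda>x. f x - g x) \<le> N f + N g"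
  using N_add[of f "\<lambda>x. -1 * g x"] scale_mem[of g "-1"] N_scale[of g "-1"] by simp

lemma N_commute: "f \<in> B \<Longrightarrow> g \<in> B \<Longrightarrow> N (\<lambda>x. f x - g x) = N (\<lambda>x. g x - f x)"
  using N_scale[OF diff_mem, of g f "-1"] by simp

lemma N_triangle: "f \<in> B \<Longrightarrow> g \<in> B \<Longrightarrow> N f \<le> N g + N (\<lambda>x. f x - g x)"
  using N_add[OF _ diff_mem, of g f g] by simp

lemma sum_mem: "(\<And>i. i \<in> A \<Longrightarrow> u i \<in> B) \<Longrightarrow> (\<lambda>x. \<Sum>i\<in>A. u i x) \<in> B"
  by (induction A rule: infinite_finite_induct) (auto simp: zero_mem intro!: add_mem)

lemma N_sum: "(\<And>i. i \<in> A \<Longrightarrow> u i \<in> B) \<Longrightarrow> N (\<lambda>x. \<Sum>i\<in>A. u i x) \<le> (\<Sum>i\<in>A. N (u i))"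
proof (induction A rule: infinite_finite_induct)
  case (insert i A)
  then have "N (\<lambda>x. u i x + (\<Sum>i\<in>A. u i x)) \<le> N (u i) + N (\<lambda>x. \<Sum>i\<in>A. u i x)"
    by (intro N_add sum_mem) auto
  then show ?case using insert by auto
next
  case (infinite A)
  then show ?case using N_zero by simp
next
  case empty
  then show ?case using N_zero by simp
qed

lemma L1_bound: "\<exists>K>0. \<forall>f\<in>B. L1_norm f \<le> K * N f"
proof -
  obtain K where K: "\<forall>f\<in>B. L1_norm f \<le> K * N f"
    using bfs unfolding banach_function_space_def by blast
  have "L1_norm f \<le> (\<bar>K\<bar> + 1) * N f" if "f \<in> B" for f
  proof -
    have "K * N f \<le> (\<bar>K\<bar> + 1) * N f"
      using N_nonneg[OF that] by (intro mult_right_mono) auto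
    then show ?thesis using K that by force
  qed
  then show ?thesis by (intro exI[of _ "\<bar>K\<bar> + 1"]) auto
qed

lemma series_limit:
  assumes u: "\<And>n. u n \<in> B" and summ: "summable (\<lambda>n. N (u n))"
  obtains f where "f \<in> B" "(\<lambda>n. N (\<lambda>x. (\<Sum>i<n. u i x) - f x)) \<longlonglongrightarrow> 0"
    "N f \<le> (\<Sum>n. N (u n))"
proof -
  have Sn: "(\<lambda>x. \<Sum>i<n. u i x) \<in> B" for n by (intro sum_mem u)
  have le: "N (\<lambda>x. (\<Sum>i<m. u i x) - (\<Sum>i<n. u i x)) \<le> (\<Sum>i=n..<m. N (u i))" if "n \<le> m" for m n
  proof -
    have "(\<Sum>i<m. u i x) - (\<Sum>i<n. u i x) = (\<Sum>i=n..<m. u i x)" for x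
      using sum_diff_nat_ivl[of 0 n m "\<lambda>i. u i x"] that by (simp add: atLeast0LessThan)
    then show ?thesis using N_sum[of "{n..<m}" u] u by simp
  qed
  have "\<exists>f\<in>B. (\<lambda>n. N (\<lambda>x. (\<Sum>i<n. u i x) - f x)) \<longlonglongrightarrow> 0"
  proof (rule complete[OF Sn])
    fix e :: real assume "0 < e"
    then obtain M where M: "\<And>m n. m \<ge> M \<Longrightarrow> norm (\<Sum>i=m..<n. N (u i)) < e"
      using summ unfolding summable_Cauchy by blast
    show "\<exists>M. \<forall>m\<ge>M. \<forall>n\<ge>M. N (\<lambda>x. (\<Sum>i<m. u i x) - (\<Sum>i<n. u i x)) < e"
    proof (intro exI[of _ M] allI impI)
      fix m n assume mn: "M \<le> m" "M \<le> n"
      show "N (\<lambda>x. (\<Sum>i<m. u i x) - (\<Sum>i<n. u i x)) < e"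
      proof (cases "n \<le> m")
        case True
        then show ?thesis using le[OF True] M[of n m] mn by force
      next
        case False
        then show ?thesis
          using le[of m n] M[of m n] mn N_commute[OF Sn[of m] Sn[of n]] by force
      qed
    qed
  qed
  then obtain f where f: "f \<in> B" "(\<lambda>n. N (\<lambda>x. (\<Sum>i<n. u i x) - f x)) \<longlonglongrightarrow> 0" by blast
  have "N f \<le> (\<Sum>n. N (u n)) + N (\<lambda>x. (\<Sum>i<n. u i x) - f x)" for n
  proof -
    have "N f \<le> N (\<lambda>x. \<Sum>i<n. u i x) + N (\<lambda>x. (\<Sum>i<n. u i x) - f x)"
      using N_triangle[OF f(1) Sn[of n]] N_commute[OF f(1) Sn[of n]] by simp
    also have "N (\<lambda>x. \<Sum>i<n. u i x) \<le> (\<Sum>i<n. N (u i))" by (intro N_sum u)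
    also have "\<dots> \<le> (\<Sum>n. N (u n))" by (intro sum_le_suminf summ) (auto simp: N_nonneg u)
    finally show ?thesis by simp
  qed
  moreover have "(\<lambda>n. (\<Sum>n. N (u n)) + N (\<lambda>x. (\<Sum>i<n. u i x) - f x)) \<longlonglongrightarrow> (\<Sum>n. N (u n)) + 0"
    by (intro tendsto_intros f)
  ultimately have "N f \<le> (\<Sum>n. N (u n)) + 0" by (intro LIMSEQ_le_const) auto
  with f show ?thesis by (intro that) auto
qed

lemma L1_tendsto:
  assumes "\<And>n. S n \<in> B" "f \<in> B" "(\<lambda>n. N (\<lambda>x. S n x - f x)) \<longlonglongrightarrow> 0"
  shows "(\<lambda>n. L1_norm (\<lambda>x. S n x - f x)) \<longlonglongrightarrow> 0"
proof -
  obtain K where K: "K > 0" "\<And>f. f \<in> B \<Longrightarrow> L1_norm f \<le> K * N f" using L1_bound by blast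
  have "(\<lambda>n. K * N (\<lambda>x. S n x - f x)) \<longlonglongrightarrow> K * 0" by (intro tendsto_intros assms)
  then have lim: "(\<lambda>n. K * N (\<lambda>x. S n x - f x)) \<longlonglongrightarrow> 0" by simp
  have "norm (L1_norm (\<lambda>x. S n x - f x)) \<le> K * N (\<lambda>x. S n x - f x)" for n
    using K(2)[OF diff_mem[OF assms(1,2)]] by (simp add: L1_norm_def)
  then show ?thesis by (intro Lim_null_comparison[OF _ lim]) simp
qed

text \<open>Completeness yields some limit \<open>g\<close> in norm, not yet the given pointwise
  limit. The embedding turns norm convergence into \<open>L\<^sup>1\<close> convergence, a
  subsequence of which converges almost everywhere; this identifies \<open>g\<close> with
  \<open>f\<close>.\<close>

lemma series_ae:
  assumes u: "\<And>n. u n \<in> B" and summ: "summable (\<lambda>n. N (u n))"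
    and ae: "AE x in mI. (\<lambda>n. \<Sum>i<n. u i x) \<longlonglongrightarrow> f x"
  shows "f \<in> B" "N f \<le> (\<Sum>n. N (u n))"
proof -
  obtain g where g: "g \<in> B" "(\<lambda>n. N (\<lambda>x. (\<Sum>i<n. u i x) - g x)) \<longlonglongrightarrow> 0" "N g \<le> (\<Sum>n. N (u n))"
    using series_limit[OF u summ] by blast
  have Sn: "(\<lambda>x. \<Sum>i<n. u i x) \<in> B" for n by (intro sum_mem u)
  have "(\<lambda>n. L1_norm (\<lambda>x. (\<Sum>i<n. u i x) - g x)) \<longlonglongrightarrow> 0"
    by (rule L1_tendsto[OF Sn g(1,2)])
  then have "\<exists>r. strict_mono r \<and> (AE x in mI. (\<lambda>n. (\<Sum>i<r n. u i x) - g x) \<longlonglongrightarrow> 0)"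
    unfolding L1_norm_def
    by (intro tendsto_L1_AE_subseq integrable_mem diff_mem Sn g(1)) auto
  then obtain r where r: "strict_mono r" "AE x in mI. (\<lambda>n. (\<Sum>i<r n. u i x) - g x) \<longlonglongrightarrow> 0"
    by blast
  have "eq_ae g f"
    unfolding eq_ae_def using r(2) ae
  proof eventually_elim
    case (elim x)
    have "(\<lambda>n. (\<Sum>i<r n. u i x)) \<longlonglongrightarrow> f x"
      using LIMSEQ_subseq_LIMSEQ[OF elim(2) r(1)] by (simp add: o_def)
    moreover have "(\<lambda>n. (\<Sum>i<r n. u i x)) \<longlonglongrightarrow> g x"
      using elim(1) by (simp add: LIM_zero_iff)
    ultimately show ?case using LIMSEQ_unique by blast
  qed
  with g mem_ae N_ae show "f \<in> B" "N f \<le> (\<Sum>n. N (u n))" by metis+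
qed

lemma series_L1:
  assumes u: "\<And>n. u n \<in> B" and summ: "summable (\<lambda>n. N (u n))"
    and f: "integrable mI f" and L1: "(\<lambda>n. L1_norm (\<lambda>x. f x - (\<Sum>i<n. u i x))) \<longlonglongrightarrow> 0"
  shows "f \<in> B" "N f \<le> (\<Sum>n. N (u n))"
proof -
  obtain g where g: "g \<in> B" "(\<lambda>n. N (\<lambda>x. (\<Sum>i<n. u i x) - g x)) \<longlonglongrightarrow> 0" "N g \<le> (\<Sum>n. N (u n))"
    using series_limit[OF u summ] by blast
  have Sn: "(\<lambda>x. \<Sum>i<n. u i x) \<in> B" for n by (intro sum_mem u)
  have L: "(\<lambda>n. L1_norm (\<lambda>x. (\<Sum>i<n. u i x) - g x)) \<longlonglongrightarrow> 0"
    by (rule L1_tendsto[OF Sn g(1,2)])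
  have "L1_norm (\<lambda>x. f x - g x) \<le> L1_norm (\<lambda>x. f x - (\<Sum>i<n. u i x)) + L1_norm (\<lambda>x. (\<Sum>i<n. u i x) - g x)" for n
    using L1_norm_triangle[of "\<lambda>x. f x - (\<Sum>i<n. u i x)" "\<lambda>x. (\<Sum>i<n. u i x) - g x"]
      f integrable_mem[OF g(1)] integrable_mem[OF Sn[of n]] by simp
  moreover have "(\<lambda>n. L1_norm (\<lambda>x. f x - (\<Sum>i<n. u i x)) + L1_norm (\<lambda>x. (\<Sum>i<n. u i x) - g x)) \<longlonglongrightarrow> 0 + 0"
    by (intro tendsto_intros L L1)
  ultimately have "L1_norm (\<lambda>x. f x - g x) \<le> 0" by (intro LIMSEQ_le_const) auto
  moreover have "0 \<le> L1_norm (\<lambda>x. f x - g x)" by (simp add: L1_norm_def)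
  ultimately have "L1_norm (\<lambda>x. f x - g x) = 0" by simp
  moreover have "integrable mI (\<lambda>x. f x - g x)" using f integrable_mem[OF g(1)] by simp
  ultimately have "eq_ae (\<lambda>x. f x - g x) (\<lambda>x. 0)" by (intro L1_norm_eq_0)
  then have "eq_ae g f" unfolding eq_ae_def by eventually_elim auto
  with g mem_ae N_ae show "f \<in> B" "N f \<le> (\<Sum>n. N (u n))" by metis+
qed

end

section \<open>Piecewise smooth maps preserving Lebesgue measure\<close>

text \<open>Only the first derivative matters later, so higher smoothness is traded for the exponent
  \<open>min \<beta> 1\<close>: when \<open>\<beta> > 1\<close> a bounded second derivative makes
  the first one Lipschitz.\<close>

lemma holder_class_derivative:
  fixes g :: "real \<Rightarrow> real"
  assumes "0 < \<beta>" "a < b" and hc: "holder_class (1 + \<beta>) {a..b} g"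
  shows "\<exists>D H. (\<forall>x\<in>{a..b}. (g has_real_derivative D x) (at x within {a..b})) \<and>
    (\<forall>x\<in>{a..b}. \<forall>y\<in>{a..b}. \<bar>D x - D y\<bar> \<le> H * \<bar>x - y\<bar> powr min \<beta> 1)"
proof -
  define k where "k = nat \<lceil>\<beta>\<rceil>"
  have keq: "nat (\<lceil>1 + \<beta>\<rceil> - 1) = k"
  proof -
    have "\<lceil>1 + \<beta>\<rceil> = \<lceil>\<beta>\<rceil> + 1" by linarith
    then show ?thesis by (simp add: k_def)
  qed
  have k1: "1 \<le> k" using \<open>0 < \<beta>\<close> by (simp add: k_def) linarith
  obtain D H where D0: "\<forall>x\<in>{a..b}. D 0 x = g x"
    and DS: "\<forall>j<k. \<forall>x\<in>{a..b}. (D j has_real_derivative D (Suc j) x) (at x within {a..b})"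
    and DH: "\<forall>x\<in>{a..b}. \<forall>y\<in>{a..b}. \<bar>D k x - D k y\<bar> \<le> H * \<bar>x - y\<bar> powr (1 + \<beta> - real k)"
    using hc unfolding holder_class_def keq Let_def by blast
  have g: "(g has_real_derivative D 1 x) (at x within {a..b})" if "x \<in> {a..b}" for x
  proof (rule has_field_derivative_transform_within[of "D 0" _ _ _ 1])
    show "(D 0 has_real_derivative D 1 x) (at x within {a..b})" using DS k1 that by auto
  qed (use D0 that in auto)
  have "\<exists>H. \<forall>x\<in>{a..b}. \<forall>y\<in>{a..b}. \<bar>D 1 x - D 1 y\<bar> \<le> H * \<bar>x - y\<bar> powr min \<beta> 1"
  proof (cases "\<beta> \<le> 1")
    case True
    then have "k = 1" using k1 by (simp add: k_def) linarith
    then show ?thesis using DH True by (auto simp: min_def)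
  next
    case False
    then have k2: "2 \<le> k" by (simp add: k_def) linarith
    \<comment> \<open>For \<open>k = 2\<close> the second derivative is the top one and is bounded
      by comparison with its value at \<open>a\<close>, the exponent \<open>1 + \<beta> - k\<close>
      being nonnegative. For \<open>k > 2\<close> it is differentiable, hence continuous on a
      compact interval.\<close>
    have "\<exists>M. \<forall>x\<in>{a..b}. \<bar>D 2 x\<bar> \<le> M"
    proof (cases "k = 2")
      case True
      have ge: "0 \<le> 1 + \<beta> - real k" using False True by simp
      have "\<bar>D 2 x\<bar> \<le> \<bar>D 2 a\<bar> + \<bar>H\<bar> * (b - a) powr (1 + \<beta> - real k)" if x: "x \<in> {a..b}" for x
      proof -
        have "\<bar>D 2 x - D 2 a\<bar> \<le> H * \<bar>x - a\<bar> powr (1 + \<beta> - real k)"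
          using DH[rule_format, of x a] x True \<open>a < b\<close> by simp
        also have "\<dots> \<le> \<bar>H\<bar> * (b - a) powr (1 + \<beta> - real k)"
          using x ge by (intro mult_mono powr_mono2) auto
        finally show ?thesis by linarith
      qed
      then show ?thesis by blast
    next
      case False
      then have "2 < k" using k2 by simp
      then have "continuous_on {a..b} (D 2)"
        using DS by (intro DERIV_continuous_on[of _ _ "D (Suc 2)"]) auto
      then have "bounded (D 2 ` {a..b})"
        by (intro compact_imp_bounded compact_continuous_image) auto
      then show ?thesis by (auto simp: bounded_iff)
    qed
    then obtain M where M: "\<forall>x\<in>{a..b}. \<bar>D 2 x\<bar> \<le> M" by blast
    have "\<bar>D 1 x - D 1 y\<bar> \<le> M * \<bar>x - y\<bar> powr min \<beta> 1" if "x \<in> {a..b}" "y \<in> {a..b}" for x y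
    proof -
      have "(D 1 has_real_derivative D 2 z) (at z within {a..b})" if "z \<in> {a..b}" for z
        using DS[rule_format, of 1 z] k2 that by (simp add: numeral_2_eq_2)
      then have "norm (D 1 x - D 1 y) \<le> M * norm (x - y)"
        using M that by (intro field_differentiable_bound[of "{a..b}" "D 1" "D 2"]) auto
      then show ?thesis using False by (simp add: min_def)
    qed
    then show ?thesis by blast
  qed
  with g show ?thesis by blast
qed

lemma continuous_inj_strict_mono_cases:
  fixes g :: "real \<Rightarrow> real"
  assumes cont: "continuous_on {a..b} g" and inj: "inj_on g {a..b}" and "a < b"
  shows "(\<forall>x y. a \<le> x \<longrightarrow> x < y \<longrightarrow> y \<le> b \<longrightarrow> g x < g y) \<or>
         (\<forall>x y. a \<le> x \<longrightarrow> x < y \<longrightarrow> y \<le> b \<longrightarrow> g y < g x)"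
proof -
  have "strict_mono_on {a..b} g \<or> strict_antimono_on {a..b} g"
    using injective_eq_monotone_map[of "{a..b}" g] cont inj by (auto simp: is_interval_cc)
  then show ?thesis by (auto simp: monotone_on_def)
qed

text \<open>Locally the sublevel set is an interval with one end at the inverse branch
  \<open>h s\<close>, so its length is \<open>h s - a\<close> or \<open>b - h s\<close>, with
  derivative of size \<open>1 / \<bar>D (h t)\<bar>\<close>. At \<open>g a\<close> and
  \<open>g b\<close> the function has a kink, whence the exclusion; outside the range of
  \<open>g\<close> it is locally constant and the sum is empty.\<close>

lemma has_derivative_sublevel_measure:
  fixes g D :: "real \<Rightarrow> real"
  assumes "a < b" and cont: "continuous_on {a..b} g" and inj: "inj_on g {a..b}"
    and deriv: "\<And>y. y \<in> {a<..<b} \<Longrightarrow> (g has_real_derivative D y) (at y)"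
    and nz: "\<And>y. y \<in> {a<..<b} \<Longrightarrow> D y \<noteq> 0"
    and t: "t \<noteq> g a" "t \<noteq> g b"
  shows "((\<lambda>s. measure lebesgue {y\<in>{a<..<b}. g y \<le> s}) has_real_derivative
            (\<Sum>y | y \<in> {a<..<b} \<and> g y = t. 1 / \<bar>D y\<bar>)) (at t)"
proof -
  let ?F = "\<lambda>s. measure lebesgue {y\<in>{a<..<b}. g y \<le> s}"
  define c d where "c = min (g a) (g b)" and "d = max (g a) (g b)"
  have "g a \<noteq> g b" using inj \<open>a < b\<close> by (auto dest: inj_onD)
  then have "c < d" by (auto simp: c_def d_def)
  have range: "c < g y \<and> g y < d" if "y \<in> {a<..<b}" for y
    using continuous_inj_imp_mono[of a y b g] cont inj that by (auto simp: c_def d_def)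
  consider "t < c" | "d < t" | "c < t" "t < d" using t by (fastforce simp: c_def d_def)
  then show ?thesis
  proof cases
    case 1
    have "{y \<in> {a<..<b}. g y = t} = {}" using range 1 by force
    moreover have "(?F has_real_derivative 0) (at t)"
    proof (rule has_field_derivative_transform_within_open[of "\<lambda>_. 0" _ _ "{..<c}"])
      fix s assume "s \<in> {..<c}"
      then have "{y\<in>{a<..<b}. g y \<le> s} = {}" using range by force
      then show "0 = ?F s" by (metis measure_empty)
    qed (use 1 in auto)
    ultimately show ?thesis by (simp only: sum.empty)
  next
    case 2
    have "{y \<in> {a<..<b}. g y = t} = {}" using range 2 by force
    moreover have "(?F has_real_derivative 0) (at t)"
    proof (rule has_field_derivative_transform_within_open[of "\<lambda>_. ?F d" _ _ "{d<..}"])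
      fix s assume "s \<in> {d<..}"
      then have "{y\<in>{a<..<b}. g y \<le> s} = {y\<in>{a<..<b}. g y \<le> d}" using range by force
      then show "?F d = ?F s" by simp
    qed (use 2 in auto)
    ultimately show ?thesis by (simp only: sum.empty)
  next
    case 3
    define h where "h = the_inv_into {a..b} g"
    have img: "s \<in> g ` {a..b}" if "c \<le> s" "s \<le> d" for s
    proof -
      have "connected (g ` {a..b})" using cont by (intro connected_continuous_image) auto
      moreover have "c \<in> g ` {a..b}" "d \<in> g ` {a..b}"
        using \<open>a < b\<close> by (auto simp: c_def d_def min_def max_def)
      ultimately show ?thesis using that unfolding connected_iff_interval by blast
    qed
    have gh: "g (h s) = s" "h s \<in> {a..b}" if "c \<le> s" "s \<le> d" for s
      using img[OF that] f_the_inv_into_f[OF inj] the_inv_into_into[OF inj, of s "{a..b}"]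
      by (auto simp: h_def)
    have h_in: "h s \<in> {a<..<b}" if "c < s" "s < d" for s
    proof -
      have "s \<noteq> g a" "s \<noteq> g b" using that by (auto simp: c_def d_def)
      then have "h s \<noteq> a" "h s \<noteq> b" using gh(1)[of s] that by auto
      then show ?thesis using gh(2)[of s] that by auto
    qed
    have "continuous_on (g ` {a..b}) h"
      unfolding h_def by (intro continuous_on_inv_into cont inj) auto
    then have "continuous_on {c<..<d} h"
      by (rule continuous_on_subset) (use img in force)
    then have hcont: "isCont h t" using 3 by (simp add: continuous_on_eq_continuous_at)
    have hder: "(h has_real_derivative inverse (D (h t))) (at t)"
    proof (rule DERIV_inverse_function[of g _ _ _ c d])
      show "(g has_real_derivative D (h t)) (at (h t))" "D (h t) \<noteq> 0"
        using deriv nz h_in[OF 3] by blast+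
    qed (use 3 gh hcont in auto)
    have uniq: "{y \<in> {a<..<b}. g y = t} = {h t}"
    proof -
      have "y = h t" if "y \<in> {a<..<b}" "g y = t" for y
        using inj_onD[OF inj, of y "h t"] gh[of t] 3 that by auto
      moreover have "h t \<in> {a<..<b}" "g (h t) = t" using h_in[of t] gh[of t] 3 by auto
      ultimately show ?thesis by blast
    qed
    consider (inc) "\<forall>x y. a \<le> x \<longrightarrow> x < y \<longrightarrow> y \<le> b \<longrightarrow> g x < g y"
      | (dec) "\<forall>x y. a \<le> x \<longrightarrow> x < y \<longrightarrow> y \<le> b \<longrightarrow> g y < g x"
      using continuous_inj_strict_mono_cases[OF cont inj \<open>a < b\<close>] by blast
    then have "(?F has_real_derivative 1 / \<bar>D (h t)\<bar>) (at t)"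
    proof cases
      case inc
      have Feq: "?F s = h s - a" if s: "s \<in> {c<..<d}" for s
      proof -
        have hs: "h s \<in> {a<..<b}" "g (h s) = s" using h_in gh s by auto
        have "g y \<le> s \<longleftrightarrow> y \<le> h s" if "y \<in> {a<..<b}" for y
          using inc[rule_format, of y "h s"] inc[rule_format, of "h s" y] hs that
          by (cases y "h s" rule: linorder_cases) auto
        then have "{y\<in>{a<..<b}. g y \<le> s} = {a<..h s}" using hs(1) by auto
        then show ?thesis using hs by (simp only:) auto
      qed
      have "((\<lambda>s. h s - a) has_real_derivative inverse (D (h t))) (at t)"
        using hder by (auto intro!: derivative_eq_intros)
      then have Fd: "(?F has_real_derivative inverse (D (h t))) (at t)"
        by (rule has_field_derivative_transform_within_open[of _ _ _ "{c<..<d}"])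
          (use Feq 3 in auto)
      \<comment> \<open>The sign decides whether \<open>inverse (D (h t))\<close> or its negative
        equals \<open>1 / \<bar>D (h t)\<bar>\<close>; a negative derivative would contradict
        \<open>inc\<close>.\<close>
      have "0 \<le> D (h t)"
      proof (rule ccontr)
        assume "\<not> 0 \<le> D (h t)"
        then obtain e where e: "e > 0" "\<And>k. 0 < k \<Longrightarrow> k < e \<Longrightarrow> g (h t + k) < g (h t)"
          using DERIV_neg_dec_right[OF deriv[OF h_in[OF 3]]] by (metis not_le)
        define k where "k = min (e / 2) ((b - h t) / 2)"
        have "0 < k" "k < e" "h t + k \<le> b" using e h_in[OF 3] by (auto simp: k_def min_def field_simps)
        then show False using e(2)[of k] inc[rule_format, of "h t" "h t + k"] h_in[OF 3] by auto
      qed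
      then show ?thesis using Fd by (simp add: inverse_eq_divide)
    next
      case dec
      have Feq: "?F s = b - h s" if s: "s \<in> {c<..<d}" for s
      proof -
        have hs: "h s \<in> {a<..<b}" "g (h s) = s" using h_in gh s by auto
        have "g y \<le> s \<longleftrightarrow> h s \<le> y" if "y \<in> {a<..<b}" for y
          using dec[rule_format, of y "h s"] dec[rule_format, of "h s" y] hs that
          by (cases y "h s" rule: linorder_cases) auto
        then have "{y\<in>{a<..<b}. g y \<le> s} = {h s..<b}" using hs(1) by auto
        then show ?thesis using hs by (simp only:) auto
      qed
      have "((\<lambda>s. b - h s) has_real_derivative - inverse (D (h t))) (at t)"
        using hder by (auto intro!: derivative_eq_intros)
      then have Fd: "(?F has_real_derivative - inverse (D (h t))) (at t)"
        by (rule has_field_derivative_transform_within_open[of _ _ _ "{c<..<d}"])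
          (use Feq 3 in auto)
      have "D (h t) \<le> 0"
      proof (rule ccontr)
        assume "\<not> D (h t) \<le> 0"
        then obtain e where e: "e > 0" "\<And>k. 0 < k \<Longrightarrow> k < e \<Longrightarrow> g (h t) < g (h t + k)"
          using DERIV_pos_inc_right[OF deriv[OF h_in[OF 3]]] by (metis not_le)
        define k where "k = min (e / 2) ((b - h t) / 2)"
        have "0 < k" "k < e" "h t + k \<le> b" using e h_in[OF 3] by (auto simp: k_def min_def field_simps)
        then show False using e(2)[of k] dec[rule_format, of "h t" "h t + k"] h_in[OF 3] by auto
      qed
      then show ?thesis using Fd by (simp add: inverse_eq_divide)
    qed
    then show ?thesis unfolding uniq by simp
  qed
qed

lemma AE_mI_finite: "finite F \<Longrightarrow> (\<And>x. x \<in> {0..1} \<Longrightarrow> x \<notin> F \<Longrightarrow> Q x) \<Longrightarrow> AE x in mI. Q x"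
proof -
  assume F: "finite F" and Q: "\<And>x. x \<in> {0..1} \<Longrightarrow> x \<notin> F \<Longrightarrow> Q x"
  have "F \<in> null_sets lebesgue" using F negligible_finite by (simp add: negligible_iff_null_sets[symmetric])
  then have "AE x in lebesgue. x \<notin> F" by (rule AE_not_in)
  then have "AE x in lebesgue. x \<in> {0..1} \<longrightarrow> Q x" by eventually_elim (use Q in auto)
  then show ?thesis by (subst AE_restrict_space_iff) auto
qed

lemma integrable_mI_bounded:
  fixes f :: "real \<Rightarrow> 'a::{second_countable_topology,banach}"
  assumes "f \<in> borel_measurable mI" "\<And>x. x \<in> {0..1} \<Longrightarrow> norm (f x) \<le> M"
  shows "integrable mI f"
proof (rule integrableI_bounded_set[where A="{0..1}" and B=M])
  show "emeasure mI {0..1} < \<infinity>" by (simp add: emeasure_restrict_space)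
qed (use assms in \<open>auto intro: AE_I2\<close>)

locale lebesgue_preserving_map =
  fixes P :: "real set set" and T :: "real \<Rightarrow> real" and \<beta> :: real
  assumes part: "interval_partition P"
    and range: "\<forall>x\<in>\<Union>P. T x \<in> {0..1}"
    and beta: "0 < \<beta>"
    and pieces: "\<forall>J\<in>P. \<exists>g. (\<forall>x\<in>J. g x = T x) \<and> holder_diffeo (1 + \<beta>) (closure J) g"
    and pres: "preserves_lebesgue P T"
begin

abbreviation X where "X \<equiv> \<Union>P"

lemma finite_P: "finite P" and finite_gap: "finite ({0..1} - X)" and disjoint_P: "disjoint P"
  and X_subset: "X \<subseteq> {0..1}"
  using part unfolding interval_partition_def by auto

lemma piece_interval: "J \<in> P \<Longrightarrow> \<exists>a b. a < b \<and> J = {a<..<b}"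
  using part unfolding interval_partition_def by auto

lemma open_piece: "J \<in> P \<Longrightarrow> open J"
  using piece_interval by fastforce

lemma X_open: "open X"
  using open_piece by blast

lemma piece_props:
  assumes "J \<in> P"
  obtains a b g D H where "a < b" "J = {a<..<b}" "\<forall>x\<in>J. g x = T x" "inj_on g {a..b}"
    "\<forall>x\<in>{a..b}. (g has_real_derivative D x) (at x within {a..b})"
    "\<forall>x\<in>{a..b}. \<forall>y\<in>{a..b}. \<bar>D x - D y\<bar> \<le> H * \<bar>x - y\<bar> powr min \<beta> 1"
proof -
  obtain a b where ab: "a < b" "J = {a<..<b}" using piece_interval[OF assms] by blast
  obtain g where g: "\<forall>x\<in>J. g x = T x" "holder_diffeo (1 + \<beta>) (closure J) g"
    using pieces assms by blast
  have cl: "closure J = {a..b}" using ab by simp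
  have hd: "inj_on g {a..b}" "holder_class (1 + \<beta>) {a..b} g"
    using g(2) unfolding holder_diffeo_def cl by blast+
  obtain D H where DH: "\<forall>x\<in>{a..b}. (g has_real_derivative D x) (at x within {a..b})"
    "\<forall>x\<in>{a..b}. \<forall>y\<in>{a..b}. \<bar>D x - D y\<bar> \<le> H * \<bar>x - y\<bar> powr min \<beta> 1"
    using holder_class_derivative[OF beta ab(1) hd(2)] by blast
  show ?thesis by (rule that[OF ab g(1) hd(1) DH])
qed

lemma DERIV_piece:
  assumes "\<forall>x\<in>{a<..<b}. g x = T x" "x \<in> {a<..<b}"
    "(g has_real_derivative d) (at x within {a..b})"
  shows "(T has_real_derivative d) (at x)" "(g has_real_derivative d) (at x)"
proof -
  have "x \<in> interior {a..b}" using assms(2) by simp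
  then show "(g has_real_derivative d) (at x)"
    using assms(3) by (simp only: at_within_interior)
  then show "(T has_real_derivative d) (at x)"
    by (rule has_field_derivative_transform_within_open[of _ _ _ "{a<..<b}"]) (use assms in auto)
qed

lemma inj_on_piece: "J \<in> P \<Longrightarrow> inj_on T J"
proof -
  assume "J \<in> P"
  then obtain a b g where *: "J = {a<..<b}" "\<forall>x\<in>J. g x = T x" "inj_on g {a..b}"
    by (rule piece_props)
  then have "inj_on g J" by (auto intro: inj_on_subset)
  then show ?thesis using * by (auto simp: inj_on_def)
qed

lemma same_piece: "J \<in> P \<Longrightarrow> J' \<in> P \<Longrightarrow> x \<in> J \<Longrightarrow> x \<in> J' \<Longrightarrow> J = J'"
  using disjoint_P by (auto simp: disjoint_def)

lemma T_measurable: "T \<in> measurable (lebesgue_on X) mI"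
  and T_distr: "distr (lebesgue_on X) mI T = mI"
  using pres unfolding preserves_lebesgue_def by auto

lemma X_lebesgue: "X \<in> sets lebesgue"
  using X_open by auto

lemma AE_mI_iff: "(AE x in mI. Q x) \<longleftrightarrow> (AE x in lebesgue_on X. Q x)"
proof -
  have "{0..1} - X \<in> null_sets lebesgue"
    using finite_gap negligible_finite by (simp add: negligible_iff_null_sets[symmetric])
  then have ae: "AE x in lebesgue. x \<notin> {0..1} - X" by (rule AE_not_in)
  have "AE x in lebesgue. (x \<in> {0..1} \<longrightarrow> Q x) = (x \<in> X \<longrightarrow> Q x)"
    using ae by eventually_elim (use X_subset in blast)
  then have "(AE x in lebesgue. x \<in> {0..1} \<longrightarrow> Q x) \<longleftrightarrow> (AE x in lebesgue. x \<in> X \<longrightarrow> Q x)"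
    by (rule eventually_subst)
  then show ?thesis using X_lebesgue by (simp add: AE_restrict_space_iff)
qed

lemma AE_pullback: "AE x in mI. Q x \<Longrightarrow> AE x in mI. x \<in> X \<and> Q (T x)"
proof -
  assume "AE x in mI. Q x"
  then have "AE x in distr (lebesgue_on X) mI T. Q x" by (simp only: T_distr)
  then have "AE x in lebesgue_on X. Q (T x)" by (rule AE_distrD[OF T_measurable])
  moreover have "AE x in lebesgue_on X. x \<in> X" using X_lebesgue by (auto intro!: AE_I2 simp: space_restrict_space)
  ultimately have "AE x in lebesgue_on X. x \<in> X \<and> Q (T x)" by eventually_elim auto
  then show ?thesis by (simp only: AE_mI_iff)
qed

lemma emeasure_preimage:
  assumes "A \<in> sets lebesgue" "A \<subseteq> {0..1}"
  shows "{x\<in>X. T x \<in> A} \<in> sets lebesgue" "emeasure lebesgue {x\<in>X. T x \<in> A} = emeasure lebesgue A"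
proof -
  have A: "A \<in> sets mI" using assms by (auto simp: sets_restrict_space_iff)
  have eq: "T -` A \<inter> space (lebesgue_on X) = {x\<in>X. T x \<in> A}" by auto
  have s: "{x\<in>X. T x \<in> A} \<in> sets (lebesgue_on X)"
    using measurable_sets[OF T_measurable A] by (simp only: eq)
  then show "{x\<in>X. T x \<in> A} \<in> sets lebesgue"
    using X_lebesgue by (simp add: sets_restrict_space_iff)
  have "emeasure mI A = emeasure (lebesgue_on X) {x\<in>X. T x \<in> A}"
    using emeasure_distr[OF T_measurable A] by (simp only: T_distr eq)
  moreover have "emeasure mI A = emeasure lebesgue A"
    using assms by (intro emeasure_restrict_space) auto
  moreover have "emeasure (lebesgue_on X) {x\<in>X. T x \<in> A} = emeasure lebesgue {x\<in>X. T x \<in> A}"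
    using X_lebesgue by (intro emeasure_restrict_space) auto
  ultimately show "emeasure lebesgue {x\<in>X. T x \<in> A} = emeasure lebesgue A" by simp
qed

lemma measure_preimage:
  assumes "A \<in> sets lebesgue" "A \<subseteq> {0..1}"
  shows "measure lebesgue {x\<in>X. T x \<in> A} = measure lebesgue A"
  using emeasure_preimage[OF assms] by (simp add: measure_def)

text \<open>Invariance is stated over \<open>X\<close> while norms use \<open>mI\<close>, and
  \<open>T\<close> is unconstrained off \<open>X\<close>. The two integrands differ by a finite
  combination \<open>g\<close> of point indicators, which is integrable with integral 0; no
  measurability of \<open>u\<close> is involved.\<close>

lemma integral_mI_eq:
  fixes u :: "real \<Rightarrow> 'a::{banach, second_countable_topology}"
  shows "integrable mI u \<longleftrightarrow> integrable (lebesgue_on X) u"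
    "integral\<^sup>L mI u = integral\<^sup>L (lebesgue_on X) u"
proof -
  define F where "F = {0..1} - X"
  define g where "g = (\<lambda>x. \<Sum>p\<in>F. indicator {p} x *\<^sub>R u p)"
  have fin: "finite F" using finite_gap by (simp add: F_def)
  have g: "integrable lebesgue g" "integral\<^sup>L lebesgue g = 0"
    unfolding g_def by (auto intro!: Bochner_Integration.integrable_sum
        simp: Bochner_Integration.integral_sum)
  have eq: "(\<lambda>x. indicator {0..1} x *\<^sub>R u x) = (\<lambda>x. indicator X x *\<^sub>R u x + g x)"
  proof
    fix x
    have "g x = (if x \<in> F then u x else 0)"
    proof -
      have "g x = (\<Sum>p\<in>F. if p = x then u p else 0)"
        unfolding g_def by (intro sum.cong) (auto simp: indicator_def)
      then show ?thesis using fin by (simp add: sum.delta)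
    qed
    then show "indicator {0..1} x *\<^sub>R u x = indicator X x *\<^sub>R u x + g x"
      using X_subset by (auto simp: F_def indicator_def)
  qed
  have iff: "integrable lebesgue (\<lambda>x. indicator {0..1} x *\<^sub>R u x) \<longleftrightarrow>
        integrable lebesgue (\<lambda>x. indicator X x *\<^sub>R u x)"
    unfolding eq using g(1) Bochner_Integration.integrable_diff[OF _ g(1), of "\<lambda>x. indicator X x *\<^sub>R u x + g x"] by auto
  then show "integrable mI u \<longleftrightarrow> integrable (lebesgue_on X) u"
    using X_lebesgue by (simp add: integrable_restrict_space)
  have "integral\<^sup>L lebesgue (\<lambda>x. indicator {0..1} x *\<^sub>R u x) = integral\<^sup>L lebesgue (\<lambda>x. indicator X x *\<^sub>R u x)"
  proof (cases "integrable lebesgue (\<lambda>x. indicator X x *\<^sub>R u x)")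
    case True
    then show ?thesis unfolding eq using g by simp
  next
    case False
    then show ?thesis using iff by (simp add: not_integrable_integral_eq)
  qed
  then show "integral\<^sup>L mI u = integral\<^sup>L (lebesgue_on X) u"
    using X_lebesgue by (simp add: integral_restrict_space)
qed

lemma integral_comp:
  fixes u :: "real \<Rightarrow> 'a::{banach, second_countable_topology}"
  assumes "integrable mI u"
  shows "integrable mI (\<lambda>x. u (T x))" "(\<integral>x. u (T x) \<partial>mI) = (\<integral>x. u x \<partial>mI)"
proof -
  have u: "u \<in> borel_measurable mI" using assms by auto
  have "integrable (distr (lebesgue_on X) mI T) u" using assms by (simp only: T_distr)
  then have "integrable (lebesgue_on X) (\<lambda>x. u (T x))"
    by (rule integrable_distr[OF T_measurable])
  then show "integrable mI (\<lambda>x. u (T x))" by (simp only: integral_mI_eq)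
  have "(\<integral>x. u x \<partial>mI) = (\<integral>x. u x \<partial>distr (lebesgue_on X) mI T)" by (simp only: T_distr)
  also have "\<dots> = (\<integral>x. u (T x) \<partial>lebesgue_on X)" by (rule integral_distr[OF T_measurable u])
  finally show "(\<integral>x. u (T x) \<partial>mI) = (\<integral>x. u x \<partial>mI)" by (simp only: integral_mI_eq)
qed

lemma integral_comp_power:
  fixes u :: "real \<Rightarrow> 'a::{banach, second_countable_topology}"
  assumes "integrable mI u"
  shows "integrable mI (\<lambda>x. u ((T ^^ k) x)) \<and> (\<integral>x. u ((T ^^ k) x) \<partial>mI) = (\<integral>x. u x \<partial>mI)"
proof (induction k)
  case (Suc k)
  then show ?case
    using integral_comp[of "\<lambda>x. u ((T ^^ k) x)"] by (simp add: funpow_swap1)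
qed (use assms in auto)

lemma AE_pullback_power: "AE x in mI. Q x \<Longrightarrow> AE x in mI. Q ((T ^^ k) x)"
proof (induction k)
  case (Suc k)
  then have "AE x in mI. Q ((T ^^ k) x)" by blast
  from AE_pullback[OF this] show ?case by eventually_elim (simp add: funpow_swap1)
qed auto

text \<open>By monotonicity \<open>{u..v}\<close> inside a piece is contained in the preimage of the
  interval spanned by \<open>T u\<close> and \<open>T v\<close>, and invariance gives that preimage
  the length of the interval. So invariance of Lebesgue measure forbids contraction; the bounds
  \<open>1 \<le> \<bar>deriv T x\<bar>\<close> and \<open>theta T k J \<le> 1\<close> come from
  here.\<close>

lemma expansion:
  assumes "J \<in> P" "x \<in> J" "y \<in> J"
  shows "\<bar>x - y\<bar> \<le> \<bar>T x - T y\<bar>"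
proof -
  have *: "v - u \<le> \<bar>T u - T v\<bar>" if uv: "u < v" "u \<in> J" "v \<in> J" for u v
  proof -
    obtain a b g D H where g: "a < b" "J = {a<..<b}" "\<forall>x\<in>J. g x = T x" "inj_on g {a..b}"
      "\<forall>x\<in>{a..b}. (g has_real_derivative D x) (at x within {a..b})"
      using assms(1) by (rule piece_props)
    have cont: "continuous_on {a..b} g" using g(5) by (intro DERIV_continuous_on) auto
    let ?S = "{min (T u) (T v)..max (T u) (T v)}"
    have "T w \<in> ?S" if w: "w \<in> {u..v}" for w
    proof (cases "u < w \<and> w < v")
      case True
      have "{u..v} \<subseteq> {a..b}" using uv g(2) by auto
      then have "continuous_on {u..v} g" "inj_on g {u..v}"
        using continuous_on_subset[OF cont] inj_on_subset[OF g(4)] by blast+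
      then have "g u < g w \<and> g w < g v \<or> g v < g w \<and> g w < g u"
        using continuous_inj_imp_mono[of u w v g] True by blast
      moreover have "u \<in> J" "w \<in> J" "v \<in> J" using uv w g(2) by auto
      ultimately show ?thesis using g(3) by (auto simp: min_def max_def)
    next
      case False
      then have "w = u \<or> w = v" using w by auto
      then show ?thesis by auto
    qed
    moreover have sub: "{u..v} \<subseteq> X"
    proof -
      have "{u..v} \<subseteq> J" using uv g(2) by auto
      then show ?thesis using assms(1) by blast
    qed
    ultimately have "{u..v} \<subseteq> {x\<in>X. T x \<in> ?S}" by blast
    moreover have S: "?S \<in> sets lebesgue" "?S \<subseteq> {0..1}"
    proof -
      have "T u \<in> {0..1}" "T v \<in> {0..1}" using range uv assms(1) by blast+
      then show "?S \<subseteq> {0..1}" by auto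
    qed simp
    ultimately have "emeasure lebesgue {u..v} \<le> emeasure lebesgue {x\<in>X. T x \<in> ?S}"
      using emeasure_preimage(1)[OF S] by (intro emeasure_mono)
    then have "emeasure lebesgue {u..v} \<le> emeasure lebesgue ?S"
      by (simp only: emeasure_preimage(2)[OF S])
    then have "ennreal (v - u) \<le> ennreal (max (T u) (T v) - min (T u) (T v))"
      using uv by simp
    then have "v - u \<le> max (T u) (T v) - min (T u) (T v)"
      by (subst (asm) ennreal_le_iff) auto
    then show ?thesis by linarith
  qed
  show ?thesis using *[of x y] *[of y x] assms by (cases x y rule: linorder_cases) auto
qed

lemma DERIV_T:
  assumes "x \<in> X"
  shows "(T has_real_derivative deriv T x) (at x)" "1 \<le> \<bar>deriv T x\<bar>"
proof -
  obtain J where J: "J \<in> P" "x \<in> J" using assms by blast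
  obtain a b g D H where g: "a < b" "J = {a<..<b}" "\<forall>x\<in>J. g x = T x" "inj_on g {a..b}"
    "\<forall>x\<in>{a..b}. (g has_real_derivative D x) (at x within {a..b})"
    using J(1) by (rule piece_props)
  have x: "x \<in> {a<..<b}" "x \<in> {a..b}" using J g by auto
  have d: "(T has_real_derivative D x) (at x)"
    using DERIV_piece(1)[of a b g x "D x"] g x by blast
  then show d': "(T has_real_derivative deriv T x) (at x)" by (simp add: DERIV_imp_deriv)
  have "(\<lambda>y. \<bar>(T y - T x) / (y - x)\<bar>) \<midarrow>x\<rightarrow> \<bar>deriv T x\<bar>"
    using d' by (intro tendsto_rabs) (simp add: has_field_derivative_iff)
  moreover have "\<forall>\<^sub>F y in at x. 1 \<le> \<bar>(T y - T x) / (y - x)\<bar>"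
  proof -
    have "\<forall>\<^sub>F y in at x. y \<in> J" using J open_piece by (simp add: eventually_at_in_open')
    moreover have "\<forall>\<^sub>F y in at x. y \<noteq> x" by (simp add: eventually_at_filter)
    ultimately show ?thesis
    proof eventually_elim
      case (elim y)
      then show ?case using expansion[OF J(1), of y x] J by (simp add: abs_divide)
    qed
  qed
  ultimately show "1 \<le> \<bar>deriv T x\<bar>" by (intro tendsto_lowerbound) auto
qed

lemma isCont_T: "x \<in> X \<Longrightarrow> isCont T x"
  using DERIV_T DERIV_isCont by blast

text \<open>The dyadic approximation of \<open>holder_comp\<close> samples its function at points
  that may lie off the piece, so a Hoelder function on the whole line is required. Clamping the
  argument to the closed piece is 1-Lipschitz and thus keeps the Hoelder bound.\<close>

lemma deriv_holder_extension:
  assumes "J \<in> P"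
  obtains f H where "\<And>x. x \<in> J \<Longrightarrow> f x = \<bar>deriv T x\<bar>"
    "\<And>x y. \<bar>f x - f y\<bar> \<le> H * \<bar>x - y\<bar> powr min \<beta> 1" "0 \<le> H"
proof -
  obtain a b g D H where g: "a < b" "J = {a<..<b}" "\<forall>x\<in>J. g x = T x" "inj_on g {a..b}"
    "\<forall>x\<in>{a..b}. (g has_real_derivative D x) (at x within {a..b})"
    "\<forall>x\<in>{a..b}. \<forall>y\<in>{a..b}. \<bar>D x - D y\<bar> \<le> H * \<bar>x - y\<bar> powr min \<beta> 1"
    using assms by (rule piece_props)
  define cl where "cl = (\<lambda>x. max a (min b x))"
  show ?thesis
  proof (rule that[of "\<lambda>x. \<bar>D (cl x)\<bar>" "\<bar>H\<bar>"])
    fix x assume x: "x \<in> J"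
    then have "cl x = x" using g by (auto simp: cl_def)
    moreover have "(T has_real_derivative D x) (at x)"
      using DERIV_piece(1)[of a b g x "D x"] g x by auto
    ultimately show "\<bar>D (cl x)\<bar> = \<bar>deriv T x\<bar>" by (simp add: DERIV_imp_deriv)
  next
    fix x y
    have "\<bar>\<bar>D (cl x)\<bar> - \<bar>D (cl y)\<bar>\<bar> \<le> \<bar>D (cl x) - D (cl y)\<bar>" by linarith
    also have "\<dots> \<le> H * \<bar>cl x - cl y\<bar> powr min \<beta> 1"
      using g(1,6) by (auto simp: cl_def)
    also have "\<dots> \<le> \<bar>H\<bar> * \<bar>x - y\<bar> powr min \<beta> 1"
      using beta by (intro mult_mono powr_mono2) (auto simp: cl_def)
    finally show "\<bar>\<bar>D (cl x)\<bar> - \<bar>D (cl y)\<bar>\<bar> \<le> \<bar>H\<bar> * \<bar>x - y\<bar> powr min \<beta> 1" .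
  qed auto
qed

lemma fibre_finite: "finite {y \<in> X. T y = x}"
proof -
  have "{y \<in> X. T y = x} = (\<Union>J\<in>P. {y\<in>J. T y = x})" by auto
  moreover have "finite {y\<in>J. T y = x}" if "J \<in> P" for J
  proof -
    have "{y\<in>J. T y = x} \<subseteq> {the_inv_into J T x}"
      using inj_on_piece[OF that] by (auto simp: the_inv_into_f_f)
    then show ?thesis by (rule finite_subset) auto
  qed
  ultimately show ?thesis using finite_P by auto
qed

text \<open>By invariance the sublevel measures of the pieces add up to \<open>s\<close> for
  \<open>0 < s < 1\<close>. Differentiating this identity in \<open>s\<close> gives the fibre sum,
  except at the finitely many values in which some piece has a kink.\<close>

lemma transfer_one: "AE x in mI. (\<Sum>y | y \<in> X \<and> T y = x. 1 / \<bar>deriv T y\<bar>) = 1"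
proof -
  have ex: "\<exists>E. finite E \<and> (\<forall>t. t \<notin> E \<longrightarrow> ((\<lambda>s. measure lebesgue {y\<in>J. T y \<le> s}) has_real_derivative
          (\<Sum>y | y \<in> J \<and> T y = t. 1 / \<bar>deriv T y\<bar>)) (at t))" if J: "J \<in> P" for J
  proof -
    obtain a b g D H where g: "a < b" "J = {a<..<b}" "\<forall>x\<in>J. g x = T x" "inj_on g {a..b}"
      "\<forall>x\<in>{a..b}. (g has_real_derivative D x) (at x within {a..b})"
      using J by (rule piece_props)
    have cont: "continuous_on {a..b} g" using g(5) by (intro DERIV_continuous_on) auto
    have D: "(g has_real_derivative deriv T y) (at y)" "deriv T y \<noteq> 0" if y: "y \<in> {a<..<b}" for y
    proof -
      have "(T has_real_derivative D y) (at y)" "(g has_real_derivative D y) (at y)"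
        using DERIV_piece[of a b g y "D y"] g y by auto
      then show "(g has_real_derivative deriv T y) (at y)" by (simp add: DERIV_imp_deriv)
      show "deriv T y \<noteq> 0" using DERIV_T(2)[of y] J y g(2) by force
    qed
    have eq: "{y\<in>{a<..<b}. g y \<le> s} = {y\<in>J. T y \<le> s}"
      "{y. y \<in> {a<..<b} \<and> g y = s} = {y. y \<in> J \<and> T y = s}" for s
      using g(2,3) by auto
    show ?thesis
      using has_derivative_sublevel_measure[OF g(1) cont g(4) D] unfolding eq
      by (intro exI[of _ "{g a, g b}"]) auto
  qed
  have "\<exists>E. \<forall>J\<in>P. finite (E J) \<and> (\<forall>t. t \<notin> E J \<longrightarrow> ((\<lambda>s. measure lebesgue {y\<in>J. T y \<le> s}) has_real_derivative
          (\<Sum>y | y \<in> J \<and> T y = t. 1 / \<bar>deriv T y\<bar>)) (at t))"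
    by (rule bchoice) (use ex in blast)
  then obtain E where E: "\<And>J. J \<in> P \<Longrightarrow> finite (E J)" "\<And>J t. J \<in> P \<Longrightarrow> t \<notin> E J \<Longrightarrow>
      ((\<lambda>s. measure lebesgue {y\<in>J. T y \<le> s}) has_real_derivative
          (\<Sum>y | y \<in> J \<and> T y = t. 1 / \<bar>deriv T y\<bar>)) (at t)" by blast
  have tot: "(\<Sum>J\<in>P. measure lebesgue {y\<in>J. T y \<le> s}) = s" if s: "s \<in> {0<..<1}" for s
  proof -
    have A: "{0..s} \<in> sets lebesgue" "{0..s} \<subseteq> {0..1}" using s by auto
    have eqJ: "{y\<in>J. T y \<le> s} = {y\<in>X. T y \<in> {0..s}} \<inter> J" if "J \<in> P" for J
      using that range by auto
    have mJ: "{y\<in>J. T y \<le> s} \<in> sets lebesgue" if "J \<in> P" for J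
      unfolding eqJ[OF that] using emeasure_preimage(1)[OF A] open_piece[OF that] by auto
    have "(\<Sum>J\<in>P. measure lebesgue {y\<in>J. T y \<le> s}) = measure lebesgue (\<Union>J\<in>P. {y\<in>J. T y \<le> s})"
    proof (rule measure_finite_Union[symmetric])
      show "disjoint_family_on (\<lambda>J. {y \<in> J. T y \<le> s}) P"
        using same_piece by (auto simp: disjoint_family_on_def)
      fix J assume J: "J \<in> P"
      have "{y\<in>J. T y \<le> s} \<subseteq> {0..1}" using J X_subset by auto
      then have "emeasure lebesgue {y\<in>J. T y \<le> s} \<le> emeasure lebesgue {0..1::real}"
        by (intro emeasure_mono) auto
      also have "\<dots> < \<infinity>" by simp
      finally show "emeasure lebesgue {y\<in>J. T y \<le> s} \<noteq> \<infinity>" by simp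
    qed (use finite_P mJ in auto)
    also have "(\<Union>J\<in>P. {y\<in>J. T y \<le> s}) = {y\<in>X. T y \<in> {0..s}}"
      using range by auto
    also have "measure lebesgue \<dots> = s" using measure_preimage[OF A] s by simp
    finally show ?thesis .
  qed
  have sum1: "(\<Sum>y | y \<in> X \<and> T y = t. 1 / \<bar>deriv T y\<bar>) = 1"
    if t: "t \<in> {0<..<1}" "t \<notin> (\<Union>J\<in>P. E J)" for t
  proof -
    have "((\<lambda>s. \<Sum>J\<in>P. measure lebesgue {y\<in>J. T y \<le> s}) has_real_derivative
        (\<Sum>J\<in>P. \<Sum>y | y \<in> J \<and> T y = t. 1 / \<bar>deriv T y\<bar>)) (at t)"
      using t by (intro DERIV_sum E) auto
    moreover have "((\<lambda>s. \<Sum>J\<in>P. measure lebesgue {y\<in>J. T y \<le> s}) has_real_derivative 1) (at t)"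
      by (rule has_field_derivative_transform_within_open[of "\<lambda>s. s" _ _ "{0<..<1}"])
        (use t tot in \<open>auto intro: DERIV_ident\<close>)
    ultimately have "(\<Sum>J\<in>P. \<Sum>y | y \<in> J \<and> T y = t. 1 / \<bar>deriv T y\<bar>) = 1"
      by (rule DERIV_unique)
    moreover have "(\<Sum>y\<in>(\<Union>J\<in>P. {y. y \<in> J \<and> T y = t}). 1 / \<bar>deriv T y\<bar>) =
        (\<Sum>J\<in>P. \<Sum>y | y \<in> J \<and> T y = t. 1 / \<bar>deriv T y\<bar>)"
      by (rule sum.UNION_disjoint)
        (use finite_P same_piece in \<open>auto intro: finite_subset[OF _ fibre_finite[of t]]\<close>)
    moreover have "(\<Union>J\<in>P. {y. y \<in> J \<and> T y = t}) = {y. y \<in> X \<and> T y = t}" by auto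
    ultimately show ?thesis by simp
  qed
  show ?thesis
  proof (rule AE_mI_finite[of "{0, 1} \<union> (\<Union>J\<in>P. E J)"])
    show "finite ({0, 1} \<union> (\<Union>J\<in>P. E J))" using finite_P E(1) by auto
    fix t :: real assume "t \<in> {0..1}" "t \<notin> {0, 1} \<union> (\<Union>J\<in>P. E J)"
    then show "(\<Sum>y | y \<in> X \<and> T y = t. 1 / \<bar>deriv T y\<bar>) = 1" by (intro sum1) auto
  qed
qed

end

section \<open>Lengths and preimages of intervals; Fekete's lemma\<close>

lemma interval_lmeasurable:
  fixes S :: "real set"
  assumes "is_interval S" "S \<subseteq> {0..1}"
  shows "S \<in> sets lebesgue" "S \<in> lmeasurable"
proof -
  have "bounded S" using assms(2) bounded_subset[of "{0..1}" S] by auto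
  moreover have "convex S" using assms(1) by (simp add: is_interval_convex)
  ultimately show "S \<in> lmeasurable" using measurable_convex by blast
  then show "S \<in> sets lebesgue" by auto
qed

lemma measure_le_diameter:
  fixes S :: "real set"
  assumes S: "S \<subseteq> {0..1}" and "0 \<le> M" and le: "\<And>x y. x \<in> S \<Longrightarrow> y \<in> S \<Longrightarrow> x < y \<Longrightarrow> y - x \<le> M"
  shows "measure lebesgue S \<le> M"
proof (cases "S = {}")
  case False
  have bdd: "bdd_below S" "bdd_above S" using bdd_below_mono[OF _ S] bdd_above_mono[OF _ S] by auto
  have le': "y - x \<le> M" if "x \<in> S" "y \<in> S" for x y
    using le[OF that] \<open>0 \<le> M\<close> by (cases "x < y") auto
  have "Sup S \<le> Inf S + M"
  proof (rule cSup_least[OF False])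
    fix x assume x: "x \<in> S"
    have "x - M \<le> Inf S" using le'[OF _ x] False by (intro cInf_greatest) force+
    then show "x \<le> Inf S + M" by simp
  qed
  moreover have sub: "S \<subseteq> {Inf S..Sup S}" using bdd by (auto intro: cInf_lower cSup_upper)
  moreover have "measure lebesgue S \<le> measure lebesgue {Inf S..Sup S}" if "S \<in> sets lebesgue"
    using sub that by (intro measure_mono_fmeasurable) auto
  moreover have "Inf S \<le> Sup S" using False bdd by (metis cInf_le_cSup)
  ultimately show ?thesis using \<open>0 \<le> M\<close> by (cases "S \<in> sets lebesgue") (auto simp: measure_notin_sets)
qed (use \<open>0 \<le> M\<close> in auto)

lemma interval_preimage:
  fixes f :: "real \<Rightarrow> real"
  assumes "is_interval J" "continuous_on J f" "inj_on f J" "is_interval Q"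
  shows "is_interval {x\<in>J. f x \<in> Q}"
proof -
  have J: "\<And>a b i. a \<in> J \<Longrightarrow> b \<in> J \<Longrightarrow> a \<le> i \<Longrightarrow> i \<le> b \<Longrightarrow> i \<in> J"
    and Q: "\<And>a b i. a \<in> Q \<Longrightarrow> b \<in> Q \<Longrightarrow> a \<le> i \<Longrightarrow> i \<le> b \<Longrightarrow> i \<in> Q"
    using assms(1,4) unfolding is_interval_1 by blast+
  have "strict_mono_on J f \<or> strict_antimono_on J f"
    using injective_eq_monotone_map[OF assms(1,2)] assms(3) by simp
  then have "f i \<in> Q" if "a \<in> J" "b \<in> J" "f a \<in> Q" "f b \<in> Q" "a \<le> i" "i \<le> b" for a b i
  proof
    assume m: "strict_mono_on J f"
    have "f a \<le> f i" "f i \<le> f b"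
      using strict_mono_on_imp_mono_on[OF m] J[of a b i] that by (auto simp: monotone_on_def)
    then show ?thesis using Q that by blast
  next
    assume m: "strict_antimono_on J f"
    have "f x \<ge> f y" if "x \<in> J" "y \<in> J" "x \<le> y" for x y
      using m that by (cases "x = y") (auto simp: monotone_on_def less_le)
    then have "f i \<le> f a" "f b \<le> f i" using J[of a b i] that by auto
    then show ?thesis using Q that by blast
  qed
  then show ?thesis unfolding is_interval_1 using J by blast
qed

text \<open>Fekete's lemma in multiplicative form.\<close>

lemma submultiplicative_root_convergent:
  fixes a :: "nat \<Rightarrow> real"
  assumes ge1: "\<And>k. 1 \<le> a k" and sub: "\<And>k m. a (k + m) \<le> a k * a m"
  shows "convergent (\<lambda>k. root k (a k))"
proof -
  define b where "b = (\<lambda>k. ln (a k))"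
  have apos: "0 < a k" for k using ge1[of k] by linarith
  have b0: "0 \<le> b k" for k using ge1 by (simp add: b_def)
  have bsub: "b (k + m) \<le> b k + b m" for k m
  proof -
    have "ln (a (k + m)) \<le> ln (a k * a m)" using sub apos by (simp add: ln_mono)
    then show ?thesis using apos[of k] apos[of m] by (simp add: b_def ln_mult)
  qed
  define L where "L = (INF k\<in>{1..}. b k / real k)"
  have bdd: "bdd_below ((\<lambda>k. b k / real k) ` {1..})" using b0 by (intro bdd_belowI[of _ 0]) auto
  have lower: "L \<le> b k / real k" if "1 \<le> k" for k
    unfolding L_def using that by (intro cINF_lower bdd) auto
  have "(\<lambda>k. b k / real k) \<longlonglongrightarrow> L"
  proof (rule LIMSEQ_I)
    fix e :: real assume e: "0 < e"
    have "\<exists>k\<in>{1..}. b k / real k < L + e / 2"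
      using cINF_less_iff[OF _ bdd, of "L + e / 2"] e by (simp add: L_def)
    then obtain k where k: "1 \<le> k" "b k / real k < L + e / 2" by auto
    \<comment> \<open>For \<open>n = q * k + r\<close> the remainder \<open>r < k\<close> costs at
      most \<open>M\<close>. The extra \<open>b 0\<close> comes from \<open>q = 0\<close>, because
      \<open>a 0\<close> is only known to be at least 1.\<close>
    define M where "M = (\<Sum>r<k. b r)"
    have M: "b r \<le> M" if "r < k" for r
      unfolding M_def using that b0 by (intro member_le_sum) auto
    have mult: "b (q * k) \<le> real q * b k + b 0" for q
    proof (induction q)
      case (Suc q)
      have "b (Suc q * k) \<le> b k + b (q * k)" using bsub[of k "q * k"] by simp
      then show ?case using Suc by (simp add: algebra_simps)
    qed simp
    have upper: "b n / real n \<le> b k / real k + (M + b 0) / real n" if n: "1 \<le> n" for n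
    proof -
      have "b n \<le> b (n div k * k) + b (n mod k)" using bsub[of "n div k * k" "n mod k"] by simp
      also have "\<dots> \<le> real (n div k) * b k + b 0 + M"
        using mult[of "n div k"] M[of "n mod k"] k by simp
      also have "real (n div k) * b k \<le> real n / real k * b k"
        using b0 by (intro mult_right_mono) (auto simp: of_nat_div_le_of_nat)
      finally have "b n \<le> real n / real k * b k + b 0 + M" by simp
      then have "b n / real n \<le> (real n / real k * b k + b 0 + M) / real n"
        by (intro divide_right_mono) auto
      also have "\<dots> = b k / real k + (M + b 0) / real n" using n by (simp add: field_simps)
      finally show ?thesis .
    qed
    have "(\<lambda>n. (M + b 0) / real n) \<longlonglongrightarrow> 0" by (rule lim_const_over_n)
    then obtain n0 where n0: "\<And>n. n0 \<le> n \<Longrightarrow> norm ((M + b 0) / real n - 0) < e / 2"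
      using e LIMSEQ_D[of _ 0 "e / 2"] by (metis half_gt_zero)
    show "\<exists>no. \<forall>n\<ge>no. norm (b n / real n - L) < e"
    proof (intro exI[of _ "max 1 n0"] allI impI)
      fix n assume n: "max 1 n0 \<le> n"
      then have "\<bar>(M + b 0) / real n\<bar> < e / 2" using n0[of n] by simp
      then show "norm (b n / real n - L) < e"
        using upper[of n] lower[of n] k n by (simp only: real_norm_def) linarith
    qed
  qed
  then have "(\<lambda>k. exp (b k / real k)) \<longlonglongrightarrow> exp L" by (intro tendsto_exp)
  moreover have "\<forall>\<^sub>F k in sequentially. exp (b k / real k) = root k (a k)"
    using eventually_gt_at_top[of 0]
  proof eventually_elim
    case (elim k)
    then have "root k (a k) = a k powr (1 / real k)" using apos elim by (intro root_powr_inverse) (auto intro: less_imp_le)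
    then show ?case using apos[of k] by (simp add: b_def powr_def)
  qed
  ultimately have "(\<lambda>k. root k (a k)) \<longlonglongrightarrow> exp L" by (rule Lim_transform_eventually)
  then show ?thesis by (auto simp: convergent_def)
qed

context lebesgue_preserving_map
begin

section \<open>Cylinders and the growth rate\<close>

abbreviation cyl where "cyl \<equiv> monotonicity_intervals P T"

lemma DERIV_T_power:
  assumes "\<And>j. j < k \<Longrightarrow> (T ^^ j) x \<in> X"
  shows "((T ^^ k) has_real_derivative deriv (T ^^ k) x) (at x) \<and> 1 \<le> \<bar>deriv (T ^^ k) x\<bar>"
  using assms
proof (induction k)
  case 0
  have "((T ^^ 0) has_real_derivative 1) (at x)" by (simp add: id_def)
  then show ?case by (simp add: DERIV_imp_deriv)
next
  case (Suc k)
  then have IH: "((T ^^ k) has_real_derivative deriv (T ^^ k) x) (at x)" "1 \<le> \<bar>deriv (T ^^ k) x\<bar>"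
    by auto
  have Tk: "(T ^^ k) x \<in> X" using Suc.prems by auto
  have d: "((T ^^ Suc k) has_real_derivative deriv T ((T ^^ k) x) * deriv (T ^^ k) x) (at x)"
    unfolding funpow.simps using DERIV_chain[OF DERIV_T(1)[OF Tk] IH(1)] .
  moreover have "1 \<le> \<bar>deriv T ((T ^^ k) x) * deriv (T ^^ k) x\<bar>"
    using mult_mono[OF DERIV_T(2)[OF Tk] IH(2)] by (simp add: abs_mult)
  ultimately show ?case by (simp only: DERIV_imp_deriv)
qed

lemma power_mem_unit:
  assumes "x \<in> {0..1}" "\<And>j. j < k \<Longrightarrow> (T ^^ j) x \<in> X"
  shows "(T ^^ k) x \<in> {0..1}"
proof (cases k)
  case (Suc m)
  then have "(T ^^ m) x \<in> X" using assms by auto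
  then show ?thesis using range Suc by auto
qed (use assms in auto)

lemma deriv_power_add:
  assumes "\<And>j. j < k + m \<Longrightarrow> (T ^^ j) x \<in> X"
  shows "deriv (T ^^ (k + m)) x = deriv (T ^^ m) ((T ^^ k) x) * deriv (T ^^ k) x"
proof -
  have "(T ^^ j) ((T ^^ k) x) \<in> X" if "j < m" for j
    using assms[of "j + k"] that by (simp add: funpow_add)
  then have 1: "((T ^^ m) has_real_derivative deriv (T ^^ m) ((T ^^ k) x)) (at ((T ^^ k) x))"
    using DERIV_T_power by blast
  have "((T ^^ k) has_real_derivative deriv (T ^^ k) x) (at x)"
    using DERIV_T_power assms by auto
  from DERIV_chain[OF 1 this] have "((T ^^ (k + m)) has_real_derivative deriv (T ^^ m) ((T ^^ k) x) * deriv (T ^^ k) x) (at x)"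
    by (simp only: funpow_add[symmetric] add.commute)
  then show ?thesis by (rule DERIV_imp_deriv)
qed

lemma cyl_subset: "J \<in> cyl k \<Longrightarrow> J \<subseteq> {0..1}"
  and cyl_nonempty: "J \<in> cyl k \<Longrightarrow> J \<noteq> {}"
  and cyl_orbit: "J \<in> cyl k \<Longrightarrow> x \<in> J \<Longrightarrow> j < k \<Longrightarrow> (T ^^ j) x \<in> X"
  unfolding monotonicity_intervals_def by auto

lemma cyl_0: "cyl 0 = {{0..1}}"
  unfolding monotonicity_intervals_def by auto

lemma cyl_1: "J \<in> cyl 1 \<Longrightarrow> J \<in> P"
proof -
  assume "J \<in> cyl 1"
  then obtain w where "\<forall>j<1. w j \<in> P" "J = {x \<in> {0..1}. \<forall>j<1. (T ^^ j) x \<in> w j}"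
    unfolding monotonicity_intervals_def by blast
  then have w: "w 0 \<in> P" "J = {x \<in> {0..1}. x \<in> w 0}" by auto
  then have "J = w 0" using X_subset by blast
  then show ?thesis using w by simp
qed

text \<open>The itinerary is cut at time \<open>k\<close>: its first \<open>k\<close> letters define
  \<open>J1\<close>, the shifted rest \<open>J2\<close>. Both are nonempty because \<open>J\<close>
  is. The case \<open>m = 1\<close> drives the inductions over cylinders, the general case
  submultiplicativity.\<close>

lemma cyl_add:
  assumes "J \<in> cyl (k + m)"
  shows "\<exists>J1\<in>cyl k. \<exists>J2\<in>cyl m. J = {x\<in>J1. (T ^^ k) x \<in> J2}"
proof -
  obtain w where w: "\<forall>j<k + m. w j \<in> P" and J: "J \<noteq> {}" "J = {x \<in> {0..1}. \<forall>j<k + m. (T ^^ j) x \<in> w j}"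
    using assms unfolding monotonicity_intervals_def by blast
  define J1 where "J1 = {x \<in> {0..1}. \<forall>j<k. (T ^^ j) x \<in> w j}"
  define J2 where "J2 = {x \<in> {0..1}. \<forall>j<m. (T ^^ j) x \<in> w (k + j)}"
  have iff: "(\<forall>j<k + m. Q j) \<longleftrightarrow> (\<forall>j<k. Q j) \<and> (\<forall>j<m. Q (k + j))" for Q :: "nat \<Rightarrow> bool"
  proof (intro iffI conjI allI impI)
    fix j assume *: "(\<forall>j<k. Q j) \<and> (\<forall>j<m. Q (k + j))" "j < k + m"
    show "Q j"
    proof (cases "j < k")
      case False
      then have "Q (k + (j - k))" using *(2) by (intro *(1)[THEN conjunct2, rule_format]) simp
      then show ?thesis using False by simp
    qed (use * in auto)
  qed auto
  have "(T ^^ k) x \<in> {0..1}" if "x \<in> J1" for x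
    using that w by (intro power_mem_unit) (auto simp: J1_def)
  then have eq: "J = {x\<in>J1. (T ^^ k) x \<in> J2}"
    unfolding J(2) iff unfolding J1_def J2_def by (auto simp: funpow_add add.commute[of k])
  then have "J1 \<noteq> {}" "J2 \<noteq> {}" using J(1) by auto
  moreover have "\<forall>j<k. w j \<in> P" "\<forall>j<m. w (k + j) \<in> P" using w by auto
  ultimately have "J1 \<in> cyl k" "J2 \<in> cyl m"
    unfolding monotonicity_intervals_def mem_Collect_eq
    using J1_def J2_def exI[of "\<lambda>w'. (\<forall>j<m. w' j \<in> P) \<and> J2 = {x \<in> {0..1}. \<forall>j<m. (T ^^ j) x \<in> w' j}" "\<lambda>j. w (k + j)"]
    by blast+
  with eq show ?thesis by blast
qed

lemma finite_cyl: "finite (cyl k)"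
proof (induction k)
  case (Suc k)
  have "cyl (Suc k) \<subseteq> (\<lambda>(J1, J2). {x\<in>J1. (T ^^ k) x \<in> J2}) ` (cyl k \<times> P)"
  proof
    fix J assume "J \<in> cyl (Suc k)"
    then obtain J1 J2 where J: "J1 \<in> cyl k" "J2 \<in> cyl 1" "J = {x\<in>J1. (T ^^ k) x \<in> J2}"
      using cyl_add[of J k 1] by auto
    from J(1) cyl_1[OF J(2)] have "(J1, J2) \<in> cyl k \<times> P" by simp
    then show "J \<in> (\<lambda>(J1, J2). {x\<in>J1. (T ^^ k) x \<in> J2}) ` (cyl k \<times> P)"
      by (rule rev_image_eqI) (simp add: J(3))
  qed
  moreover have "finite ((\<lambda>(J1, J2). {x\<in>J1. (T ^^ k) x \<in> J2}) ` (cyl k \<times> P))"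
    using Suc finite_P by blast
  ultimately show ?case by (rule finite_subset)
qed (simp add: cyl_0)

lemma cyl_disjoint:
  assumes "J \<in> cyl k" "J' \<in> cyl k" "x \<in> J" "x \<in> J'"
  shows "J = J'"
proof -
  obtain w where w: "\<forall>j<k. w j \<in> P" "J = {x \<in> {0..1}. \<forall>j<k. (T ^^ j) x \<in> w j}"
    using assms(1) unfolding monotonicity_intervals_def by blast
  obtain w' where w': "\<forall>j<k. w' j \<in> P" "J' = {x \<in> {0..1}. \<forall>j<k. (T ^^ j) x \<in> w' j}"
    using assms(2) unfolding monotonicity_intervals_def by blast
  have "w j = w' j" if "j < k" for j
    using same_piece[of "w j" "w' j" "(T ^^ j) x"] w w' assms that by auto
  then show ?thesis using w w' by auto
qed

lemma cyl_cover:
  assumes "x \<in> {0..1}" "\<And>j. j < k \<Longrightarrow> (T ^^ j) x \<in> X"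
  shows "\<exists>J\<in>cyl k. x \<in> J"
proof -
  have "\<forall>j. \<exists>K. j < k \<longrightarrow> K \<in> P \<and> (T ^^ j) x \<in> K" using assms(2) by blast
  then obtain w where w: "\<And>j. j < k \<Longrightarrow> w j \<in> P \<and> (T ^^ j) x \<in> w j" by metis
  define J where "J = {x \<in> {0..1}. \<forall>j<k. (T ^^ j) x \<in> w j}"
  have "x \<in> J" using w assms by (auto simp: J_def)
  moreover have "J \<in> cyl k"
    unfolding monotonicity_intervals_def using w \<open>x \<in> J\<close> J_def by blast
  ultimately show ?thesis by blast
qed

text \<open>This is the part of the unit interval not covered by cylinders of length
  \<open>k\<close>. It is finite, so almost-everywhere claims about \<open>T ^^ k\<close> may be
  checked off it, where the orbit never meets the arbitrary values of \<open>T\<close> outside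
  \<open>X\<close>.\<close>

definition exceptional :: "nat \<Rightarrow> real set" where
  "exceptional k = {x\<in>{0..1}. \<exists>j<k. (T ^^ j) x \<notin> X}"

lemma finite_exceptional: "finite (exceptional k)"
proof (induction k)
  case (Suc k)
  have "exceptional (Suc k) \<subseteq> ({0..1} - X) \<union> (\<Union>p\<in>exceptional k. {x\<in>X. T x = p})"
  proof
    fix x assume "x \<in> exceptional (Suc k)"
    then obtain j where j: "x \<in> {0..1}" "j < Suc k" "(T ^^ j) x \<notin> X" by (auto simp: exceptional_def)
    show "x \<in> ({0..1} - X) \<union> (\<Union>p\<in>exceptional k. {x\<in>X. T x = p})"
    proof (cases "x \<in> X")
      case True
      then obtain i where i: "j = Suc i" using j by (cases j) auto
      then have "(T ^^ i) (T x) \<notin> X" using j by (simp add: funpow_swap1)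
      then have "T x \<in> exceptional k" using i j True range by (auto simp: exceptional_def)
      then show ?thesis using True by blast
    qed (use j in auto)
  qed
  moreover have "finite (({0..1} - X) \<union> (\<Union>p\<in>exceptional k. {x\<in>X. T x = p}))"
    using finite_gap Suc fibre_finite by auto
  ultimately show ?case by (rule finite_subset)
qed (simp add: exceptional_def)

lemma cyl_cover_exceptional: "x \<in> {0..1} \<Longrightarrow> x \<notin> exceptional k \<Longrightarrow> \<exists>J\<in>cyl k. x \<in> J"
  using cyl_cover by (auto simp: exceptional_def)

lemma cyl_continuous: "J \<in> cyl k \<Longrightarrow> continuous_on J (T ^^ k)"
  using DERIV_T_power cyl_orbit DERIV_isCont by (metis continuous_at_imp_continuous_on)

lemma cyl_interval_inj: "J \<in> cyl k \<Longrightarrow> is_interval J \<and> inj_on (T ^^ k) J"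
proof (induction k arbitrary: J)
  case 0
  then show ?case by (simp add: cyl_0 is_interval_cc id_def)
next
  case (Suc k)
  obtain J1 J2 where J: "J1 \<in> cyl k" "J2 \<in> cyl 1" "J = {x\<in>J1. (T ^^ k) x \<in> J2}"
    using cyl_add[of J k 1] Suc.prems by auto
  have J1: "is_interval J1" "inj_on (T ^^ k) J1" using Suc.IH[OF J(1)] by auto
  have J2: "J2 \<in> P" using cyl_1 J by auto
  then have "is_interval J2" using piece_interval[OF J2] by (auto simp: is_interval_oo)
  then have "is_interval J" unfolding J(3) by (intro interval_preimage J1 cyl_continuous J(1))
  moreover have "inj_on (T ^^ Suc k) J"
    using J1(2) inj_on_piece[OF J2] J(3) by (auto simp: inj_on_def)
  ultimately show ?case by blast
qed

lemma cyl_preimage_interval: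
  assumes "J \<in> cyl k" "is_interval Q"
  shows "is_interval {x\<in>J. (T ^^ k) x \<in> Q}"
  using cyl_interval_inj[OF assms(1)] cyl_continuous[OF assms(1)] assms(2)
  by (intro interval_preimage) auto

lemma theta_bounds:
  assumes "J \<in> cyl k"
  shows "x \<in> J \<Longrightarrow> 1 / \<bar>deriv (T ^^ k) x\<bar> \<le> theta T k J" "theta T k J \<le> 1" "0 < theta T k J"
proof -
  have le1: "1 / \<bar>deriv (T ^^ k) x\<bar> \<le> 1" "0 < 1 / \<bar>deriv (T ^^ k) x\<bar>" if "x \<in> J" for x
    using DERIV_T_power[of k x] cyl_orbit[OF assms that] by auto
  have bdd: "bdd_above ((\<lambda>x. 1 / \<bar>deriv (T ^^ k) x\<bar>) ` J)"
    using le1(1) by (intro bdd_aboveI[of _ 1]) auto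
  show *: "1 / \<bar>deriv (T ^^ k) x\<bar> \<le> theta T k J" if "x \<in> J" for x
    unfolding theta_def by (rule cSUP_upper[OF that bdd])
  show "theta T k J \<le> 1"
    unfolding theta_def by (rule cSUP_least[OF cyl_nonempty[OF assms] le1(1)])
  obtain x where "x \<in> J" using cyl_nonempty[OF assms] by blast
  then show "0 < theta T k J" using *[of x] le1(2)[of x] by linarith
qed

lemma theta_expansion:
  assumes J: "J \<in> cyl k" and xy: "x \<in> J" "y \<in> J" "x < y"
  shows "y - x \<le> theta T k J * \<bar>(T ^^ k) y - (T ^^ k) x\<bar>"
proof -
  have in_J: "z \<in> J" if "x \<le> z" "z \<le> y" for z
    using cyl_interval_inj[OF J] xy that unfolding is_interval_1 by blast
  have d: "((T ^^ k) has_real_derivative deriv (T ^^ k) z) (at z)" "1 \<le> \<bar>deriv (T ^^ k) z\<bar>"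
    if "x \<le> z" "z \<le> y" for z
    using DERIV_T_power[of k z] cyl_orbit[OF J in_J[OF that]] by auto
  obtain z where z: "x < z" "z < y" "(T ^^ k) y - (T ^^ k) x = (y - x) * deriv (T ^^ k) z"
    using MVT2[OF xy(3), of "T ^^ k" "deriv (T ^^ k)"] d by auto
  have "1 / \<bar>deriv (T ^^ k) z\<bar> \<le> theta T k J"
    using theta_bounds(1)[OF J] in_J z by auto
  moreover have "1 \<le> \<bar>deriv (T ^^ k) z\<bar>" using d z by auto
  ultimately have "1 \<le> theta T k J * \<bar>deriv (T ^^ k) z\<bar>" by (simp add: field_simps split: if_splits)
  then have "(y - x) * 1 \<le> (y - x) * (theta T k J * \<bar>deriv (T ^^ k) z\<bar>)"
    using xy by (intro mult_left_mono) auto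
  then show ?thesis using xy by (simp add: z(3) abs_mult mult_ac)
qed

lemma cyl_preimage_length:
  assumes J: "J \<in> cyl k" and Q: "is_interval Q" "Q \<subseteq> {0..1}"
  shows "length_of {x\<in>J. (T ^^ k) x \<in> Q} \<le> theta T k J * length_of Q"
proof (rule measure_le_diameter)
  fix x y assume x: "x \<in> {x\<in>J. (T ^^ k) x \<in> Q}" and y: "y \<in> {x\<in>J. (T ^^ k) x \<in> Q}" and "x < y"
  let ?u = "(T ^^ k) x" and ?v = "(T ^^ k) y"
  have "{min ?u ?v..max ?u ?v} \<subseteq> Q"
    using Q(1) x y unfolding is_interval_1 by (auto simp: min_def max_def split: if_splits)
  then have "measure lebesgue {min ?u ?v..max ?u ?v} \<le> measure lebesgue Q"
    using interval_lmeasurable[OF Q] by (intro measure_mono_fmeasurable) auto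
  then have "max ?u ?v - min ?u ?v \<le> length_of Q" by (simp split: if_splits)
  then have "\<bar>?v - ?u\<bar> \<le> length_of Q" by linarith
  then have "theta T k J * \<bar>?v - ?u\<bar> \<le> theta T k J * length_of Q"
    using theta_bounds(3)[OF J] by (intro mult_left_mono) auto
  then show "y - x \<le> theta T k J * length_of Q"
    using theta_expansion[OF J, of x y] x y \<open>x < y\<close> by auto
qed (use cyl_subset[OF J] theta_bounds(3)[OF J] in auto)

text \<open>Up to finitely many points the cylinders cover the unit interval, so their lengths sum
  to at least 1, and each length is at most \<open>theta T k J\<close>. As
  \<open>theta T k J \<le> 1\<close> and \<open>\<gamma> \<le> 1\<close>, raising to the power
  \<open>\<gamma>\<close> only increases it.\<close>

lemma Theta_ge_1:
  assumes "0 < \<gamma>" "\<gamma> \<le> 1"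
  shows "1 \<le> Theta P T k \<gamma>"
proof -
  have meas: "J \<in> lmeasurable" if "J \<in> cyl k" for J
    using interval_lmeasurable cyl_interval_inj[OF that] cyl_subset[OF that] by blast
  have "length_of ({0..1} - exceptional k) = length_of {0..1::real}"
    using finite_exceptional negligible_finite
    by (intro measure_Diff_null_set) (auto simp: negligible_iff_null_sets[symmetric])
  then have "1 = length_of ({0..1} - exceptional k)" by simp
  also have "\<dots> \<le> length_of (\<Union>J\<in>cyl k. J)"
    using cyl_cover_exceptional[of _ k] meas finite_cyl finite_exceptional[of k]
    by (intro measure_mono_fmeasurable fmeasurable.finite_UN) (auto simp: finite_imp_closed)
  also have "\<dots> \<le> (\<Sum>J\<in>cyl k. length_of J)"
    using finite_cyl meas by (intro measure_UNION_le) auto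
  also have "\<dots> \<le> (\<Sum>J\<in>cyl k. theta T k J powr \<gamma>)"
  proof (rule sum_mono)
    fix J assume J: "J \<in> cyl k"
    have "{x\<in>J. (T ^^ k) x \<in> {0..1}} = J"
      using power_mem_unit cyl_orbit[OF J] cyl_subset[OF J] by blast
    then have "length_of J \<le> theta T k J"
      using cyl_preimage_length[OF J, of "{0..1}"] by (simp add: is_interval_cc)
    also have "\<dots> = theta T k J powr 1" using theta_bounds(3)[OF J] by simp
    also have "\<dots> \<le> theta T k J powr \<gamma>" using theta_bounds[OF J] assms by (intro powr_mono') auto
    finally show "length_of J \<le> theta T k J powr \<gamma>" .
  qed
  finally show ?thesis by (simp add: Theta_def)
qed

text \<open>The chain rule bounds \<open>theta\<close> of a long cylinder by the product over its
  two factors, and a cylinder is determined by its factors. Pairs with empty intersection only add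
  to the right-hand side.\<close>

lemma Theta_submultiplicative:
  assumes "0 < \<gamma>"
  shows "Theta P T (k + m) \<gamma> \<le> Theta P T k \<gamma> * Theta P T m \<gamma>"
proof -
  have "\<forall>J\<in>cyl (k + m). \<exists>p. fst p \<in> cyl k \<and> snd p \<in> cyl m \<and> J = {x\<in>fst p. (T ^^ k) x \<in> snd p}"
    using cyl_add by fastforce
  from bchoice[OF this] obtain p where p: "\<And>J. J \<in> cyl (k + m) \<Longrightarrow> fst (p J) \<in> cyl k \<and> snd (p J) \<in> cyl m \<and>
      J = {x\<in>fst (p J). (T ^^ k) x \<in> snd (p J)}" by blast
  have sub: "p ` cyl (k + m) \<subseteq> cyl k \<times> cyl m"
  proof
    fix q assume "q \<in> p ` cyl (k + m)"
    then obtain J where "J \<in> cyl (k + m)" "q = p J" by blast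
    with p[of J] show "q \<in> cyl k \<times> cyl m" by (simp add: mem_Times_iff)
  qed
  have inj: "inj_on p (cyl (k + m))"
  proof (rule inj_onI)
    fix J J' assume J: "J \<in> cyl (k + m)" "J' \<in> cyl (k + m)" "p J = p J'"
    have "J = {x\<in>fst (p J). (T ^^ k) x \<in> snd (p J)}" using p[OF J(1)] by blast
    also have "\<dots> = J'" using p[OF J(2)] J(3) by simp
    finally show "J = J'" .
  qed
  have le: "theta T (k + m) J powr \<gamma> \<le> theta T k (fst (p J)) powr \<gamma> * theta T m (snd (p J)) powr \<gamma>"
    if J: "J \<in> cyl (k + m)" for J
  proof -
    note pJ = p[OF J]
    have c: "fst (p J) \<in> cyl k" "snd (p J) \<in> cyl m" using pJ by auto
    have "theta T (k + m) J \<le> theta T k (fst (p J)) * theta T m (snd (p J))"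
      unfolding theta_def[of T "k + m"]
    proof (rule cSUP_least[OF cyl_nonempty[OF J]])
      fix x assume x: "x \<in> J"
      have "x \<in> fst (p J)" "(T ^^ k) x \<in> snd (p J)" using pJ x by auto
      then have "1 / \<bar>deriv (T ^^ k) x\<bar> * (1 / \<bar>deriv (T ^^ m) ((T ^^ k) x)\<bar>) \<le>
          theta T k (fst (p J)) * theta T m (snd (p J))"
        using theta_bounds[OF c(1)] theta_bounds[OF c(2)] by (intro mult_mono) auto
      then show "1 / \<bar>deriv (T ^^ (k + m)) x\<bar> \<le> theta T k (fst (p J)) * theta T m (snd (p J))"
        using deriv_power_add[of k m x] cyl_orbit[OF J x] by (simp add: abs_mult mult.commute)
    qed
    then have "theta T (k + m) J powr \<gamma> \<le> (theta T k (fst (p J)) * theta T m (snd (p J))) powr \<gamma>"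
      using theta_bounds[OF J] assms by (intro powr_mono2) auto
    also have "\<dots> = theta T k (fst (p J)) powr \<gamma> * theta T m (snd (p J)) powr \<gamma>"
      using theta_bounds(3)[OF c(1)] theta_bounds(3)[OF c(2)] by (simp add: powr_mult)
    finally show ?thesis .
  qed
  let ?h = "\<lambda>q. theta T k (fst q) powr \<gamma> * theta T m (snd q) powr \<gamma>"
  have "Theta P T (k + m) \<gamma> \<le> (\<Sum>J\<in>cyl (k + m). ?h (p J))"
    unfolding Theta_def by (intro sum_mono le)
  also have "\<dots> = (\<Sum>q\<in>p ` cyl (k + m). ?h q)" using sum.reindex[OF inj, of ?h] by simp
  also have "\<dots> \<le> (\<Sum>q\<in>cyl k \<times> cyl m. ?h q)"
  proof (rule sum_mono2)
    show "p ` cyl (k + m) \<subseteq> cyl k \<times> cyl m" by (rule sub)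
  qed (use finite_cyl in auto)
  also have "\<dots> = Theta P T k \<gamma> * Theta P T m \<gamma>"
    unfolding Theta_def sum_product sum.cartesian_product by (simp add: case_prod_unfold)
  finally show ?thesis .
qed

lemma Theta_root_limit:
  assumes "0 < \<gamma>" "\<gamma> \<le> 1"
  shows "(\<lambda>k. root k (Theta P T k \<gamma>)) \<longlonglongrightarrow> Theta_infty P T \<gamma>" "1 \<le> Theta_infty P T \<gamma>"
proof -
  have "convergent (\<lambda>k. root k (Theta P T k \<gamma>))"
    using Theta_ge_1[OF assms] Theta_submultiplicative[OF assms(1)]
    by (rule submultiplicative_root_convergent)
  then show lim: "(\<lambda>k. root k (Theta P T k \<gamma>)) \<longlonglongrightarrow> Theta_infty P T \<gamma>"
    by (simp add: Theta_infty_def convergent_LIMSEQ_iff)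
  have "\<forall>\<^sub>F k in sequentially. 1 \<le> root k (Theta P T k \<gamma>)"
    using eventually_gt_at_top[of 0] by eventually_elim (simp add: Theta_ge_1[OF assms])
  with lim show "1 \<le> Theta_infty P T \<gamma>"
    by (rule tendsto_lowerbound) auto
qed

lemma summable_Theta:
  assumes "0 < \<gamma>" "\<gamma> \<le> 1" "0 \<le> r" "r < 1 / Theta_infty P T \<gamma>"
  shows "summable (\<lambda>k. r ^ k * Theta P T k \<gamma>)"
proof (rule root_test_convergence)
  have "(\<lambda>k. r * root k (Theta P T k \<gamma>)) \<longlonglongrightarrow> r * Theta_infty P T \<gamma>"
    by (intro tendsto_intros Theta_root_limit assms)
  moreover have "\<forall>\<^sub>F k in sequentially. r * root k (Theta P T k \<gamma>) = root k (norm (r ^ k * Theta P T k \<gamma>))"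
    using eventually_gt_at_top[of 0]
  proof eventually_elim
    case (elim k)
    have "0 \<le> Theta P T k \<gamma>" using Theta_ge_1[OF assms(1,2), of k] by linarith
    then show ?case using elim assms(3) by (simp add: abs_mult real_root_mult real_root_power_cancel)
  qed
  ultimately show "(\<lambda>k. root k (norm (r ^ k * Theta P T k \<gamma>))) \<longlonglongrightarrow> r * Theta_infty P T \<gamma>"
    by (rule Lim_transform_eventually)
  show "r * Theta_infty P T \<gamma> < 1"
    using assms Theta_root_limit(2)[OF assms(1,2)] by (simp add: field_simps)
qed

end

lemma positive_length_open:
  fixes S :: "real set"
  assumes "open S" "S \<noteq> {}" "S \<subseteq> {0..1}"
  shows "\<not> (AE x in mI. x \<notin> S)"
proof
  assume "AE x in mI. x \<notin> S"
  then have "AE x in lebesgue. x \<in> {0..1} \<longrightarrow> x \<notin> S" by (simp add: AE_restrict_space_iff)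
  then have "AE x in lebesgue. x \<notin> S" by eventually_elim (use assms(3) in auto)
  then have "S \<in> null_sets lebesgue"
    using assms(1) by (subst (asm) AE_iff_null_sets[symmetric]) auto
  then have "negligible S" by (simp add: negligible_iff_null_sets)
  then show False using open_not_negligible assms by blast
qed

text \<open>Halving the index of the dyadic interval around a point gives the index of its parent,
  which is what lets the step approximations in \<open>holder_comp\<close> telescope.\<close>

lemma nat_floor_double_div_2: "0 \<le> y \<Longrightarrow> nat \<lfloor>2 * y\<rfloor> div 2 = nat \<lfloor>y::real\<rfloor>"
proof -
  assume "0 \<le> y"
  have "\<lfloor>2 * y\<rfloor> div 2 = \<lfloor>y\<rfloor>"
    using floor_divide_real_eq_div[of 2 "2 * y"] by simp
  moreover have "nat (\<lfloor>2 * y\<rfloor> div 2) = nat \<lfloor>2 * y\<rfloor> div nat 2"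
    using \<open>0 \<le> y\<close> by (intro nat_div_distrib) auto
  ultimately show ?thesis by simp
qed

section \<open>The Besov embedding and norms of compositions with iterates of
  \<open>T\<close>\<close>

locale transfer_space = lebesgue_preserving_map P T \<beta> + function_space B N
  for P T \<beta> B N +
  fixes C s :: real
  assumes L_mem: "\<forall>f\<in>B. transfer_op P T f \<in> B"
    and L_bounded: "\<exists>K. \<forall>f\<in>B. N (transfer_op P T f) \<le> K * N f"
    and C_nonneg: "0 \<le> C" and s_pos: "0 < s" and s_less_1: "s < 1"
    and indicators: "\<forall>J. is_interval J \<and> J \<subseteq> {0..1} \<longrightarrow>
           (indicator J :: real \<Rightarrow> complex) \<in> B \<and>
           N (indicator J) \<le> C * length_of J powr (1 - s)"
begin

abbreviation L where "L \<equiv> transfer_op P T"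

abbreviation \<Theta> where "\<Theta> k \<equiv> Theta P T k (1 - s)"

lemma indicator_mem: "is_interval J \<Longrightarrow> J \<subseteq> {0..1} \<Longrightarrow> (indicator J :: real \<Rightarrow> complex) \<in> B"
  and N_indicator: "is_interval J \<Longrightarrow> J \<subseteq> {0..1} \<Longrightarrow> N (indicator J) \<le> C * length_of J powr (1 - s)"
  using indicators by auto

text \<open>The exponents \<open>s - 1\<close> and \<open>1 - s\<close> cancel, so every normalised
  atom has norm at most \<open>C\<close> in \<open>B\<close>. Absolutely summable coefficients then
  make the series converge in \<open>B\<close>, and its \<open>L\<^sup>1\<close> limit is
  \<open>\<psi>\<close>.\<close>

lemma besov_mem:
  assumes \<psi>: "integrable mI \<psi>" and rep: "besov_representation s \<psi> c Q"
  shows "\<psi> \<in> B" "N \<psi> \<le> C * (\<Sum>n. cmod (c n))"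
proof -
  define u where "u = (\<lambda>n x. c n * of_real (length_of (Q n) powr (s - 1)) * indicator (Q n) x)"
  have Q: "is_interval (Q n)" "Q n \<subseteq> {0..1}" "0 < length_of (Q n)" for n
    using rep unfolding besov_representation_def by auto
  have c: "summable (\<lambda>n. cmod (c n))"
    and lim: "(\<lambda>M. L1_norm (\<lambda>x. \<psi> x - (\<Sum>n<M. u n x))) \<longlonglongrightarrow> 0"
    using rep unfolding besov_representation_def u_def by auto
  have u: "u n \<in> B" for n unfolding u_def by (intro scale_mem indicator_mem Q)
  have le: "N (u n) \<le> C * cmod (c n)" for n
  proof -
    have "N (u n) = cmod (c n) * length_of (Q n) powr (s - 1) * N (indicator (Q n))"
      unfolding u_def by (subst N_scale[OF indicator_mem[OF Q(1,2)]]) (simp add: norm_mult)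
    also have "\<dots> \<le> cmod (c n) * length_of (Q n) powr (s - 1) * (C * length_of (Q n) powr (1 - s))"
      by (intro mult_left_mono N_indicator Q) auto
    also have "\<dots> = C * cmod (c n) * (length_of (Q n) powr (s - 1) * length_of (Q n) powr (1 - s))"
      by (simp add: mult_ac)
    also have "length_of (Q n) powr (s - 1) * length_of (Q n) powr (1 - s) = 1"
      using Q(3)[of n] by (simp add: powr_add[symmetric])
    finally show ?thesis by simp
  qed
  have summ: "summable (\<lambda>n. N (u n))"
    by (rule summable_comparison_test'[OF summable_mult[OF c, of C], of 0]) (use le N_nonneg[OF u] in simp)
  show "\<psi> \<in> B" by (rule series_L1(1)[OF u summ \<psi> lim])
  have "N \<psi> \<le> (\<Sum>n. N (u n))" by (rule series_L1(2)[OF u summ \<psi> lim])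
  also have "\<dots> \<le> (\<Sum>n. C * cmod (c n))" by (intro suminf_le le summ summable_mult c)
  also have "\<dots> = C * (\<Sum>n. cmod (c n))" by (rule suminf_mult[OF c])
  finally show "N \<psi> \<le> C * (\<Sum>n. cmod (c n))" .
qed

lemma besov_embedding:
  "besov_space s \<subseteq> B" "\<psi> \<in> besov_space s \<Longrightarrow> N \<psi> \<le> C * besov_norm s \<psi>"
proof -
  show "besov_space s \<subseteq> B" using besov_mem(1) by (auto simp: besov_space_def)
  assume \<psi>: "\<psi> \<in> besov_space s"
  let ?S = "{\<Sum>n. cmod (c n) | c. \<exists>Q. besov_representation s \<psi> c Q}"
  have ne: "?S \<noteq> {}" and int: "integrable mI \<psi>" using \<psi> by (auto simp: besov_space_def)
  have le: "N \<psi> \<le> C * t" if "t \<in> ?S" for t using besov_mem(2)[OF int] that by auto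
  show "N \<psi> \<le> C * besov_norm s \<psi>"
  \<comment> \<open>The infimum is passed through by dividing by \<open>C\<close>, which requires
    \<open>C\<close> to be positive.\<close>
  proof (cases "C = 0")
    case True
    then show ?thesis using le ne by fastforce
  next
    case False
    then have "0 < C" using C_nonneg by simp
    then have "N \<psi> / C \<le> Inf ?S"
      using le by (intro cInf_greatest[OF ne]) (simp add: pos_divide_le_eq mult.commute)
    then show ?thesis using \<open>0 < C\<close> by (simp add: besov_norm_def pos_divide_le_eq mult.commute)
  qed
qed

lemma Theta_nonneg: "0 \<le> \<Theta> k"
  using Theta_ge_1[of "1 - s" k] s_pos s_less_1 by simp

lemma indicator_comp:
  assumes Q: "is_interval Q" "Q \<subseteq> {0..1}"
  shows "(\<lambda>x. indicator Q ((T ^^ k) x) :: complex) \<in> B"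
    "N (\<lambda>x. indicator Q ((T ^^ k) x) :: complex) \<le> C * \<Theta> k * length_of Q powr (1 - s)"
proof -
  define S where "S = (\<lambda>J. {x\<in>J. (T ^^ k) x \<in> Q})"
  have S: "is_interval (S J)" "S J \<subseteq> {0..1}" if "J \<in> cyl k" for J
    using cyl_preimage_interval[OF that Q(1)] cyl_subset[OF that] by (auto simp: S_def)
  let ?g = "\<lambda>x. \<Sum>J\<in>cyl k. indicator (S J) x :: complex"
  have g: "?g \<in> B" by (intro sum_mem indicator_mem S)
  have "N ?g \<le> (\<Sum>J\<in>cyl k. N (indicator (S J)))" by (intro N_sum indicator_mem S)
  also have "\<dots> \<le> (\<Sum>J\<in>cyl k. C * (theta T k J powr (1 - s) * length_of Q powr (1 - s)))"
  proof (rule sum_mono)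
    fix J assume J: "J \<in> cyl k"
    have "N (indicator (S J)) \<le> C * length_of (S J) powr (1 - s)"
      by (intro N_indicator S J)
    also have "length_of (S J) powr (1 - s) \<le> (theta T k J * length_of Q) powr (1 - s)"
      using cyl_preimage_length[OF J Q] s_less_1 unfolding S_def by (intro powr_mono2) auto
    also have "\<dots> = theta T k J powr (1 - s) * length_of Q powr (1 - s)"
      using theta_bounds(3)[OF J] by (simp add: powr_mult)
    finally show "N (indicator (S J)) \<le> C * (theta T k J powr (1 - s) * length_of Q powr (1 - s))"
      using C_nonneg by (simp add: mult_left_mono)
  qed
  also have "\<dots> = C * \<Theta> k * length_of Q powr (1 - s)"
    by (simp add: Theta_def sum_distrib_left sum_distrib_right mult_ac)
  finally have Ng: "N ?g \<le> C * \<Theta> k * length_of Q powr (1 - s)" .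
  \<comment> \<open>Off the exceptional points exactly one cylinder contains \<open>x\<close>, so
    exactly one summand can be nonzero.\<close>
  have "eq_ae ?g (\<lambda>x. indicator Q ((T ^^ k) x))"
    unfolding eq_ae_def
  proof (rule AE_mI_finite[OF finite_exceptional[of k]])
    fix x :: real assume x: "x \<in> {0..1}" "x \<notin> exceptional k"
    then obtain J0 where J0: "J0 \<in> cyl k" "x \<in> J0" using cyl_cover_exceptional by blast
    have "?g x = (\<Sum>J\<in>cyl k. if J = J0 then indicator Q ((T ^^ k) x) else 0)"
      using J0 cyl_disjoint by (intro sum.cong) (auto simp: S_def indicator_def)
    then show "?g x = indicator Q ((T ^^ k) x)" using J0 finite_cyl by simp
  qed
  from mem_ae[OF g this] N_ae[OF g this] Ng
  show "(\<lambda>x. indicator Q ((T ^^ k) x) :: complex) \<in> B"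
    "N (\<lambda>x. indicator Q ((T ^^ k) x) :: complex) \<le> C * \<Theta> k * length_of Q powr (1 - s)"
    by simp_all
qed

text \<open>Half-open intervals make the index of a nonnegative point unique. The price is that the
  point 1 has index \<open>2 ^ n\<close>, so sums run over \<open>i \<le> 2 ^ n\<close>; the
  resulting \<open>2 ^ n + 1\<close> terms are later bounded by \<open>2 * 2 ^ n\<close>.\<close>

definition dyadic :: "nat \<Rightarrow> nat \<Rightarrow> real set" where
  "dyadic n i = {real i / 2 ^ n..<real (Suc i) / 2 ^ n}"

lemma mem_dyadic: "0 \<le> y \<Longrightarrow> y \<in> dyadic n i \<longleftrightarrow> i = nat \<lfloor>2 ^ n * y\<rfloor>"
proof -
  assume y: "0 \<le> y"
  have "y \<in> dyadic n i \<longleftrightarrow> real i \<le> 2 ^ n * y \<and> 2 ^ n * y < real i + 1"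
    by (auto simp: dyadic_def field_simps)
  also have "\<dots> \<longleftrightarrow> \<lfloor>2 ^ n * y\<rfloor> = int i"
    by (simp add: floor_eq_iff)
  also have "\<dots> \<longleftrightarrow> i = nat \<lfloor>2 ^ n * y\<rfloor>" using y by auto
  finally show ?thesis .
qed

lemma dyadic_step_comp:
  fixes c :: "nat \<Rightarrow> real"
  assumes Q: "is_interval Q" "Q \<subseteq> {0..1}" and c: "\<And>i. i \<le> 2 ^ n \<Longrightarrow> \<bar>c i\<bar> \<le> M"
  shows "(\<lambda>x. \<Sum>i\<le>2 ^ n. of_real (c i) * indicator (Q \<inter> dyadic n i) ((T ^^ k) x) :: complex) \<in> B"
    "N (\<lambda>x. \<Sum>i\<le>2 ^ n. of_real (c i) * indicator (Q \<inter> dyadic n i) ((T ^^ k) x)) \<le>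
      2 * 2 ^ n * M * (C * \<Theta> k * (1 / 2 ^ n) powr (1 - s))"
proof -
  have D: "is_interval (Q \<inter> dyadic n i)" "Q \<inter> dyadic n i \<subseteq> {0..1}" for i
    using Q by (auto simp: dyadic_def intro!: is_interval_Int is_interval_co)
  show "(\<lambda>x. \<Sum>i\<le>2 ^ n. of_real (c i) * indicator (Q \<inter> dyadic n i) ((T ^^ k) x) :: complex) \<in> B"
    by (intro sum_mem scale_mem indicator_comp D)
  have "0 \<le> M" using c[of 0] by simp
  have "N (\<lambda>x. \<Sum>i\<le>2 ^ n. of_real (c i) * indicator (Q \<inter> dyadic n i) ((T ^^ k) x)) \<le>
      (\<Sum>i\<le>2 ^ n. N (\<lambda>x. of_real (c i) * indicator (Q \<inter> dyadic n i) ((T ^^ k) x)))"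
    by (intro N_sum scale_mem indicator_comp D)
  also have "\<dots> \<le> (\<Sum>i\<le>(2::nat) ^ n. M * (C * \<Theta> k * (1 / 2 ^ n) powr (1 - s)))"
  proof (rule sum_mono)
    fix i :: nat assume i: "i \<in> {..2 ^ n}"
    have "N (\<lambda>x. of_real (c i) * indicator (Q \<inter> dyadic n i) ((T ^^ k) x)) =
        \<bar>c i\<bar> * N (\<lambda>x. indicator (Q \<inter> dyadic n i) ((T ^^ k) x))"
      by (subst N_scale[OF indicator_comp(1)[OF D]]) simp
    also have "\<dots> \<le> M * (C * \<Theta> k * length_of (Q \<inter> dyadic n i) powr (1 - s))"
      using c[of i] i indicator_comp[OF D[of i], of k] \<open>0 \<le> M\<close> by (intro mult_mono N_nonneg) auto
    also have "\<dots> \<le> M * (C * \<Theta> k * (1 / 2 ^ n) powr (1 - s))"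
    proof -
      have "{real i / 2 ^ n..<real (Suc i) / 2 ^ n} \<in> lmeasurable"
        by (rule fmeasurableI2[of "{real i / 2 ^ n..real (Suc i) / 2 ^ n}"]) auto
      then have "length_of (Q \<inter> dyadic n i) \<le> length_of (dyadic n i)"
        using interval_lmeasurable(1)[OF D[of i]] unfolding dyadic_def
        by (intro measure_mono_fmeasurable) auto
      also have "\<dots> = 1 / 2 ^ n" unfolding dyadic_def by (simp add: divide_right_mono diff_divide_distrib[symmetric])
      finally show ?thesis
        using \<open>0 \<le> M\<close> C_nonneg Theta_nonneg[of k] s_less_1
        by (intro mult_left_mono powr_mono2) auto
    qed
    finally show "N (\<lambda>x. of_real (c i) * indicator (Q \<inter> dyadic n i) ((T ^^ k) x)) \<le>
        M * (C * \<Theta> k * (1 / 2 ^ n) powr (1 - s))" .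
  qed
  also have "\<dots> = (2 ^ n + 1) * (M * (C * \<Theta> k * (1 / 2 ^ n) powr (1 - s)))"
    by (simp add: algebra_simps)
  also have "\<dots> \<le> (2 * 2 ^ n) * (M * (C * \<Theta> k * (1 / 2 ^ n) powr (1 - s)))"
    using \<open>0 \<le> M\<close> C_nonneg Theta_nonneg[of k] by (intro mult_right_mono) auto
  finally show "N (\<lambda>x. \<Sum>i\<le>2 ^ n. of_real (c i) * indicator (Q \<inter> dyadic n i) ((T ^^ k) x)) \<le>
      2 * 2 ^ n * M * (C * \<Theta> k * (1 / 2 ^ n) powr (1 - s))" by (simp add: mult.assoc)
qed

text \<open>The function is telescoped over its dyadic step approximations: level \<open>n\<close> consists of about
  \<open>2 ^ n\<close> indicators of intervals of length \<open>2 ^ -n\<close> with coefficients of order \<open>2 powr (- n * b)\<close>, which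
  contributes \<open>2 powr (n * (s - b))\<close> to the norm.\<close>

lemma holder_comp:
  fixes f :: "real \<Rightarrow> real"
  assumes Q: "is_interval Q" "Q \<subseteq> {0..1}" and H: "0 \<le> H" and b: "s < b"
    and holder: "\<And>x y. \<bar>f x - f y\<bar> \<le> H * \<bar>x - y\<bar> powr b"
  shows "\<exists>M. \<forall>k. (\<lambda>x. of_real (f ((T ^^ k) x)) * indicator Q ((T ^^ k) x)) \<in> B \<and>
    N (\<lambda>x. of_real (f ((T ^^ k) x)) * indicator Q ((T ^^ k) x)) \<le> M * \<Theta> k"
proof -
  \<comment> \<open>At level \<open>Suc m\<close> the coefficient is the value at the left end of a
    dyadic interval minus the value at the left end of its parent, which has index
    \<open>i div 2\<close>. Levels up to \<open>n\<close> thus add up to \<open>f\<close> sampled at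
    the left end of the level-\<open>n\<close> interval around the point.\<close>
  define c where "c = (\<lambda>n i. case n of 0 \<Rightarrow> f (real i)
      | Suc m \<Rightarrow> f (real i / 2 ^ n) - f (real (i div 2) / 2 ^ m))"
  define u where "u = (\<lambda>n y. \<Sum>i\<le>2 ^ n. of_real (c n i) * indicator (Q \<inter> dyadic n i) y :: complex)"
  define \<rho> where "\<rho> = 2 powr (s - b)"
  have \<rho>: "0 < \<rho>" "\<rho> < 1" using b by (auto simp: \<rho>_def powr_less_one)
  \<comment> \<open>\<open>H\<close> controls the differences,
    \<open>\<bar>f 0\<bar> + \<bar>f 1\<bar>\<close> the two coefficients of level 0, and the factor
    2 absorbs the additional dyadic interval on each level.\<close>
  define A where "A = 2 * (H + \<bar>f 0\<bar> + \<bar>f 1\<bar>) * C"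
  have b0: "0 < b" using b s_pos by simp
  have cb: "\<bar>c n i\<bar> \<le> (H + \<bar>f 0\<bar> + \<bar>f 1\<bar>) * (1 / 2 ^ n) powr b" if "i \<le> 2 ^ n" for n i
  proof (cases n)
    case 0
    then have "i = 0 \<or> i = 1" using that by auto
    then show ?thesis using 0 H by (auto simp: c_def)
  next
    case (Suc m)
    have d: "\<bar>real i / 2 ^ n - real (i div 2) / 2 ^ m\<bar> \<le> 1 / 2 ^ n"
    proof -
      have "real i = 2 * real (i div 2) + real (i mod 2)"
        by (metis mult_div_mod_eq of_nat_add of_nat_mult of_nat_numeral)
      then have "real i / 2 ^ n - real (i div 2) / 2 ^ m = real (i mod 2) / 2 ^ n"
        by (simp add: Suc field_simps)
      moreover have "real (i mod 2) \<le> 1" using mod_less_divisor[of 2 i] by linarith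
      ultimately show ?thesis by (simp add: divide_right_mono)
    qed
    have "\<bar>c n i\<bar> \<le> H * \<bar>real i / 2 ^ n - real (i div 2) / 2 ^ m\<bar> powr b"
      using holder by (simp add: c_def Suc)
    also have "\<dots> \<le> (H + \<bar>f 0\<bar> + \<bar>f 1\<bar>) * (1 / 2 ^ n) powr b"
      using H d b0 by (intro mult_mono powr_mono2) auto
    finally show ?thesis .
  qed
  have val: "(\<Sum>i\<le>2 ^ n. of_real (d i) * indicator (Q \<inter> dyadic n i) y :: complex) =
      of_real (d (nat \<lfloor>2 ^ n * y\<rfloor>)) * indicator Q y" if y: "y \<in> {0..1}" for n d y
  proof -
    have mem: "nat \<lfloor>2 ^ n * y\<rfloor> \<le> 2 ^ n"
    proof -
      have "\<lfloor>2 ^ n * y\<rfloor> \<le> \<lfloor>2 ^ n :: real\<rfloor>" using y by (intro floor_mono) (simp add: mult_le_one)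
      also have "\<dots> = 2 ^ n" by (metis floor_numeral_power)
      finally show ?thesis by (metis nat_le_iff of_nat_numeral of_nat_power)
    qed
    have "(\<Sum>i\<le>2 ^ n. of_real (d i) * indicator (Q \<inter> dyadic n i) y :: complex) =
      (\<Sum>i\<le>2 ^ n. if i = nat \<lfloor>2 ^ n * y\<rfloor> then of_real (d (nat \<lfloor>2 ^ n * y\<rfloor>)) * indicator Q y else 0)"
      using y mem_dyadic[of y n] by (intro sum.cong) (auto simp: indicator_def)
    then show ?thesis using mem by simp
  qed
  have partial: "(\<Sum>i<Suc n. u i y) = of_real (f (real (nat \<lfloor>2 ^ n * y\<rfloor>) / 2 ^ n)) * indicator Q y"
    if y: "y \<in> {0..1}" for n y
  proof (induction n)
    case 0
    have "u 0 y = of_real (c 0 (nat \<lfloor>2 ^ 0 * y\<rfloor>)) * indicator Q y"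
      unfolding u_def by (rule val[OF y])
    then show ?case by (simp add: c_def)
  next
    case (Suc n)
    have div2: "nat \<lfloor>2 ^ Suc n * y\<rfloor> div 2 = nat \<lfloor>2 ^ n * y\<rfloor>"
      using nat_floor_double_div_2[of "2 ^ n * y"] y by (simp add: mult.assoc)
    have "u (Suc n) y = of_real (c (Suc n) (nat \<lfloor>2 ^ Suc n * y\<rfloor>)) * indicator Q y"
      unfolding u_def by (rule val[OF y])
    also have "c (Suc n) (nat \<lfloor>2 ^ Suc n * y\<rfloor>) =
        f (real (nat \<lfloor>2 ^ Suc n * y\<rfloor>) / 2 ^ Suc n) - f (real (nat \<lfloor>2 ^ n * y\<rfloor>) / 2 ^ n)"
      by (simp only: c_def nat.case div2)
    finally show ?case
      by (simp only: sum.lessThan_Suc[of _ "Suc n"] Suc.IH of_real_diff) (simp only: algebra_simps)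
  qed
  have lim: "(\<lambda>n. \<Sum>i<n. u i y) \<longlonglongrightarrow> of_real (f y) * indicator Q y" if y: "y \<in> {0..1}" for y
  proof (subst filterlim_sequentially_Suc[symmetric], unfold partial[OF y], intro tendsto_intros)
    have le: "\<bar>f (real (nat \<lfloor>2 ^ n * y\<rfloor>) / 2 ^ n) - f y\<bar> \<le> H * ((1/2) powr b) ^ n" for n
    proof -
      have "\<bar>real (nat \<lfloor>2 ^ n * y\<rfloor>) - 2 ^ n * y\<bar> \<le> 1" using y by (simp, linarith)
      then have "\<bar>real (nat \<lfloor>2 ^ n * y\<rfloor>) - 2 ^ n * y\<bar> / 2 ^ n \<le> 1 / 2 ^ n"
        by (intro divide_right_mono) auto
      also have "\<bar>real (nat \<lfloor>2 ^ n * y\<rfloor>) - 2 ^ n * y\<bar> / 2 ^ n = \<bar>(real (nat \<lfloor>2 ^ n * y\<rfloor>) - 2 ^ n * y) / 2 ^ n\<bar>"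
        by (simp add: abs_divide)
      also have "(real (nat \<lfloor>2 ^ n * y\<rfloor>) - 2 ^ n * y) / 2 ^ n = real (nat \<lfloor>2 ^ n * y\<rfloor>) / 2 ^ n - y"
        by (simp add: diff_divide_distrib)
      finally have d: "\<bar>real (nat \<lfloor>2 ^ n * y\<rfloor>) / 2 ^ n - y\<bar> \<le> 1 / 2 ^ n" .
      have "\<bar>f (real (nat \<lfloor>2 ^ n * y\<rfloor>) / 2 ^ n) - f y\<bar> \<le> H * \<bar>real (nat \<lfloor>2 ^ n * y\<rfloor>) / 2 ^ n - y\<bar> powr b"
        by (rule holder)
      also have "\<dots> \<le> H * (1 / 2 ^ n) powr b"
        using d H b0 by (intro mult_left_mono powr_mono2) auto
      also have "(1 / 2 ^ n :: real) powr b = ((1/2) powr b) ^ n"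
      proof -
        have "(1 / 2 ^ n :: real) = (1/2) powr real n" by (simp add: powr_realpow power_one_over)
        moreover have "((1/2::real) powr b) ^ n = ((1/2) powr b) powr real n"
          by (rule powr_realpow[symmetric]) simp
        ultimately show ?thesis by (simp only: powr_powr mult.commute)
      qed
      finally show ?thesis .
    qed
    have "(\<lambda>n. H * ((1/2::real) powr b) ^ n) \<longlonglongrightarrow> H * 0"
      using b0 powr_less_mono2[of b "1/2" 1] by (intro tendsto_intros LIMSEQ_power_zero) auto
    then have null: "(\<lambda>n. H * ((1/2::real) powr b) ^ n) \<longlonglongrightarrow> 0" by (simp only: mult_zero_right)
    have "(\<lambda>n. f (real (nat \<lfloor>2 ^ n * y\<rfloor>) / 2 ^ n) - f y) \<longlonglongrightarrow> 0"
    proof (rule Lim_null_comparison[OF _ null], rule always_eventually, rule allI)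
      show "norm (f (real (nat \<lfloor>2 ^ n * y\<rfloor>) / 2 ^ n) - f y) \<le> H * ((1/2) powr b) ^ n" for n
        unfolding real_norm_def by (rule le)
    qed
    then show "(\<lambda>n. f (real (nat \<lfloor>2 ^ n * y\<rfloor>) / 2 ^ n)) \<longlonglongrightarrow> f y" by (simp add: LIM_zero_iff)
  qed
  have u_mem: "(\<lambda>x. u n ((T ^^ k) x)) \<in> B" for n k
    unfolding u_def by (rule dyadic_step_comp(1)[OF Q cb])
  have u_le: "N (\<lambda>x. u n ((T ^^ k) x)) \<le> A * \<Theta> k * \<rho> ^ n" for n k
  proof -
    have "N (\<lambda>x. u n ((T ^^ k) x)) \<le>
        2 * 2 ^ n * ((H + \<bar>f 0\<bar> + \<bar>f 1\<bar>) * (1 / 2 ^ n) powr b) * (C * \<Theta> k * (1 / 2 ^ n) powr (1 - s))"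
      unfolding u_def by (rule dyadic_step_comp(2)[OF Q cb])
    also have "\<dots> = A * \<Theta> k * (2 ^ n * (1 / 2 ^ n) powr b * (1 / 2 ^ n) powr (1 - s))"
      by (simp add: A_def)
    also have "2 ^ n * (1 / 2 ^ n) powr b * (1 / 2 ^ n) powr (1 - s) = \<rho> ^ n"
    proof -
      have "(1 / 2 ^ n :: real) = 2 powr (- real n)" by (simp add: powr_minus powr_realpow divide_inverse)
      moreover have "(2 ^ n :: real) = 2 powr (real n)" by (simp add: powr_realpow)
      ultimately have "2 ^ n * (1 / 2 ^ n) powr b * (1 / 2 ^ n) powr (1 - s) =
          2 powr (real n + (- real n * b) + (- real n * (1 - s)))"
        by (simp only: powr_powr powr_add)
      also have "real n + (- real n * b) + (- real n * (1 - s)) = (s - b) * real n"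
        by (simp add: algebra_simps)
      also have "2 powr ((s - b) * real n) = \<rho> ^ n"
        using \<rho>(1) by (simp add: \<rho>_def powr_powr[symmetric] powr_realpow)
      finally show ?thesis .
    qed
    finally show ?thesis .
  qed
  have summ\<rho>: "summable (\<lambda>n. A * \<Theta> k * \<rho> ^ n)" for k
    using \<rho> by (intro summable_mult summable_geometric) auto
  have summ: "summable (\<lambda>n. N (\<lambda>x. u n ((T ^^ k) x)))" for k
    by (rule summable_comparison_test'[OF summ\<rho>, of 0]) (use u_le N_nonneg[OF u_mem] in simp)
  have ae: "AE x in mI. (\<lambda>n. \<Sum>i<n. u i ((T ^^ k) x)) \<longlonglongrightarrow> of_real (f ((T ^^ k) x)) * indicator Q ((T ^^ k) x)" for k
  proof (rule AE_mI_finite[OF finite_exceptional[of k]])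
    fix x :: real assume "x \<in> {0..1}" "x \<notin> exceptional k"
    then have "(T ^^ k) x \<in> {0..1}" by (intro power_mem_unit) (auto simp: exceptional_def)
    then show "(\<lambda>n. \<Sum>i<n. u i ((T ^^ k) x)) \<longlonglongrightarrow> of_real (f ((T ^^ k) x)) * indicator Q ((T ^^ k) x)"
      by (rule lim)
  qed
  show ?thesis
  proof (intro exI[of _ "A / (1 - \<rho>)"] allI conjI)
    fix k
    show "(\<lambda>x. of_real (f ((T ^^ k) x)) * indicator Q ((T ^^ k) x)) \<in> B"
      by (rule series_ae(1)[OF u_mem summ ae])
    have "N (\<lambda>x. of_real (f ((T ^^ k) x)) * indicator Q ((T ^^ k) x)) \<le> (\<Sum>n. N (\<lambda>x. u n ((T ^^ k) x)))"
      by (rule series_ae(2)[OF u_mem summ ae])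
    also have "\<dots> \<le> (\<Sum>n. A * \<Theta> k * \<rho> ^ n)" by (intro suminf_le u_le summ summ\<rho>)
    also have "\<dots> = A * \<Theta> k * (1 / (1 - \<rho>))"
      using \<rho> by (subst suminf_mult) (auto simp: suminf_geometric)
    finally show "N (\<lambda>x. of_real (f ((T ^^ k) x)) * indicator Q ((T ^^ k) x)) \<le> A / (1 - \<rho>) * \<Theta> k"
      by simp
  qed
qed


section \<open>Spectrum of the transfer operator\<close>

lemma L_diff: "L (\<lambda>x. f x - g x) = (\<lambda>x. L f x - L g x)"
  by (simp add: transfer_op_def fun_eq_iff diff_divide_distrib sum_subtractf)

lemma L_scale: "L (\<lambda>x. c * f x) = (\<lambda>x. c * L f x)"
  by (simp add: transfer_op_def fun_eq_iff sum_distrib_left)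

lemma L_sum: "L (\<lambda>x. \<Sum>i\<in>A. u i x) = (\<lambda>x. \<Sum>i\<in>A. L (u i) x)"
  unfolding transfer_op_def fun_eq_iff sum_divide_distrib by (intro allI sum.swap)

text \<open>Since \<open>\<phi> (T y)\<close> is constant on the fibre, the only exceptional set is
  that of \<open>transfer_one\<close>. It does not depend on \<open>\<phi>\<close>, so the
  quantifier may stand inside and one null set serves all functions at once.\<close>

lemma L_comp: "AE x in mI. \<forall>\<phi>. L (\<lambda>y. \<phi> (T y)) x = \<phi> x"
  using transfer_one
proof eventually_elim
  case (elim x)
  have "L (\<lambda>y. \<phi> (T y)) x = \<phi> x * of_real (\<Sum>y | y \<in> X \<and> T y = x. 1 / \<bar>deriv T y\<bar>)" for \<phi>
    by (simp add: transfer_op_def sum_distrib_left)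
  then have "L (\<lambda>y. \<phi> (T y)) x = \<phi> x * of_real 1" for \<phi> by (simp only: elim)
  then show ?case by simp
qed

lemma L_memI: "f \<in> B \<Longrightarrow> L f \<in> B"
  using L_mem by blast

lemma L_bound: "\<exists>K\<ge>0. \<forall>f\<in>B. N (L f) \<le> K * N f"
proof -
  obtain K where K: "\<forall>f\<in>B. N (L f) \<le> K * N f" using L_bounded by blast
  have "N (L f) \<le> max 0 K * N f" if "f \<in> B" for f
    using K that mult_right_mono[OF max.cobounded2[of K 0] N_nonneg[OF that]] by force
  then show ?thesis by (intro exI[of _ "max 0 K"]) auto
qed

text \<open>Neumann series for \<open>z - L\<close>. It serves to show that large numbers are
  admissible in the infimum defining the essential spectral radius. The margin 1 in
  \<open>K + 1\<close> makes the inverse bound equal to 1.\<close>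

lemma resolvent_outside:
  assumes K: "0 \<le> K" "\<forall>f\<in>B. N (L f) \<le> K * N f" and z: "K + 1 < cmod z"
  shows "z \<notin> spectrum_on B N L"
proof -
  have z0: "z \<noteq> 0" using K z by auto
  have q: "0 \<le> K / cmod z" "K / cmod z < 1" using K z by (auto simp: divide_less_eq)
  have "\<exists>f\<in>B. eq_ae (\<lambda>x. z * f x - L f x) g" if g: "g \<in> B" for g
  proof -
    have Lg: "(L ^^ n) g \<in> B" for n by (induction n) (auto intro: g L_memI)
    have Ng: "N ((L ^^ n) g) \<le> K ^ n * N g" for n
    proof (induction n)
      case (Suc n)
      have "N ((L ^^ Suc n) g) \<le> K * N ((L ^^ n) g)" using K Lg by simp
      also have "\<dots> \<le> K * (K ^ n * N g)" using Suc K by (intro mult_left_mono) auto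
      finally show ?case by (simp add: mult_ac)
    qed simp
    define u where "u = (\<lambda>n x. (1 / z ^ Suc n) * (L ^^ n) g x)"
    have u: "u n \<in> B" for n unfolding u_def by (intro scale_mem Lg)
    have geo: "summable (\<lambda>n. N g * (K / cmod z) ^ n)"
      using q by (intro summable_mult summable_geometric) auto
    have le: "N (\<lambda>x. (1 / z ^ n) * (L ^^ n) g x) \<le> N g * (K / cmod z) ^ n" for n
    proof -
      have "N (\<lambda>x. (1 / z ^ n) * (L ^^ n) g x) = N ((L ^^ n) g) / cmod z ^ n"
        by (subst N_scale[OF Lg]) (simp add: norm_divide norm_power)
      also have "\<dots> \<le> K ^ n * N g / cmod z ^ n" by (intro divide_right_mono Ng) auto
      finally show ?thesis by (simp add: power_divide mult.commute)
    qed
    have "N (u n) \<le> N g * (K / cmod z) ^ n" for n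
    proof -
      have "N (u n) = N (\<lambda>x. (1 / z ^ n) * (L ^^ n) g x) / cmod z"
      proof -
        have "u n = (\<lambda>x. (1 / z) * ((1 / z ^ n) * (L ^^ n) g x))" by (simp add: u_def)
        then have "N (u n) = cmod (1 / z) * N (\<lambda>x. (1 / z ^ n) * (L ^^ n) g x)"
          using N_scale[OF scale_mem[OF Lg], of "1 / z" "1 / z ^ n" n] by (simp only:)
        then show ?thesis by (simp only: norm_divide norm_one) simp
      qed
      also have "\<dots> \<le> N (\<lambda>x. (1 / z ^ n) * (L ^^ n) g x) / 1"
        using K z by (intro divide_left_mono N_nonneg scale_mem Lg) auto
      finally show ?thesis using le[of n] by simp
    qed
    then have summ: "summable (\<lambda>n. N (u n))"
      by (intro summable_comparison_test'[OF geo, of 0]) (use N_nonneg[OF u] in simp)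
    obtain f where f: "f \<in> B" "(\<lambda>n. N (\<lambda>x. (\<Sum>i<n. u i x) - f x)) \<longlonglongrightarrow> 0"
      by (rule series_limit[OF u summ]) blast
    have Sn: "(\<lambda>x. \<Sum>i<n. u i x) \<in> B" for n by (intro sum_mem u)
    have LSn: "z * (\<Sum>i<n. u i x) - L (\<lambda>x. \<Sum>i<n. u i x) x = g x - (1 / z ^ n) * (L ^^ n) g x" for n x
    proof (induction n)
      case 0
      have "L (\<lambda>x. 0) x = 0" by (simp add: transfer_op_def)
      then show ?case by simp
    next
      case (Suc n)
      have "L (u n) x = (1 / z ^ Suc n) * (L ^^ Suc n) g x"
        unfolding u_def L_scale by simp
      moreover have "z * u n x = (1 / z ^ n) * (L ^^ n) g x" using z0 by (simp add: u_def)
      ultimately show ?case using Suc unfolding L_sum by (simp add: algebra_simps)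
    qed
    have memg: "(\<lambda>x. (z * f x - L f x) - g x) \<in> B"
      using f(1) g by (intro diff_mem scale_mem L_memI)
    have "N (\<lambda>x. (z * f x - L f x) - g x) \<le> (cmod z + K) * N (\<lambda>x. (\<Sum>i<n. u i x) - f x) + N g * (K / cmod z) ^ n" for n
    proof -
      let ?d = "\<lambda>x. (\<Sum>i<n. u i x) - f x"
      have d: "?d \<in> B" by (intro diff_mem Sn f)
      \<comment> \<open>The defect of the limit is split into the truncation error
        \<open>?d\<close>, on which \<open>z - L\<close> is bounded, and the last Neumann remainder
        from \<open>LSn\<close>; both tend to 0, while the left-hand side does not depend on
        \<open>n\<close>.\<close>
      have eq: "(\<lambda>x. (z * f x - L f x) - g x) = (\<lambda>x. L ?d x - (z * ?d x + (1 / z ^ n) * (L ^^ n) g x))"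
        unfolding L_diff using LSn[where n=n] by (auto simp: fun_eq_iff algebra_simps)
      have "N (\<lambda>x. (z * f x - L f x) - g x) \<le> N (L ?d) + N (\<lambda>x. z * ?d x + (1 / z ^ n) * (L ^^ n) g x)"
        unfolding eq by (intro N_diff L_memI add_mem scale_mem d Lg)
      also have "N (\<lambda>x. z * ?d x + (1 / z ^ n) * (L ^^ n) g x) \<le> N (\<lambda>x. z * ?d x) + N (\<lambda>x. (1 / z ^ n) * (L ^^ n) g x)"
        by (intro N_add scale_mem d Lg)
      also have "N (\<lambda>x. z * ?d x) = cmod z * N ?d" by (rule N_scale[OF d])
      finally show ?thesis using K(2) d le[of n] by (force simp: algebra_simps)
    qed
    moreover have "(\<lambda>n. (cmod z + K) * N (\<lambda>x. (\<Sum>i<n. u i x) - f x) + N g * (K / cmod z) ^ n) \<longlonglongrightarrow> (cmod z + K) * 0 + N g * 0"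
      using q by (intro tendsto_intros f LIMSEQ_power_zero) auto
    ultimately have "N (\<lambda>x. (z * f x - L f x) - g x) \<le> (cmod z + K) * 0 + N g * 0"
      by (intro LIMSEQ_le_const) auto
    then have "N (\<lambda>x. (z * f x - L f x) - g x) = 0" using N_nonneg[OF memg] by simp
    then have "eq_ae (\<lambda>x. (z * f x - L f x) - g x) (\<lambda>x. 0)" using N_eq_0[OF memg] by simp
    then have "eq_ae (\<lambda>x. z * f x - L f x) g"
      unfolding eq_ae_def by eventually_elim simp
    then show ?thesis using f(1) by blast
  qed
  moreover have "N f \<le> 1 * N (\<lambda>x. z * f x - L f x)" if f: "f \<in> B" for f
  proof -
    have "cmod z * N f = N (\<lambda>x. z * f x)" by (rule N_scale[OF f, symmetric])
    also have "\<dots> \<le> N (L f) + N (\<lambda>x. z * f x - L f x)"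
      by (intro N_triangle scale_mem L_memI f)
    also have "N (L f) \<le> K * N f" using K f by blast
    finally have "(cmod z - K) * N f \<le> N (\<lambda>x. z * f x - L f x)" by (simp add: algebra_simps)
    moreover have "1 * N f \<le> (cmod z - K) * N f" using z N_nonneg[OF f] by (intro mult_right_mono) auto
    ultimately show ?thesis by simp
  qed
  ultimately show ?thesis unfolding spectrum_on_def by blast
qed

text \<open>\<open>Inf\<close> bounds from below only over a nonempty set; \<open>K + 1\<close>
  belongs to it because no spectrum lies beyond.\<close>

lemma ess_spectral_radius_ge:
  assumes "\<And>r. 0 \<le> r \<Longrightarrow> (\<And>z. z \<in> spectrum_on B N L \<Longrightarrow> r < cmod z \<Longrightarrow> isolated_finite_eigenvalue B N L z)
    \<Longrightarrow> \<rho> \<le> r"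
  shows "\<rho> \<le> ess_spectral_radius B N L"
  unfolding ess_spectral_radius_def
proof (rule cInf_greatest)
  obtain K where "0 \<le> K" "\<forall>f\<in>B. N (L f) \<le> K * N f" using L_bound by blast
  then have "K + 1 \<in> {r. 0 \<le> r \<and>
        (\<forall>z \<in> spectrum_on B N L. r < cmod z \<longrightarrow> isolated_finite_eigenvalue B N L z)}"
    using resolvent_outside by fastforce
  then show "{r. 0 \<le> r \<and>
        (\<forall>z \<in> spectrum_on B N L. r < cmod z \<longrightarrow> isolated_finite_eigenvalue B N L z)} \<noteq> {}" by blast
qed (use assms in blast)

lemma eigenvalue_in_spectrum:
  assumes "is_eigenvalue B L z"
  shows "z \<in> spectrum_on B N L"
proof (rule ccontr)
  assume "z \<notin> spectrum_on B N L"
  then obtain K where K: "\<forall>f\<in>B. N f \<le> K * N (\<lambda>x. z * f x - L f x)"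
    unfolding spectrum_on_def by blast
  obtain f where f: "f \<in> B" "eq_ae (L f) (\<lambda>x. z * f x)" "\<not> eq_ae f (\<lambda>x. 0)"
    using assms unfolding is_eigenvalue_def eigenspace_def by blast
  have mem: "(\<lambda>x. z * f x - L f x) \<in> B" using f(1) by (intro diff_mem scale_mem L_memI)
  have "eq_ae (\<lambda>x. z * f x - L f x) (\<lambda>x. 0)"
    using f(2) unfolding eq_ae_def by eventually_elim simp
  then have "N (\<lambda>x. z * f x - L f x) = 0" using N_eq_0[OF mem] by simp
  then have "N f = 0" using K f(1) N_nonneg[OF f(1)] by fastforce
  then show False using N_eq_0[OF f(1)] f(3) by simp
qed

lemma eigenspace_subset: "eigenspace B L z \<subseteq> gen_eigenspace B L z"
proof
  fix f assume "f \<in> eigenspace B L z"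
  then have f: "f \<in> B" "eq_ae (L f) (\<lambda>x. z * f x)" by (auto simp: eigenspace_def)
  have "eq_ae (((\<lambda>g x. L g x - z * g x) ^^ 1) f) (\<lambda>x. 0)"
    using f(2) by (simp add: eq_ae_def)
  then show "f \<in> gen_eigenspace B L z" using f(1) unfolding gen_eigenspace_def by blast
qed

section \<open>Eigenfunctions from the kernel\<close>

text \<open>\<open>L\<close> kills the term \<open>k = 0\<close> and sends the term
  \<open>k + 1\<close> to \<open>z\<close> times the term \<open>k\<close>, so it maps each partial
  sum to \<open>z\<close> times the preceding one. Boundedness of \<open>L\<close> passes this to
  the limit. The \<open>L\<^sup>1\<close> convergence is recorded because the independence proof
  recovers \<open>\<phi>\<close> from the partial sums.\<close>

lemma kernel_eigenfunction:
  assumes \<phi>: "\<And>k. (\<lambda>x. \<phi> ((T ^^ k) x)) \<in> B" "\<And>k. N (\<lambda>x. \<phi> ((T ^^ k) x)) \<le> M * \<Theta> k"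
    and ker: "\<And>x. L \<phi> x = 0" and z: "cmod z < 1 / Theta_infty P T (1 - s)"
  shows "\<exists>f\<in>eigenspace B L z. (\<lambda>n. L1_norm (\<lambda>x. (\<Sum>k<n. z ^ k * \<phi> ((T ^^ k) x)) - f x)) \<longlonglongrightarrow> 0"
proof -
  define u where "u = (\<lambda>k x. z ^ k * \<phi> ((T ^^ k) x))"
  have u: "u k \<in> B" for k unfolding u_def by (intro scale_mem \<phi>)
  have le: "N (u k) \<le> M * (cmod z ^ k * \<Theta> k)" for k
  proof -
    have "N (u k) = cmod z ^ k * N (\<lambda>x. \<phi> ((T ^^ k) x))"
      unfolding u_def by (subst N_scale[OF \<phi>(1)]) (simp add: norm_power)
    also have "\<dots> \<le> cmod z ^ k * (M * \<Theta> k)" by (intro mult_left_mono \<phi>) auto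
    finally show ?thesis by (simp add: mult_ac)
  qed
  have geo: "summable (\<lambda>k. M * (cmod z ^ k * \<Theta> k))"
    using s_pos s_less_1 z by (intro summable_mult summable_Theta) auto
  have summ: "summable (\<lambda>k. N (u k))"
    by (rule summable_comparison_test'[OF geo, of 0]) (use le N_nonneg[OF u] in simp)
  obtain f where f: "f \<in> B" "(\<lambda>n. N (\<lambda>x. (\<Sum>i<n. u i x) - f x)) \<longlonglongrightarrow> 0"
    by (rule series_limit[OF u summ]) blast
  have Sn: "(\<lambda>x. \<Sum>i<n. u i x) \<in> B" for n by (intro sum_mem u)
  have lim: "(\<lambda>n. L1_norm (\<lambda>x. (\<Sum>k<n. u k x) - f x)) \<longlonglongrightarrow> 0"
    by (rule L1_tendsto[OF Sn f])
  have LS: "AE x in mI. \<forall>n. L (\<lambda>x. \<Sum>i<Suc n. u i x) x = z * (\<Sum>i<n. u i x)"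
    using L_comp
  proof eventually_elim
    case (elim x)
    have uS: "u (Suc i) = (\<lambda>y. z ^ Suc i * \<phi> ((T ^^ i) (T y)))" for i
      by (simp add: u_def funpow_swap1)
    have "L (u (Suc i)) x = z * u i x" for i
      unfolding uS L_scale using elim[rule_format, of "\<lambda>y. \<phi> ((T ^^ i) y)"] by (simp add: u_def)
    moreover have "L (u 0) x = 0" using ker by (simp add: u_def)
    ultimately have "(\<Sum>i<Suc n. L (u i) x) = z * (\<Sum>i<n. u i x)" for n
      by (simp only: sum.lessThan_Suc_shift sum_distrib_left) simp
    then show ?case unfolding L_sum by blast
  qed
  obtain K where K: "0 \<le> K" "\<forall>f\<in>B. N (L f) \<le> K * N f" using L_bound by blast
  have mem: "(\<lambda>x. L f x - z * f x) \<in> B" using f(1) by (intro diff_mem scale_mem L_memI)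
  have "N (\<lambda>x. L f x - z * f x) \<le> K * N (\<lambda>x. (\<Sum>i<Suc n. u i x) - f x) + cmod z * N (\<lambda>x. (\<Sum>i<n. u i x) - f x)" for n
  proof -
    let ?d = "\<lambda>n x. (\<Sum>i<n. u i x) - f x"
    have d: "?d n \<in> B" for n by (intro diff_mem Sn f)
    have eq: "eq_ae (\<lambda>x. z * ?d n x - L (?d (Suc n)) x) (\<lambda>x. L f x - z * f x)"
      unfolding eq_ae_def L_diff using LS
    proof eventually_elim
      case (elim x)
      show ?case unfolding elim[rule_format, of n] by (simp add: algebra_simps)
    qed
    have "N (\<lambda>x. L f x - z * f x) = N (\<lambda>x. z * ?d n x - L (?d (Suc n)) x)"
      by (rule N_ae[OF _ eq]) (intro diff_mem scale_mem L_memI Sn f)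
    also have "\<dots> \<le> N (\<lambda>x. z * ?d n x) + N (L (?d (Suc n)))"
      by (intro N_diff scale_mem L_memI d)
    also have "N (\<lambda>x. z * ?d n x) = cmod z * N (?d n)" by (rule N_scale[OF d])
    also have "N (L (?d (Suc n))) \<le> K * N (?d (Suc n))" using K d by blast
    finally show ?thesis by simp
  qed
  moreover have "(\<lambda>n. K * N (\<lambda>x. (\<Sum>i<Suc n. u i x) - f x) + cmod z * N (\<lambda>x. (\<Sum>i<n. u i x) - f x))
      \<longlonglongrightarrow> K * 0 + cmod z * 0"
    using f(2) LIMSEQ_Suc[OF f(2)] by (intro tendsto_intros)
  ultimately have "N (\<lambda>x. L f x - z * f x) \<le> K * 0 + cmod z * 0"
    by (intro LIMSEQ_le_const) auto
  then have "N (\<lambda>x. L f x - z * f x) = 0" using N_nonneg[OF mem] by simp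
  then have "eq_ae (\<lambda>x. L f x - z * f x) (\<lambda>x. 0)" using N_eq_0[OF mem] by simp
  then have "f \<in> eigenspace B L z"
    using f(1) by (simp add: eigenspace_def eq_ae_def)
  with lim show ?thesis by (auto simp: u_def)
qed

text \<open>Two points with the same image lie in different pieces, whose images are open and so
  share a ball. Over each small interval \<open>V i\<close> of that ball, \<open>L\<close> turns
  \<open>\<bar>T'\<bar>\<close> on either preimage into the indicator of \<open>V i\<close>, and the
  difference is killed. Disjoint \<open>V i\<close> give the sets \<open>S i\<close>, which separate
  the functions.\<close>

lemma kernel_functions:
  assumes "\<not> inj_on T X" "s < \<beta>"
  obtains \<phi> :: "nat \<Rightarrow> real \<Rightarrow> complex" and M S where
    "\<And>i k. (\<lambda>x. \<phi> i ((T ^^ k) x)) \<in> B" "\<And>i k. N (\<lambda>x. \<phi> i ((T ^^ k) x)) \<le> M i * \<Theta> k"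
    "\<And>i x. L (\<phi> i) x = 0" "\<And>i. open (S i)" "\<And>i. S i \<noteq> {}" "\<And>i. S i \<subseteq> {0..1}"
    "\<And>i x. x \<in> S i \<Longrightarrow> \<phi> i x \<noteq> 0" "\<And>i j x. i \<noteq> j \<Longrightarrow> x \<in> S i \<Longrightarrow> \<phi> j x = 0"
proof -
  obtain y1 y2 where y: "y1 \<in> X" "y2 \<in> X" "y1 \<noteq> y2" "T y1 = T y2"
    using assms(1) by (auto simp: inj_on_def)
  obtain J1 J2 where J: "J1 \<in> P" "y1 \<in> J1" "J2 \<in> P" "y2 \<in> J2" using y by blast
  have J12: "J1 \<inter> J2 = {}"
  proof -
    have "J1 \<noteq> J2" using inj_on_piece[OF J(1)] J y by (auto dest: inj_onD)
    then show ?thesis using same_piece[OF J(1,3)] by blast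
  qed
  have opn: "open (T ` J)" if "J \<in> P" for J
    using isCont_T inj_on_piece[OF that] open_piece[OF that] that
    by (intro invariance_of_domain continuous_at_imp_continuous_on) auto
  have "open (T ` J1 \<inter> T ` J2)" using opn J by auto
  moreover have "T y1 \<in> T ` J1" using J by blast
  moreover have "T y1 \<in> T ` J2" unfolding y(4) using J by blast
  ultimately have "open (T ` J1 \<inter> T ` J2)" "T y1 \<in> T ` J1 \<inter> T ` J2" by blast+
  then obtain e where e: "0 < e" "ball (T y1) e \<subseteq> T ` J1 \<inter> T ` J2"
    using open_contains_ball by blast
  \<comment> \<open>Infinitely many disjoint intervals shrinking to \<open>T y1\<close> from the
    right: the left end of each is the right end of the next, and all stay within distance
    \<open>e / 2\<close>.\<close>
  define V where "V = (\<lambda>i::nat. {T y1 + e / (real i + 3)<..<T y1 + e / (real i + 2)})"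
  have V: "V i \<noteq> {}" "V i \<subseteq> T ` J1 \<inter> T ` J2" "open (V i)" "is_interval (V i)" for i
  proof -
    show "V i \<noteq> {}" using e(1) by (simp add: V_def frac_less2 not_le divide_strict_left_mono)
    have "V i \<subseteq> ball (T y1) e"
    proof
      fix v assume "v \<in> V i"
      moreover have "0 < e / (real i + 3)" "e / (real i + 2) \<le> e" using e(1) by (auto simp: field_simps)
      ultimately show "v \<in> ball (T y1) e" by (auto simp: V_def dist_real_def)
    qed
    then show "V i \<subseteq> T ` J1 \<inter> T ` J2" using e(2) by blast
  qed (auto simp: V_def is_interval_oo)
  have Vdisj: "V i \<inter> V j = {}" if "i < j" for i j
  proof -
    have "e / (real j + 2) \<le> e / (real i + 3)" using e(1) that by (intro divide_left_mono) auto
    then show ?thesis by (auto simp: V_def)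
  qed
  then have Vdisj: "V i \<inter> V j = {}" if "i \<noteq> j" for i j
    using that by (metis Int_commute nat_neq_iff)
  define Q where "Q = (\<lambda>J i. {y\<in>J. T y \<in> V i})"
  have Q: "is_interval (Q J i)" "Q J i \<subseteq> {0..1}" if "J \<in> P" for J i
  proof -
    have "is_interval J" using piece_interval[OF that] by (auto simp: is_interval_oo)
    then show "is_interval (Q J i)" unfolding Q_def
      using isCont_T inj_on_piece[OF that] V(4) that
      by (intro interval_preimage continuous_at_imp_continuous_on) auto
    show "Q J i \<subseteq> {0..1}" using X_subset that by (auto simp: Q_def)
  qed
  define b where "b = min \<beta> 1"
  have b: "s < b" using assms(2) s_less_1 by (simp add: b_def)
  obtain f1 H1 where f1: "\<And>x. x \<in> J1 \<Longrightarrow> f1 x = \<bar>deriv T x\<bar>"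
    "\<And>x y. \<bar>f1 x - f1 y\<bar> \<le> H1 * \<bar>x - y\<bar> powr b" "0 \<le> H1"
    using deriv_holder_extension[OF J(1)] unfolding b_def by metis
  obtain f2 H2 where f2: "\<And>x. x \<in> J2 \<Longrightarrow> f2 x = \<bar>deriv T x\<bar>"
    "\<And>x y. \<bar>f2 x - f2 y\<bar> \<le> H2 * \<bar>x - y\<bar> powr b" "0 \<le> H2"
    using deriv_holder_extension[OF J(3)] unfolding b_def by metis
  define g1 where "g1 = (\<lambda>i y. of_real (f1 y) * indicator (Q J1 i) y :: complex)"
  define g2 where "g2 = (\<lambda>i y. of_real (f2 y) * indicator (Q J2 i) y :: complex)"
  have "\<exists>M. \<forall>k. (\<lambda>x. g1 i ((T ^^ k) x)) \<in> B \<and> N (\<lambda>x. g1 i ((T ^^ k) x)) \<le> M * \<Theta> k" for i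
    unfolding g1_def by (rule holder_comp[OF Q[OF J(1)] f1(3) b f1(2)])
  then obtain M1 where M1: "\<And>i k. (\<lambda>x. g1 i ((T ^^ k) x)) \<in> B \<and> N (\<lambda>x. g1 i ((T ^^ k) x)) \<le> M1 i * \<Theta> k"
    by metis
  have "\<exists>M. \<forall>k. (\<lambda>x. g2 i ((T ^^ k) x)) \<in> B \<and> N (\<lambda>x. g2 i ((T ^^ k) x)) \<le> M * \<Theta> k" for i
    unfolding g2_def by (rule holder_comp[OF Q[OF J(3)] f2(3) b f2(2)])
  then obtain M2 where M2: "\<And>i k. (\<lambda>x. g2 i ((T ^^ k) x)) \<in> B \<and> N (\<lambda>x. g2 i ((T ^^ k) x)) \<le> M2 i * \<Theta> k"
    by metis
  show ?thesis
  proof (rule that[of "\<lambda>i y. g1 i y - g2 i y" "\<lambda>i. M1 i + M2 i" "Q J1"])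
    fix i k
    show "(\<lambda>x. g1 i ((T ^^ k) x) - g2 i ((T ^^ k) x)) \<in> B" using M1 M2 by (intro diff_mem) auto
    have "N (\<lambda>x. g1 i ((T ^^ k) x) - g2 i ((T ^^ k) x)) \<le> N (\<lambda>x. g1 i ((T ^^ k) x)) + N (\<lambda>x. g2 i ((T ^^ k) x))"
      using M1 M2 by (intro N_diff) auto
    also have "\<dots> \<le> M1 i * \<Theta> k + M2 i * \<Theta> k" using M1 M2 by (intro add_mono) auto
    finally show "N (\<lambda>x. g1 i ((T ^^ k) x) - g2 i ((T ^^ k) x)) \<le> (M1 i + M2 i) * \<Theta> k"
      by (simp add: algebra_simps)
  next
    fix i x
    have LG: "L (\<lambda>y. of_real (f y) * indicator (Q J i) y) x = indicator (V i) x"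
      if J: "J \<in> P" and f: "\<And>y. y \<in> J \<Longrightarrow> f y = \<bar>deriv T y\<bar>" and VJ: "V i \<subseteq> T ` J" for J f
    proof (cases "x \<in> V i")
      case False
      then have "y \<notin> Q J i" if "T y = x" for y using that by (auto simp: Q_def)
      then have "L (\<lambda>y. of_real (f y) * indicator (Q J i) y) x = 0"
        unfolding transfer_op_def by (intro sum.neutral) auto
      then show ?thesis using False by simp
    next
      case True
      then obtain y0 where y0: "y0 \<in> J" "T y0 = x" using VJ by blast
      have "L (\<lambda>y. of_real (f y) * indicator (Q J i) y) x = (\<Sum>y | y \<in> X \<and> T y = x. if y = y0 then 1 else 0)"
        unfolding transfer_op_def
      proof (rule sum.cong)
        fix y assume y: "y \<in> {y \<in> X. T y = x}"
        show "complex_of_real (f y) * indicator (Q J i) y / of_real \<bar>deriv T y\<bar> = (if y = y0 then 1 else 0)"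
        proof (cases "y \<in> J")
          case True
          then have "y = y0" using inj_on_piece[OF J] y y0 by (auto dest: inj_onD)
          moreover have "deriv T y \<noteq> 0" using DERIV_T(2)[of y] y by force
          ultimately show ?thesis using f[OF True] True y \<open>x \<in> V i\<close> by (simp add: Q_def)
        next
          case False
          then show ?thesis using y0 by (auto simp: Q_def)
        qed
      qed simp
      also have "\<dots> = 1" using fibre_finite[of x] y0 J by auto
      finally show ?thesis using True by simp
    qed
    show "L (\<lambda>y. g1 i y - g2 i y) x = 0"
      unfolding L_diff g1_def g2_def using LG[OF J(1) f1(1)] LG[OF J(3) f2(1)] V(2)[of i] by simp
  next
    fix i
    have "continuous_on J1 T" using isCont_T J(1) by (intro continuous_at_imp_continuous_on) auto
    then have "open (J1 \<inter> T -` V i)" using open_piece[OF J(1)] V(3) by (rule continuous_open_preimage)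
    moreover have "Q J1 i = J1 \<inter> T -` V i" by (auto simp: Q_def)
    ultimately show "open (Q J1 i)" by simp
    show "Q J1 i \<noteq> {}" using V(1,2)[of i] by (auto simp: Q_def)
    show "Q J1 i \<subseteq> {0..1}" by (rule Q(2)[OF J(1)])
    fix x assume x: "x \<in> Q J1 i"
    then have "x \<in> J1" "x \<notin> J2" using J12 by (auto simp: Q_def)
    then have "f1 x \<noteq> 0" using f1(1) DERIV_T(2)[of x] J(1) by fastforce
    then show "g1 i x - g2 i x \<noteq> 0" using x \<open>x \<notin> J2\<close> by (auto simp: g1_def g2_def Q_def)
  next
    fix i j x assume "i \<noteq> j" "x \<in> Q J1 i"
    then have "x \<notin> Q J1 j" "x \<notin> Q J2 j" using Vdisj[of i j] J12 by (auto simp: Q_def)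
    then show "g1 j x - g2 j x = 0" by (simp add: g1_def g2_def)
  qed
qed

lemma L1_norm_comp:
  assumes "integrable mI f"
  shows "L1_norm (\<lambda>x. f (T x)) = L1_norm f"
  unfolding L1_norm_def using integral_comp(2)[of "\<lambda>x. cmod (f x)"] assms by simp

text \<open>Each eigenfunction satisfies \<open>e i = \<phi> i + z * (e i \<circ> T)\<close>, so a
  relation among the \<open>e i\<close> forces the same relation among the \<open>\<phi> i\<close>,
  which the sets \<open>S i\<close> exclude. This is carried out with the partial sums
  \<open>U m\<close> in \<open>L\<^sup>1\<close>, where composition with \<open>T\<close> preserves
  the norm.\<close>

lemma small_eigenvalues:
  assumes "\<not> inj_on T X" "s < \<beta>" and z: "cmod z < 1 / Theta_infty P T (1 - s)"
  shows "\<exists>e. (\<forall>i. e i \<in> eigenspace B L z) \<and>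
    (\<forall>n a. eq_ae (\<lambda>x. \<Sum>i<n. a i * e i x) (\<lambda>x. 0) \<longrightarrow> (\<forall>i<n::nat. a i = 0))"
proof -
  obtain \<phi> :: "nat \<Rightarrow> real \<Rightarrow> complex" and M S where
    mem: "\<And>i k. (\<lambda>x. \<phi> i ((T ^^ k) x)) \<in> B" and le: "\<And>i k. N (\<lambda>x. \<phi> i ((T ^^ k) x)) \<le> M i * \<Theta> k"
    and ker: "\<And>i x. L (\<phi> i) x = 0" and S: "\<And>i. open (S i)" "\<And>i. S i \<noteq> {}" "\<And>i. S i \<subseteq> {0..1}"
    and on: "\<And>i x. x \<in> S i \<Longrightarrow> \<phi> i x \<noteq> 0" and off: "\<And>i j x. i \<noteq> j \<Longrightarrow> x \<in> S i \<Longrightarrow> \<phi> j x = 0"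
    by (rule kernel_functions[OF assms(1,2)]) blast
  define u where "u = (\<lambda>i n x. \<Sum>k<n. z ^ k * \<phi> i ((T ^^ k) x))"
  have "\<exists>f\<in>eigenspace B L z. (\<lambda>n. L1_norm (\<lambda>x. u i n x - f x)) \<longlonglongrightarrow> 0" for i
    unfolding u_def by (rule kernel_eigenfunction[OF mem le ker z])
  then obtain e where e: "\<And>i. e i \<in> eigenspace B L z"
    "\<And>i. (\<lambda>n. L1_norm (\<lambda>x. u i n x - e i x)) \<longlonglongrightarrow> 0" by metis
  have eB: "e i \<in> B" for i using e(1) by (auto simp: eigenspace_def)
  have uB: "u i n \<in> B" for i n unfolding u_def by (intro sum_mem scale_mem mem)
  have "\<forall>i<n. a i = 0" if ae: "eq_ae (\<lambda>x. \<Sum>i<n. a i * e i x) (\<lambda>x. 0)" for n and a :: "nat \<Rightarrow> complex"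
  proof -
    define \<Phi> where "\<Phi> = (\<lambda>x. \<Sum>i<n. a i * \<phi> i x)"
    define U where "U = (\<lambda>m x. \<Sum>i<n. a i * u i m x)"
    have UB: "U m \<in> B" for m unfolding U_def by (intro sum_mem scale_mem uB)
    have \<Phi>B: "\<Phi> \<in> B" unfolding \<Phi>_def using mem[of _ 0] by (intro sum_mem scale_mem) auto
    have Ulim: "(\<lambda>m. L1_norm (U m)) \<longlonglongrightarrow> 0"
    proof (rule Lim_null_comparison[OF always_eventually])
      show "\<forall>m. norm (L1_norm (U m)) \<le> (\<Sum>i<n. cmod (a i) * L1_norm (\<lambda>x. u i m x - e i x))"
      proof
        fix m
        have "L1_norm (U m) \<le> (\<integral>x. (\<Sum>i<n. cmod (a i) * cmod (u i m x - e i x)) \<partial>mI)"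
          unfolding L1_norm_def
        proof (rule integral_mono_AE)
          show "integrable mI (\<lambda>x. cmod (U m x))" using integrable_mem[OF UB] by simp
          show "integrable mI (\<lambda>x. \<Sum>i<n. cmod (a i) * cmod (u i m x - e i x))"
            using integrable_mem[OF uB] integrable_mem[OF eB] by auto
          show "AE x in mI. cmod (U m x) \<le> (\<Sum>i<n. cmod (a i) * cmod (u i m x - e i x))"
            using ae unfolding eq_ae_def
          proof eventually_elim
            case (elim x)
            have "U m x = (\<Sum>i<n. a i * (u i m x - e i x))"
              using elim by (simp add: U_def right_diff_distrib sum_subtractf)
            also have "cmod \<dots> \<le> (\<Sum>i<n. cmod (a i * (u i m x - e i x)))" by (rule norm_sum)
            finally show ?case by (simp add: norm_mult)
          qed
        qed
        also have "\<dots> = (\<Sum>i<n. cmod (a i) * L1_norm (\<lambda>x. u i m x - e i x))"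
          unfolding L1_norm_def using integrable_mem[OF uB] integrable_mem[OF eB]
          by (subst Bochner_Integration.integral_sum) auto
        finally show "norm (L1_norm (U m)) \<le> (\<Sum>i<n. cmod (a i) * L1_norm (\<lambda>x. u i m x - e i x))"
          by (simp add: L1_norm_def)
      qed
      have "(\<lambda>m. \<Sum>i<n. cmod (a i) * L1_norm (\<lambda>x. u i m x - e i x)) \<longlonglongrightarrow> (\<Sum>i<n. cmod (a i) * 0)"
        by (intro tendsto_intros e)
      then show "(\<lambda>m. \<Sum>i<n. cmod (a i) * L1_norm (\<lambda>x. u i m x - e i x)) \<longlonglongrightarrow> 0" by simp
    qed
    have USuc: "\<Phi> x = U (Suc m) x + (- z) * U m (T x)" for m x
    proof -
      have "u i (Suc m) x = \<phi> i x + z * u i m (T x)" for i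
        unfolding u_def by (simp only: sum.lessThan_Suc_shift sum_distrib_left)
          (simp add: funpow_swap1 mult.assoc)
      then show ?thesis
        by (simp add: U_def \<Phi>_def sum_distrib_left distrib_left sum.distrib sum_negf mult_ac)
    qed
    have "L1_norm \<Phi> \<le> L1_norm (U (Suc m)) + cmod z * L1_norm (U m)" for m
    proof -
      have int: "integrable mI (U m)" "integrable mI (U (Suc m))" using integrable_mem[OF UB] by auto
      have "L1_norm \<Phi> = L1_norm (\<lambda>x. U (Suc m) x + (- z) * U m (T x))" by (simp only: USuc[symmetric])
      also have "\<dots> \<le> L1_norm (U (Suc m)) + L1_norm (\<lambda>x. (- z) * U m (T x))"
        by (intro L1_norm_triangle int integrable_mult_right integral_comp)
      also have "L1_norm (\<lambda>x. (- z) * U m (T x)) = cmod z * L1_norm (\<lambda>x. U m (T x))"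
        by (simp add: L1_norm_def norm_mult)
      also have "L1_norm (\<lambda>x. U m (T x)) = L1_norm (U m)" by (rule L1_norm_comp[OF int(1)])
      finally show ?thesis .
    qed
    moreover have "(\<lambda>m. L1_norm (U (Suc m)) + cmod z * L1_norm (U m)) \<longlonglongrightarrow> 0 + cmod z * 0"
      by (intro tendsto_intros Ulim LIMSEQ_Suc)
    ultimately have "L1_norm \<Phi> \<le> 0 + cmod z * 0" by (intro LIMSEQ_le_const) auto
    then have "L1_norm \<Phi> = 0" using L1_norm_def by (simp add: order_antisym)
    then have ae\<Phi>: "eq_ae \<Phi> (\<lambda>x. 0)" by (intro L1_norm_eq_0 integrable_mem \<Phi>B)
    show ?thesis
    proof (intro allI impI, rule ccontr)
      fix i assume i: "i < n" "a i \<noteq> 0"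
      have "\<Phi> x \<noteq> 0" if "x \<in> S i" for x
      proof -
        have "\<Phi> x = (\<Sum>j<n. if j = i then a i * \<phi> i x else 0)"
          unfolding \<Phi>_def using off[of i _ x] that by (intro sum.cong) auto
        then show ?thesis using i on[OF that] by simp
      qed
      then have "\<And>x. \<Phi> x = 0 \<Longrightarrow> x \<notin> S i" by blast
      then have "AE x in mI. x \<notin> S i" using ae\<Phi> unfolding eq_ae_def by (rule eventually_mono[rotated])
      then show False using positive_length_open[OF S] by blast
    qed
  qed
  with e(1) show ?thesis by blast
qed

lemma eigenvalue_if_independent:
  assumes "\<And>i. e i \<in> eigenspace B L z"
    "\<And>n a. eq_ae (\<lambda>x. \<Sum>i<n. a i * e i x) (\<lambda>x. 0) \<Longrightarrow> \<forall>i<n::nat. a i = 0"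
  shows "is_eigenvalue B L z"
proof -
  have "\<not> eq_ae (e 0) (\<lambda>x. 0)" using assms(2)[where n=1 and a="\<lambda>_. 1"] by auto
  then show ?thesis using assms(1) unfolding is_eigenvalue_def by blast
qed

lemma infinite_small_eigenspaces:
  assumes "\<not> inj_on T X" "s < \<beta>" "cmod z < 1 / Theta_infty P T (1 - s)"
  shows "is_eigenvalue B L z" "\<not> fin_dim_ae (eigenspace B L z)" "\<not> fin_dim_ae (gen_eigenspace B L z)"
proof -
  obtain e where e: "\<And>i. e i \<in> eigenspace B L z"
    "\<And>n a. eq_ae (\<lambda>x. \<Sum>i<n. a i * e i x) (\<lambda>x. 0) \<Longrightarrow> \<forall>i<n::nat. a i = 0"
    using small_eigenvalues[OF assms] by metis
  show "is_eigenvalue B L z" by (rule eigenvalue_if_independent[OF e])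
  show "\<not> fin_dim_ae (eigenspace B L z)" by (rule not_fin_dim_ae[OF e])
  show "\<not> fin_dim_ae (gen_eigenspace B L z)"
    by (rule not_fin_dim_ae[OF subsetD[OF eigenspace_subset e(1)] e(2)])
qed

text \<open>A real \<open>t\<close> strictly between \<open>r\<close> and the claimed bound is
  already an eigenvalue of infinite multiplicity.\<close>

lemma ess_spectral_radius_noninjective:
  assumes "\<not> inj_on T X" "s < \<beta>"
  shows "1 / Theta_infty P T (1 - s) \<le> ess_spectral_radius B N L"
proof (rule ess_spectral_radius_ge, rule ccontr)
  fix r assume r: "0 \<le> r"
    and iso: "\<And>z. z \<in> spectrum_on B N L \<Longrightarrow> r < cmod z \<Longrightarrow> isolated_finite_eigenvalue B N L z"
    and "\<not> 1 / Theta_infty P T (1 - s) \<le> r"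
  then obtain t where t: "r < t" "t < 1 / Theta_infty P T (1 - s)" using dense by (metis not_le)
  have z: "cmod (of_real t) = t" using r t by simp
  then have "is_eigenvalue B L (of_real t)" "\<not> fin_dim_ae (gen_eigenspace B L (of_real t))"
    using infinite_small_eigenspaces[OF assms, of "of_real t"] t by auto
  then show False
    using iso[OF eigenvalue_in_spectrum] z t unfolding isolated_finite_eigenvalue_def by auto
qed

end

section \<open>Fourier sums over roots of unity\<close>

lemma roots_of_unity_orthogonal:
  fixes R :: nat
  assumes "a < R" "b < R"
  shows "(\<Sum>q<R. cis (2 * pi * real q / real R) ^ a * cnj (cis (2 * pi * real q / real R) ^ b)) =
    (if a = b then of_nat R else 0)"
proof -
  define \<zeta> where "\<zeta> = cis (2 * pi * (real a - real b) / real R)"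
  have R: "0 < R" using assms by simp
  have summand: "cis (2 * pi * real q / real R) ^ a * cnj (cis (2 * pi * real q / real R) ^ b) = \<zeta> ^ q" for q
  proof -
    have "cis (2 * pi * real q / real R) ^ a * cnj (cis (2 * pi * real q / real R) ^ b) =
        cis (real a * (2 * pi * real q / real R) - real b * (2 * pi * real q / real R))"
      by (simp only: Complex.DeMoivre cis_cnj cis_mult diff_conv_add_uminus)
    also have "real a * (2 * pi * real q / real R) - real b * (2 * pi * real q / real R) =
        real q * (2 * pi * (real a - real b) / real R)"
      by (simp add: algebra_simps diff_divide_distrib)
    finally show ?thesis by (simp add: \<zeta>_def Complex.DeMoivre)
  qed
  show ?thesis
  proof (cases "a = b")
    case True
    then have "\<zeta> = 1" by (simp add: \<zeta>_def)
    then show ?thesis unfolding summand using True by simp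
  next
    case False
    have "\<zeta> \<noteq> 1"
    proof
      assume "\<zeta> = 1"
      then have "cos (2 * pi * (real a - real b) / real R) = 1" by (simp add: \<zeta>_def complex_eq_iff)
      then obtain k :: int where "2 * pi * (real a - real b) / real R = of_int k * 2 * pi"
        using cos_one_2pi_int by blast
      then have "2 * pi * (real a - real b) = 2 * pi * (of_int k * real R)"
        using R by (simp add: field_simps)
      then have "real_of_int (int a - int b) = real_of_int (k * int R)" by simp
      then have eq: "int a - int b = k * int R" by (simp only: of_int_eq_iff)
      then have "int R dvd int a - int b" by simp
      then have "int R \<le> \<bar>int a - int b\<bar>" using False by (intro zdvd_imp_le) auto
      then show False using assms by linarith
    qed
    moreover have "\<zeta> ^ R = 1"
    proof -
      have "\<zeta> ^ R = cis (2 * pi * of_int (int a - int b))"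
        using R by (simp add: \<zeta>_def Complex.DeMoivre)
      then show ?thesis by (simp only: cis_multiple_2pi Ints_of_int)
    qed
    ultimately have "(\<Sum>q<R. \<zeta> ^ q) = 0" by (simp add: geometric_sum)
    then show ?thesis using False by (simp only: summand) simp
  qed
qed

text \<open>Averaging the squared modulus gives Parseval's identity, and the weight
  \<open>Re (w q)\<close> extracts the lag-one autocorrelation. With \<open>R = l + 2\<close> nodes
  for \<open>l + 1\<close> coefficients the shifted exponents stay below \<open>R\<close>, so there
  is no cyclic term joining \<open>v l\<close> to \<open>v 0\<close>.\<close>

lemma weighted_parseval:
  fixes v :: "nat \<Rightarrow> complex" and l :: nat and \<kappa> :: real
  defines "R \<equiv> Suc (Suc l)"
  defines "w \<equiv> \<lambda>q. cis (2 * pi * real q / real R)"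
  shows "(\<Sum>q<R. (Re (w q) - \<kappa>) * (cmod (\<Sum>j<Suc l. w q ^ j * v j))\<^sup>2) =
    real R * (Re (\<Sum>i<l. v i * cnj (v (Suc i))) - \<kappa> * (\<Sum>i<Suc l. (cmod (v i))\<^sup>2))"
proof -
  have main: "(\<Sum>q<R. w q ^ e * ((\<Sum>i<Suc l. w q ^ i * v i) * cnj (\<Sum>j<Suc l. w q ^ j * v j))) =
      of_nat R * (\<Sum>i<Suc l. \<Sum>j<Suc l. if e + i = j then v i * cnj (v j) else 0)" if "e \<le> 1" for e
  proof -
    have "w q ^ e * ((\<Sum>i<Suc l. w q ^ i * v i) * cnj (\<Sum>j<Suc l. w q ^ j * v j)) =
        (\<Sum>i<Suc l. \<Sum>j<Suc l. v i * cnj (v j) * (w q ^ (e + i) * cnj (w q ^ j)))" for q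
    proof -
      have "w q ^ e * ((\<Sum>i<Suc l. w q ^ i * v i) * cnj (\<Sum>j<Suc l. w q ^ j * v j)) =
          w q ^ e * (\<Sum>i<Suc l. \<Sum>j<Suc l. (w q ^ i * v i) * cnj (w q ^ j * v j))"
        by (simp only: cnj_sum sum_product)
      also have "\<dots> = (\<Sum>i<Suc l. \<Sum>j<Suc l. w q ^ e * ((w q ^ i * v i) * cnj (w q ^ j * v j)))"
        by (simp only: sum_distrib_left)
      also have "\<dots> = (\<Sum>i<Suc l. \<Sum>j<Suc l. v i * cnj (v j) * (w q ^ (e + i) * cnj (w q ^ j)))"
        by (intro sum.cong refl) (simp add: power_add mult_ac)
      finally show ?thesis .
    qed
    then have "(\<Sum>q<R. w q ^ e * ((\<Sum>i<Suc l. w q ^ i * v i) * cnj (\<Sum>j<Suc l. w q ^ j * v j))) =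
        (\<Sum>q<R. \<Sum>i<Suc l. \<Sum>j<Suc l. v i * cnj (v j) * (w q ^ (e + i) * cnj (w q ^ j)))"
      by simp
    also have "\<dots> = (\<Sum>i<Suc l. \<Sum>q<R. \<Sum>j<Suc l. v i * cnj (v j) * (w q ^ (e + i) * cnj (w q ^ j)))"
      by (rule sum.swap)
    also have "\<dots> = (\<Sum>i<Suc l. \<Sum>j<Suc l. \<Sum>q<R. v i * cnj (v j) * (w q ^ (e + i) * cnj (w q ^ j)))"
      by (intro sum.cong refl sum.swap)
    also have "\<dots> = (\<Sum>i<Suc l. \<Sum>j<Suc l. of_nat R * (if e + i = j then v i * cnj (v j) else 0))"
    proof (intro sum.cong refl)
      fix i j assume "i \<in> {..<Suc l}" "j \<in> {..<Suc l}"
      then have "e + i < R" "j < R" using that by (auto simp: R_def)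
      then show "(\<Sum>q<R. v i * cnj (v j) * (w q ^ (e + i) * cnj (w q ^ j))) =
          of_nat R * (if e + i = j then v i * cnj (v j) else 0)"
        unfolding sum_distrib_left[symmetric] w_def by (subst roots_of_unity_orthogonal) auto
    qed
    finally show ?thesis by (simp only: sum_distrib_left)
  qed
  have sq: "(cmod z)\<^sup>2 = Re (z * cnj z)" "of_real ((cmod z)\<^sup>2) = z * cnj z" for z
    by (simp_all add: complex_norm_square[symmetric] del: of_real_power)
  have e0: "(\<Sum>q<R. (cmod (\<Sum>j<Suc l. w q ^ j * v j))\<^sup>2) = real R * (\<Sum>i<Suc l. (cmod (v i))\<^sup>2)"
  proof -
    have "(\<Sum>i<Suc l. \<Sum>j<Suc l. if 0 + i = j then v i * cnj (v j) else 0) = (\<Sum>i<Suc l. v i * cnj (v i))"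
      by (intro sum.cong refl) simp
    then have "Re (\<Sum>q<R. w q ^ 0 * ((\<Sum>i<Suc l. w q ^ i * v i) * cnj (\<Sum>j<Suc l. w q ^ j * v j))) =
        Re (of_nat R * (\<Sum>i<Suc l. v i * cnj (v i)))"
      using main[of 0] by (simp only:)
    then show ?thesis by (simp add: sq(1) del: sum.lessThan_Suc)
  qed
  have e1: "(\<Sum>q<R. Re (w q) * (cmod (\<Sum>j<Suc l. w q ^ j * v j))\<^sup>2) =
      real R * Re (\<Sum>i<l. v i * cnj (v (Suc i)))"
  proof -
    have "(\<Sum>j<Suc l. if 1 + i = j then v i * cnj (v j) else 0) = (if i < l then v i * cnj (v (Suc i)) else 0)" for i
      by (simp add: sum.delta' del: sum.lessThan_Suc)
    then have "(\<Sum>i<Suc l. \<Sum>j<Suc l. if 1 + i = j then v i * cnj (v j) else 0) =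
        (\<Sum>i<l. v i * cnj (v (Suc i)))"
      by (simp only:) simp
    then have "Re (\<Sum>q<R. w q ^ 1 * ((\<Sum>i<Suc l. w q ^ i * v i) * cnj (\<Sum>j<Suc l. w q ^ j * v j))) =
        Re (of_nat R * (\<Sum>i<l. v i * cnj (v (Suc i))))"
      using main[of 1] by (simp only:)
    moreover have "Re (w q ^ 1 * (z * cnj z)) = Re (w q) * (cmod z)\<^sup>2" for q z
      by (simp add: sq(2)[symmetric] del: of_real_power)
    moreover have "Re (of_nat R * z) = real R * Re z" for z by simp
    ultimately show ?thesis by (simp only: Re_sum)
  qed
  show ?thesis using e0 e1 by (simp add: left_diff_distrib sum_subtractf sum_distrib_left[symmetric] right_diff_distrib mult.left_commute del: sum.lessThan_Suc)
qed

context transfer_space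
begin

section \<open>The injective case\<close>

text \<open>Under injectivity the fibre over \<open>T x\<close> is the single point
  \<open>x\<close>, and \<open>transfer_one\<close> then forces
  \<open>\<bar>deriv T x\<bar> = 1\<close> for almost every \<open>x\<close>.\<close>

lemma L_inverse:
  assumes "inj_on T X"
  shows "AE x in mI. \<forall>h. L h (T x) = h x"
  using AE_pullback[OF transfer_one]
proof eventually_elim
  case (elim x)
  then have set: "{y. y \<in> X \<and> T y = T x} = {x}" using assms by (auto dest: inj_onD)
  have "1 / \<bar>deriv T x\<bar> = 1" using elim unfolding set by simp
  then have "\<bar>deriv T x\<bar> = 1" by (simp add: divide_eq_1_iff)
  then show ?case unfolding transfer_op_def set by simp
qed

text \<open>\<open>transfer_op\<close> acts on representatives by point values, so compatibility
  with equality almost everywhere is not built in; on \<open>B\<close> it follows from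
  boundedness.\<close>

lemma L_null: "f \<in> B \<Longrightarrow> eq_ae f (\<lambda>x. 0) \<Longrightarrow> eq_ae (L f) (\<lambda>x. 0)"
proof -
  assume f: "f \<in> B" "eq_ae f (\<lambda>x. 0)"
  obtain K where K: "0 \<le> K" "\<forall>f\<in>B. N (L f) \<le> K * N f" using L_bound by blast
  have "N f = 0" using N_eq_0[OF f(1)] f(2) by simp
  then have "N (L f) \<le> 0" using K f(1) by force
  then have "N (L f) = 0" using N_nonneg[OF L_memI[OF f(1)]] by simp
  then show ?thesis using N_eq_0[OF L_memI[OF f(1)]] by simp
qed

lemma eigenvalue_1: "is_eigenvalue B L 1"
proof -
  have "(indicator {0..1} :: real \<Rightarrow> complex) \<in> B" by (intro indicator_mem) (auto simp: is_interval_cc)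
  moreover have "eq_ae (indicator {0..1}) (\<lambda>x. 1)"
    unfolding eq_ae_def by (rule AE_mI_finite[of "{}"]) auto
  ultimately have mem: "(\<lambda>x. 1) \<in> B" by (rule mem_ae)
  have "eq_ae (L (\<lambda>x. 1)) (\<lambda>x. 1 * 1)"
    unfolding eq_ae_def using L_comp by eventually_elim (drule spec[of _ "\<lambda>_. 1"], simp)
  then have "(\<lambda>x. 1) \<in> eigenspace B L 1" using mem by (simp add: eigenspace_def)
  moreover have "\<not> eq_ae (\<lambda>x. 1) (\<lambda>x. 0)"
  proof
    assume "eq_ae (\<lambda>x. 1) (\<lambda>x. 0)"
    then have "AE x in mI. x \<notin> {0<..<1}" unfolding eq_ae_def by eventually_elim simp
    moreover have "\<not> (AE x in mI. x \<notin> {0<..<1})" by (rule positive_length_open) auto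
    ultimately show False by blast
  qed
  ultimately show ?thesis unfolding is_eigenvalue_def by blast
qed

lemma integral_indicator_comp:
  assumes "is_interval J" "J \<subseteq> {0..1}"
  shows "integrable mI (\<lambda>x. indicator J ((T ^^ k) x) :: real)"
    "(\<integral>x. indicator J ((T ^^ k) x) \<partial>mI) = length_of J"
proof -
  have J: "J \<in> sets mI" "J \<in> lmeasurable" using interval_lmeasurable[OF assms] assms(2) by (auto simp: sets_restrict_space_iff)
  have int: "integrable mI (indicator J :: real \<Rightarrow> real)"
    using J by (intro integrable_mI_bounded[of _ 1]) auto
  have "(\<integral>x. indicator J x \<partial>mI) = measure mI J" using J(1) assms(2) by (simp add: Int_absorb1 inf_absorb1 inf_commute)
  also have "\<dots> = length_of J" using assms(2) J(2) by (intro measure_restrict_space) auto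
  finally have val: "(\<integral>x. indicator J x \<partial>mI) = length_of J" .
  show "integrable mI (\<lambda>x. indicator J ((T ^^ k) x) :: real)"
    "(\<integral>x. indicator J ((T ^^ k) x) \<partial>mI) = length_of J"
    using integral_comp_power[OF int, of k] val by auto
qed

text \<open>Orbit sums of the nested intervals \<open>{0..w ^ i}\<close> are invariant. They are independent because the
  supports of all later ones together are smaller than the \<open>i\<close>-th interval.\<close>

lemma infinite_eigenspace_periodic:
  assumes "0 < K" and per: "AE x in mI. (T ^^ K) x = x"
  shows "\<not> fin_dim_ae (gen_eigenspace B L 1)"
proof -
  \<comment> \<open>Then \<open>w / (1 - w) = 1 / (K + 1)\<close>, so the lengths of all later
    intervals, each counted \<open>K\<close> times along the orbit, sum to less than
    \<open>w ^ i\<close>.\<close>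
  define w where "w = 1 / (real K + 2)"
  have w: "0 < w" "w \<le> 1" by (auto simp: w_def)
  define J where "J = (\<lambda>i::nat. {0..w ^ i})"
  have J: "is_interval (J i)" "J i \<subseteq> {0..1}" "length_of (J i) = w ^ i" for i
    using w by (auto simp: J_def is_interval_cc intro: order_trans[OF _ power_le_one])
  define e where "e = (\<lambda>i x. \<Sum>k<K. indicator (J i) ((T ^^ k) x) :: complex)"
  have eB: "e i \<in> B" for i unfolding e_def by (intro sum_mem indicator_comp J)
  have eTB: "(\<lambda>x. e i (T x)) \<in> B" for i
  proof -
    have "(\<lambda>x. e i (T x)) = (\<lambda>x. \<Sum>k<K. indicator (J i) ((T ^^ Suc k) x))"
      by (simp add: e_def funpow_swap1)
    then show ?thesis by (simp only:) (intro sum_mem indicator_comp J)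
  qed
  have inv: "eq_ae (\<lambda>x. e i x - e i (T x)) (\<lambda>x. 0)" for i
    unfolding eq_ae_def using per
  proof eventually_elim
    case (elim x)
    have "e i (T x) = (\<Sum>k<K. indicator (J i) ((T ^^ Suc k) x))"
      by (simp add: e_def funpow_swap1)
    then have "e i (T x) - e i x = (\<Sum>k<K. indicator (J i) ((T ^^ Suc k) x) - indicator (J i) ((T ^^ k) x))"
      by (simp add: e_def sum_subtractf)
    also have "\<dots> = indicator (J i) ((T ^^ K) x) - indicator (J i) ((T ^^ 0) x)"
      by (rule sum_lessThan_telescope)
    finally show ?case by (simp add: elim)
  qed
  have "e i \<in> eigenspace B L 1" for i
  proof -
    have "eq_ae (L (\<lambda>x. e i x - e i (T x))) (\<lambda>x. 0)" by (intro L_null diff_mem eB eTB inv)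
    then have "AE x in mI. L (e i) x - L (\<lambda>x. e i (T x)) x = 0" by (simp add: eq_ae_def L_diff)
    then have "eq_ae (L (e i)) (\<lambda>x. 1 * e i x)"
      unfolding eq_ae_def using L_comp by eventually_elim simp
    then show ?thesis using eB by (simp add: eigenspace_def)
  qed
  then have "e i \<in> gen_eigenspace B L 1" for i using eigenspace_subset by blast
  then show ?thesis
  proof (rule not_fin_dim_ae)
    fix n and a :: "nat \<Rightarrow> complex" assume ae: "eq_ae (\<lambda>x. \<Sum>i<n. a i * e i x) (\<lambda>x. 0)"
    show "\<forall>i<n. a i = 0"
    proof (rule ccontr)
      assume "\<not> (\<forall>i<n. a i = 0)"
      then have ex: "\<exists>i. i < n \<and> a i \<noteq> 0" by blast
      \<comment> \<open>On \<open>J i\<close> the function \<open>e i\<close> is a positive integer,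
        so the relation needs some later \<open>e j\<close> to be nonzero there. Hence the orbit
        preimages of the later intervals cover almost all of \<open>J i\<close>, which their total
        length forbids.\<close>
      define i where "i = (LEAST i. i < n \<and> a i \<noteq> 0)"
      have i: "i < n" "a i \<noteq> 0" using LeastI_ex[OF ex] by (auto simp: i_def)
      have below: "a j = 0" if "j < i" for j
        using not_less_Least[of j "\<lambda>i. i < n \<and> a i \<noteq> 0"] that i(1) by (auto simp: i_def)
      define g where "g = (\<lambda>x. \<Sum>j\<in>{Suc i..<n}. \<Sum>k<K. indicator (J j) ((T ^^ k) x) :: real)"
      have "AE x in mI. indicator (J i) ((T ^^ 0) x) \<le> g x"
        using ae unfolding eq_ae_def
      proof eventually_elim
        case (elim x)
        show ?case
        proof (cases "x \<in> J i")
          case True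
          have e_nat: "e j x = of_nat (card {k\<in>{..<K}. (T ^^ k) x \<in> J j})" for j
            by (simp add: e_def indicator_def sum.If_cases Int_def)
          have "e i x \<noteq> 0"
          proof -
            have "0 \<in> {k\<in>{..<K}. (T ^^ k) x \<in> J i}" using True \<open>0 < K\<close> by simp
            then have "card {k\<in>{..<K}. (T ^^ k) x \<in> J i} \<noteq> 0" by (auto simp: card_eq_0_iff)
            then show ?thesis by (simp only: e_nat of_nat_eq_0_iff) simp
          qed
          moreover have "(\<Sum>j<n. a j * e j x) = a i * e i x + (\<Sum>j\<in>{Suc i..<n}. a j * e j x)"
          proof -
            have "(\<Sum>j<n. a j * e j x) = (\<Sum>j\<in>{i..<n}. a j * e j x)"
              using below by (intro sum.mono_neutral_right) auto
            then show ?thesis using i(1) by (simp add: sum.atLeast_Suc_lessThan)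
          qed
          ultimately have "(\<Sum>j\<in>{Suc i..<n}. a j * e j x) \<noteq> 0" using elim i(2) by auto
          then obtain j where j: "j \<in> {Suc i..<n}" "e j x \<noteq> 0" by (metis (no_types, lifting) mult_zero_right sum.neutral)
          then obtain k where k: "k < K" "(T ^^ k) x \<in> J j"
            unfolding e_def by (metis (no_types, lifting) indicator_simps(2) lessThan_iff sum.neutral)
          have "1 = (indicator (J j) ((T ^^ k) x) :: real)" using k by simp
          also have "\<dots> \<le> (\<Sum>k<K. indicator (J j) ((T ^^ k) x))"
            using k by (intro member_le_sum) auto
          also have "\<dots> \<le> g x"
            unfolding g_def using j by (intro member_le_sum) (auto intro: sum_nonneg)
          finally show ?thesis using True by simp
        next
          case False
          then show ?thesis by (simp add: g_def sum_nonneg)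
        qed
      qed
      then have "(\<integral>x. indicator (J i) ((T ^^ 0) x) \<partial>mI) \<le> (\<integral>x. g x \<partial>mI)"
        unfolding g_def by (intro integral_mono_AE integral_indicator_comp J Bochner_Integration.integrable_sum)
      also have "(\<integral>x. indicator (J i) ((T ^^ 0) x) \<partial>mI) = w ^ i"
        by (simp only: integral_indicator_comp(2)[OF J(1,2)] J(3))
      also have "(\<integral>x. g x \<partial>mI) = (\<Sum>j\<in>{Suc i..<n}. real K * w ^ j)"
        unfolding g_def using integral_indicator_comp[OF J(1,2)] J(3)
        by (subst Bochner_Integration.integral_sum, simp)+ simp
      finally have le: "w ^ i \<le> real K * (\<Sum>j\<in>{Suc i..<n}. w ^ j)" by (simp add: sum_distrib_left)
      have "(1 - w) * (\<Sum>j\<in>{Suc i..<m}. w ^ j) = w ^ Suc i - w ^ m" if "Suc i \<le> m" for m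
        using that
      proof (induction m rule: dec_induct)
        case (step m)
        have "(1 - w) * (\<Sum>j\<in>{Suc i..<Suc m}. w ^ j) = (1 - w) * (\<Sum>j\<in>{Suc i..<m}. w ^ j) + (1 - w) * w ^ m"
          using step.hyps by (simp add: distrib_left)
        then show ?case unfolding step.IH by (simp add: left_diff_distrib)
      qed simp
      then have "(1 - w) * (\<Sum>j\<in>{Suc i..<n}. w ^ j) \<le> w ^ Suc i" using i(1) w by simp
      moreover have "1 - w = (real K + 1) * w" by (simp add: w_def field_simps)
      ultimately have "(real K + 1) * (\<Sum>j\<in>{Suc i..<n}. w ^ j) * w \<le> w ^ i * w" by (simp add: mult_ac)
      then have "(real K + 1) * (\<Sum>j\<in>{Suc i..<n}. w ^ j) \<le> w ^ i" using w(1) by simp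
      moreover have "(\<Sum>j\<in>{Suc i..<n}. w ^ j) > 0"
      proof -
        have "0 < w ^ i" using w by simp
        then have "0 < real K * (\<Sum>j\<in>{Suc i..<n}. w ^ j)" using le by linarith
        then show ?thesis by (simp add: zero_less_mult_iff)
      qed
      ultimately show False using le by (simp add: algebra_simps)
    qed
  qed
qed

text \<open>Writing \<open>f = (\<mu> - L) (\<mu> - L) h'\<close> makes the sum telescope twice: once in each factor of the
  square. Since \<open>L\<close> is inverse to composition with \<open>T\<close>, the bound does not depend on \<open>n\<close>.\<close>

lemma resolvent_correlation_bound:
  fixes n :: nat
  assumes inj: "inj_on T X" and lam: "cmod \<mu> = 1" and K: "0 \<le> K"
    and bnd: "\<And>f. f \<in> B \<Longrightarrow> N f \<le> K * N (\<lambda>x. \<mu> * f x - L f x)"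
    and surj: "\<And>g. g \<in> B \<Longrightarrow> \<exists>f\<in>B. eq_ae (\<lambda>x. \<mu> * f x - L f x) g"
    and K1: "0 \<le> K1" "\<And>f. f \<in> B \<Longrightarrow> L1_norm f \<le> K1 * N f"
    and f: "f \<in> B" "\<And>x. cmod (f x) \<le> M"
  shows "(\<integral>x. (cmod (\<Sum>j<n. \<mu> ^ j * f ((T ^^ Suc j) x)))\<^sup>2 \<partial>mI) \<le> 4 * M * (K1 * (K * (K * N f)))"
proof -
  have M: "0 \<le> M" using f(2)[of 0] norm_ge_zero order_trans by blast
  \<comment> \<open>The resolvent equation evaluated at \<open>T x\<close>: \<open>L_inverse\<close>
    replaces \<open>L h (T x)\<close> by \<open>h x\<close>, leaving a twisted coboundary equation
    that telescopes along orbits.\<close>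
  have sol: "\<exists>h\<in>B. N h \<le> K * N g \<and> (AE x in mI. g (T x) = \<mu> * h (T x) - h x)" if g: "g \<in> B" for g
  proof -
    obtain h where h: "h \<in> B" "eq_ae (\<lambda>x. \<mu> * h x - L h x) g" using surj[OF g] by blast
    have "(\<lambda>x. \<mu> * h x - L h x) \<in> B" using h(1) by (intro diff_mem scale_mem L_memI)
    then have "N g = N (\<lambda>x. \<mu> * h x - L h x)" using N_ae h(2) by blast
    then have "N h \<le> K * N g" using bnd[OF h(1)] by simp
    moreover have "AE x in mI. g (T x) = \<mu> * h (T x) - h x"
      using AE_pullback[OF h(2)[unfolded eq_ae_def]] L_inverse[OF inj] by eventually_elim simp
    ultimately show ?thesis using h(1) by blast
  qed
  obtain h where h: "h \<in> B" "N h \<le> K * N f" "AE x in mI. f (T x) = \<mu> * h (T x) - h x" using sol[OF f(1)] by blast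
  obtain h' where h': "h' \<in> B" "N h' \<le> K * N h" "AE x in mI. h (T x) = \<mu> * h' (T x) - h' x" using sol[OF h(1)] by blast
  define V where "V = (\<lambda>x. \<Sum>j<n. \<mu> ^ j * f ((T ^^ Suc j) x))"
  \<comment> \<open>\<open>V\<close> telescopes to the same expression in \<open>h\<close>, and the
    second solution \<open>h'\<close> makes \<open>V\<close> composed with \<open>T\<close> a
    twisted coboundary of \<open>G\<close>. The \<open>L1_norm\<close> of \<open>G\<close> is at
    most twice that of \<open>h'\<close>, for every \<open>n\<close>.\<close>
  define G where "G = (\<lambda>x. \<mu> ^ n * h' ((T ^^ n) x) - h' x)"
  have V_ae: "AE x in mI. V x = \<mu> ^ n * h ((T ^^ n) x) - h x"
  proof -
    have "AE x in mI. \<forall>j. f ((T ^^ Suc j) x) = \<mu> * h ((T ^^ Suc j) x) - h ((T ^^ j) x)"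
      unfolding AE_all_countable
    proof
      fix j
      show "AE x in mI. f ((T ^^ Suc j) x) = \<mu> * h ((T ^^ Suc j) x) - h ((T ^^ j) x)"
        using AE_pullback_power[OF h(3), of j] by simp
    qed
    then show ?thesis
    proof eventually_elim
      case (elim x)
      have "V x = (\<Sum>j<n. \<mu> ^ Suc j * h ((T ^^ Suc j) x) - \<mu> ^ j * h ((T ^^ j) x))"
        unfolding V_def by (intro sum.cong refl) (simp only: elim, simp add: algebra_simps)
      also have "\<dots> = \<mu> ^ n * h ((T ^^ n) x) - \<mu> ^ 0 * h ((T ^^ 0) x)" by (rule sum_lessThan_telescope)
      finally show ?case by simp
    qed
  qed
  have VT: "AE x in mI. V (T x) = \<mu> * G (T x) - G x"
    using AE_pullback[OF V_ae] h'(3) AE_pullback_power[OF h'(3), of n]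
  proof eventually_elim
    case (elim x)
    have "V (T x) = \<mu> ^ n * h ((T ^^ n) (T x)) - h (T x)" using elim by blast
    also have "h ((T ^^ n) (T x)) = h (T ((T ^^ n) x))" by (simp add: funpow_swap1)
    also have "\<mu> ^ n * h (T ((T ^^ n) x)) - h (T x) = \<mu> * G (T x) - G x"
      unfolding elim(2,3) G_def by (simp add: algebra_simps funpow_swap1)
    finally show ?case .
  qed
  have fint: "integrable mI (\<lambda>x. f ((T ^^ k) x))" for k
    using integral_comp_power[OF integrable_mem[OF f(1)]] by blast
  have Gint: "integrable mI G"
    unfolding G_def using integral_comp_power[OF integrable_mem[OF h'(1)], of n] integrable_mem[OF h'(1)] by auto
  have Vint: "integrable mI V"
    unfolding V_def by (intro Bochner_Integration.integrable_sum integrable_mult_right fint)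
  have prod_le: "cmod (c * cnj (f y)) \<le> M * cmod c" for c y
    \<comment> \<open>Square integrability of \<open>h\<close> and \<open>h'\<close> is not known;
      all pairings below are of an integrable function with the bounded \<open>f\<close>.\<close>
    using mult_right_mono[OF f(2)[of y], of "cmod c"] by (simp add: norm_mult mult.commute)
  have prod_int: "integrable mI (\<lambda>x. u x * cnj (f ((T ^^ k) x)))" if u: "integrable mI u" for u k
  proof (rule Bochner_Integration.integrable_bound[of _ "\<lambda>x. M * cmod (u x)"])
    have "(\<lambda>x. f ((T ^^ k) x)) \<in> borel_measurable mI" by (rule borel_measurable_integrable[OF fint])
    then show "(\<lambda>x. u x * cnj (f ((T ^^ k) x))) \<in> borel_measurable mI"
      using u by (intro borel_measurable_times borel_measurable_continuous_on[of cnj]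
          continuous_on_cnj continuous_on_id) auto
    show "AE x in mI. norm (u x * cnj (f ((T ^^ k) x))) \<le> norm (M * cmod (u x))"
    proof (rule AE_I2)
      fix x
      have "norm (M * cmod (u x)) = M * cmod (u x)" using M by simp
      then show "norm (u x * cnj (f ((T ^^ k) x))) \<le> norm (M * cmod (u x))"
        by (simp only: prod_le)
    qed
  qed (use u in auto)
  define g where "g = (\<lambda>i. \<integral>x. G x * cnj (f ((T ^^ i) x)) \<partial>mI)"
  have g_le: "cmod (g i) \<le> M * (2 * L1_norm h')" for i
  proof -
    have "cmod (g i) \<le> (\<integral>x. cmod (G x * cnj (f ((T ^^ i) x))) \<partial>mI)"
      unfolding g_def by (rule integral_norm_bound)
    also have "\<dots> \<le> (\<integral>x. M * cmod (G x) \<partial>mI)"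
      using Gint by (intro integral_mono integrable_norm prod_int prod_le) auto
    also have "\<dots> = M * L1_norm G" by (simp add: L1_norm_def)
    also have "L1_norm G \<le> 2 * L1_norm h'"
    proof -
      have i: "integrable mI (\<lambda>x. h' ((T ^^ n) x))" "integrable mI h'"
        using integral_comp_power[OF integrable_mem[OF h'(1)], of n] integrable_mem[OF h'(1)] by auto
      have "L1_norm G \<le> L1_norm (\<lambda>x. \<mu> ^ n * h' ((T ^^ n) x)) + L1_norm (\<lambda>x. - h' x)"
        using L1_norm_triangle[of "\<lambda>x. \<mu> ^ n * h' ((T ^^ n) x)" "\<lambda>x. - h' x"] i by (simp add: G_def)
      also have "L1_norm (\<lambda>x. \<mu> ^ n * h' ((T ^^ n) x)) = (\<integral>x. cmod (h' ((T ^^ n) x)) \<partial>mI)"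
        by (simp add: L1_norm_def norm_mult norm_power lam)
      also have "\<dots> = L1_norm h'"
        using integral_comp_power[of "\<lambda>x. cmod (h' x)" n] i(2) by (simp add: L1_norm_def)
      also have "L1_norm (\<lambda>x. - h' x) = L1_norm h'" by (simp add: L1_norm_def)
      finally show ?thesis by simp
    qed
    finally show ?thesis using M by (simp add: mult_left_mono)
  qed
  have lamc: "cnj \<mu> * \<mu> = 1" using lam complex_norm_square[of \<mu>] by (simp add: mult.commute)
  \<comment> \<open>Invariance shifts the integrand by one step, after which \<open>VT\<close>
    applies. Expanding only one factor of the square of \<open>V\<close> then yields a sum of such
    differences, which telescopes and leaves the boundary terms \<open>g (Suc n)\<close> and
    \<open>g (Suc 0)\<close>.\<close>
  have Vf: "(\<integral>x. V x * cnj (f ((T ^^ Suc j) x)) \<partial>mI) = \<mu> * g (Suc j) - g (Suc (Suc j))" for j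
  proof -
    have int: "integrable mI (\<lambda>x. V x * cnj (f ((T ^^ Suc j) x)))" by (rule prod_int[OF Vint])
    have "(\<integral>x. V x * cnj (f ((T ^^ Suc j) x)) \<partial>mI) = (\<integral>x. V (T x) * cnj (f ((T ^^ Suc j) (T x))) \<partial>mI)"
      by (rule integral_comp(2)[OF int, symmetric])
    also have "\<dots> = (\<integral>x. \<mu> * (G (T x) * cnj (f ((T ^^ Suc j) (T x)))) - G x * cnj (f ((T ^^ Suc (Suc j)) x)) \<partial>mI)"
    proof (rule integral_cong_AE)
      show "(\<lambda>x. V (T x) * cnj (f ((T ^^ Suc j) (T x)))) \<in> borel_measurable mI"
        using integral_comp(1)[OF int] by (rule borel_measurable_integrable)
      show "(\<lambda>x. \<mu> * (G (T x) * cnj (f ((T ^^ Suc j) (T x)))) - G x * cnj (f ((T ^^ Suc (Suc j)) x))) \<in> borel_measurable mI"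
        by (intro borel_measurable_integrable Bochner_Integration.integrable_diff integrable_mult_right
            prod_int Gint integral_comp(1)[OF prod_int[OF Gint, of "Suc j"]])
      show "AE x in mI. V (T x) * cnj (f ((T ^^ Suc j) (T x))) =
          \<mu> * (G (T x) * cnj (f ((T ^^ Suc j) (T x)))) - G x * cnj (f ((T ^^ Suc (Suc j)) x))"
        using VT
      proof eventually_elim
        case (elim x)
        have "(T ^^ Suc j) (T x) = (T ^^ Suc (Suc j)) x" by (simp add: funpow_swap1)
        then show ?case by (simp only: elim left_diff_distrib mult.assoc)
      qed
    qed
    also have "\<dots> = \<mu> * (\<integral>x. G (T x) * cnj (f ((T ^^ Suc j) (T x))) \<partial>mI) - g (Suc (Suc j))"
      unfolding g_def
      by (subst Bochner_Integration.integral_diff)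
        (auto intro!: integrable_mult_right prod_int Gint integral_comp(1)[OF prod_int[OF Gint, of "Suc j"]] simp del: funpow.simps)
    also have "(\<integral>x. G (T x) * cnj (f ((T ^^ Suc j) (T x))) \<partial>mI) = g (Suc j)"
      unfolding g_def by (rule integral_comp(2)[OF prod_int[OF Gint]])
    finally show ?thesis .
  qed
  have "complex_of_real (\<integral>x. (cmod (V x))\<^sup>2 \<partial>mI) = (\<integral>x. V x * cnj (V x) \<partial>mI)"
    by (subst integral_complex_of_real[symmetric]) (simp only: complex_norm_square)
  also have "\<dots> = (\<integral>x. (\<Sum>j<n. cnj \<mu> ^ j * (V x * cnj (f ((T ^^ Suc j) x)))) \<partial>mI)"
  proof (intro Bochner_Integration.integral_cong refl)
    fix x
    have "cnj (V x) = (\<Sum>j<n. cnj \<mu> ^ j * cnj (f ((T ^^ Suc j) x)))"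
      by (simp only: V_def cnj_sum complex_cnj_mult complex_cnj_power)
    then show "V x * cnj (V x) = (\<Sum>j<n. cnj \<mu> ^ j * (V x * cnj (f ((T ^^ Suc j) x))))"
      by (simp only: sum_distrib_left mult.left_commute)
  qed
  also have "\<dots> = (\<Sum>j<n. cnj \<mu> ^ j * (\<mu> * g (Suc j) - g (Suc (Suc j))))"
    using prod_int[OF Vint] by (subst Bochner_Integration.integral_sum) (auto simp del: funpow.simps simp: Vf)
  also have "\<dots> = (\<Sum>j<n. (- \<mu>) * (cnj \<mu> ^ Suc j * g (Suc (Suc j)) - cnj \<mu> ^ j * g (Suc j)))"
  proof (intro sum.cong refl)
    fix j
    have "(- \<mu>) * (cnj \<mu> ^ Suc j * g (Suc (Suc j)) - cnj \<mu> ^ j * g (Suc j)) =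
        cnj \<mu> ^ j * (\<mu> * g (Suc j)) - (cnj \<mu> * \<mu>) * (cnj \<mu> ^ j * g (Suc (Suc j)))"
      by (simp add: algebra_simps)
    then show "cnj \<mu> ^ j * (\<mu> * g (Suc j) - g (Suc (Suc j))) =
        (- \<mu>) * (cnj \<mu> ^ Suc j * g (Suc (Suc j)) - cnj \<mu> ^ j * g (Suc j))"
      unfolding lamc by (simp add: right_diff_distrib)
  qed
  also have "\<dots> = (- \<mu>) * (cnj \<mu> ^ n * g (Suc n) - cnj \<mu> ^ 0 * g (Suc 0))"
    unfolding sum_distrib_left[symmetric] by (subst sum_lessThan_telescope) simp
  finally have eq: "complex_of_real (\<integral>x. (cmod (V x))\<^sup>2 \<partial>mI) = (- \<mu>) * (cnj \<mu> ^ n * g (Suc n) - cnj \<mu> ^ 0 * g (Suc 0))" .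
  have "(\<integral>x. (cmod (V x))\<^sup>2 \<partial>mI) \<le> cmod (complex_of_real (\<integral>x. (cmod (V x))\<^sup>2 \<partial>mI))" by simp
  also have "\<dots> = cmod (cnj \<mu> ^ n * g (Suc n) - g (Suc 0))" unfolding eq by (simp add: norm_mult lam)
  also have "\<dots> \<le> cmod (cnj \<mu> ^ n * g (Suc n)) + cmod (g (Suc 0))" by (rule norm_triangle_ineq4)
  also have "\<dots> \<le> 4 * M * L1_norm h'"
    using g_le[of "Suc n"] g_le[of "Suc 0"] by (simp add: norm_mult norm_power lam)
  also have "\<dots> \<le> 4 * M * (K1 * (K * (K * N f)))"
  proof -
    have "L1_norm h' \<le> K1 * N h'" by (rule K1(2)[OF h'(1)])
    also have "\<dots> \<le> K1 * (K * N h)" using K1(1) h'(2) by (rule mult_left_mono[rotated])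
    also have "\<dots> \<le> K1 * (K * (K * N f))" using K1(1) K h(2) by (intro mult_left_mono) auto
    finally show ?thesis using M by (intro mult_left_mono) auto
  qed
  finally show ?thesis by (simp add: V_def)
qed


text \<open>Every \<open>k\<close> with \<open>1 \<le> k \<le> m\<close> divides
  \<open>fact m\<close>, so a point moved by \<open>T ^^ fact m\<close> is moved by each of these
  \<open>T ^^ k\<close>. Continuity at a nonexceptional such point keeps a whole small ball from
  returning.\<close>

lemma small_nonreturning_interval:
  assumes "\<not> (AE x in mI. (T ^^ fact m) x = x)"
  obtains J where "is_interval J" "J \<subseteq> {0..1}" "0 < length_of J"
    "\<And>k y. 1 \<le> k \<Longrightarrow> k \<le> m \<Longrightarrow> y \<in> J \<Longrightarrow> (T ^^ k) y \<notin> J"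
proof -
  have "\<exists>x\<in>{0..1}. x \<notin> exceptional (Suc m) \<and> (T ^^ fact m) x \<noteq> x"
  proof (rule ccontr)
    assume "\<not> ?thesis"
    then have "AE x in mI. (T ^^ fact m) x = x"
      by (intro AE_mI_finite[OF finite_exceptional[of "Suc m"]]) blast
    then show False using assms by blast
  qed
  then obtain x where x: "x \<in> {0..1}" "x \<notin> exceptional (Suc m)" "(T ^^ fact m) x \<noteq> x" by blast
  have orbit: "(T ^^ j) x \<in> X" if "j \<le> m" for j using x that by (auto simp: exceptional_def)
  have "\<exists>e>0. \<forall>e'\<le>e. \<forall>y\<in>ball x e'. (T ^^ k) y \<notin> ball x e'" if k: "1 \<le> k" "k \<le> m" for k
  proof -
    have "(T ^^ k) x \<noteq> x"
    proof
      assume fixed: "(T ^^ k) x = x"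
      have "((T ^^ k) ^^ n) x = x" for n by (induction n) (auto simp: fixed)
      then have "(T ^^ (k * n)) x = x" for n by (simp add: funpow_mult)
      moreover have "k dvd fact m" using k by (intro dvd_fact) auto
      ultimately show False using x(3) by (auto simp: dvd_def)
    qed
    then have d: "0 < dist ((T ^^ k) x) x" by simp
    have "isCont (T ^^ k) x"
      using DERIV_T_power[of k x] orbit k by (meson DERIV_isCont less_le_trans nat_less_le order.strict_implies_order)
    then obtain e where e: "0 < e" "\<And>y. dist y x < e \<Longrightarrow> dist ((T ^^ k) y) ((T ^^ k) x) < dist ((T ^^ k) x) x / 2"
      using d unfolding continuous_at_eps_delta by (metis half_gt_zero)
    show ?thesis
    proof (intro exI[of _ "min e (dist ((T ^^ k) x) x / 2)"] conjI allI impI ballI)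
      show "0 < min e (dist ((T ^^ k) x) x / 2)" using e d by simp
      fix e' y assume e': "e' \<le> min e (dist ((T ^^ k) x) x / 2)" and y: "y \<in> ball x e'"
      then have "dist ((T ^^ k) y) ((T ^^ k) x) < dist ((T ^^ k) x) x / 2"
        by (intro e) (simp add: dist_commute)
      moreover have "dist ((T ^^ k) x) x \<le> dist ((T ^^ k) y) ((T ^^ k) x) + dist ((T ^^ k) y) x"
        by (rule dist_triangle3)
      ultimately show "(T ^^ k) y \<notin> ball x e'" using e' by (auto simp: dist_commute)
    qed
  qed
  then have "\<forall>k\<in>{1..m}. \<exists>e>0. \<forall>e'\<le>e. \<forall>y\<in>ball x e'. (T ^^ k) y \<notin> ball x e'" by auto
  from bchoice[OF this] obtain E where
    E: "\<And>k. k \<in> {1..m} \<Longrightarrow> 0 < E k \<and> (\<forall>e'\<le>E k. \<forall>y\<in>ball x e'. (T ^^ k) y \<notin> ball x e')" by blast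
  obtain e0 where e0: "0 < e0" "ball x e0 \<subseteq> X"
    using orbit[of 0] X_open open_contains_ball by (metis funpow_0 le0)
  define e where "e = Min (insert e0 (E ` {1..m}))"
  have e: "0 < e" "e \<le> e0" using e0 E by (auto simp: e_def)
  have eE: "e \<le> E k" if "k \<in> {1..m}" for k
    unfolding e_def using that by (intro Min_le) auto
  show ?thesis
  proof (rule that[of "ball x e"])
    have "ball x e = {x - e<..<x + e}" by (auto simp: dist_real_def)
    then show "is_interval (ball x e)" "0 < length_of (ball x e)" using e(1) by (auto simp: is_interval_oo)
    show "ball x e \<subseteq> {0..1}" using e(2) e0(2) X_subset by (meson order_trans subset_ball)
    fix k y assume "1 \<le> k" "k \<le> m" "y \<in> ball x e"
    then show "(T ^^ k) y \<notin> ball x e" using E[of k] eE[of k] by auto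
  qed
qed

lemma unit_dist_square: "cmod z = 1 \<Longrightarrow> (cmod (z - 1))\<^sup>2 = 2 - 2 * Re z"
proof -
  assume "cmod z = 1"
  then have "(Re z)\<^sup>2 + (Im z)\<^sup>2 = 1" by (metis cmod_power2 one_power2)
  then show ?thesis by (simp add: cmod_power2 power2_diff)
qed

text \<open>On the arc \<open>\<bar>z - \<mu>\<bar> \<le> \<delta>\<close> of the unit circle the correlation sums of \<open>f\<close> stay bounded, while the
  weight \<open>Re (z / \<mu>) - \<kappa>\<close> is nonpositive on the rest of the circle. Averaging over roots of unity
  therefore bounds \<open>l * (M - \<kappa> * (M + 1))\<close> uniformly in \<open>l\<close>.\<close>

lemma ess_spectral_radius_injective:
  assumes inj: "inj_on T X"
  shows "1 \<le> ess_spectral_radius B N L"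
proof (rule ess_spectral_radius_ge, rule ccontr)
  fix r assume "0 \<le> r"
    and iso: "\<And>z. z \<in> spectrum_on B N L \<Longrightarrow> r < cmod z \<Longrightarrow> isolated_finite_eigenvalue B N L z"
    and "\<not> 1 \<le> r"
  then have "isolated_finite_eigenvalue B N L 1"
    using eigenvalue_in_spectrum[OF eigenvalue_1] by auto
  then have isol: "\<not> 1 islimpt spectrum_on B N L" and fin: "fin_dim_ae (gen_eigenspace B L 1)"
    unfolding isolated_finite_eigenvalue_def by auto
  have nonper: "\<not> (AE x in mI. (T ^^ K) x = x)" if "0 < K" for K
    using infinite_eigenspace_periodic[OF that] fin by blast
  obtain \<epsilon> where \<epsilon>: "0 < \<epsilon>" "\<And>z. z \<noteq> 1 \<Longrightarrow> cmod (z - 1) < \<epsilon> \<Longrightarrow> z \<notin> spectrum_on B N L"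
    using isol unfolding islimpt_approachable dist_norm by blast
  \<comment> \<open>For unit \<open>\<mu>\<close> with real part \<open>1 - \<eta>\<close> the
    squared distance to 1 is \<open>2 * \<eta>\<close>, so this choice puts \<open>\<mu>\<close> at
    distance \<open>min \<epsilon> 1 / 2\<close>, inside the punctured disc free of
    spectrum.\<close>
  define \<eta> where "\<eta> = (min \<epsilon> 1)\<^sup>2 / 8"
  have \<eta>: "0 < \<eta>" "\<eta> \<le> 1"
  proof -
    show "0 < \<eta>" using \<epsilon>(1) by (simp add: \<eta>_def)
    have "(min \<epsilon> 1)\<^sup>2 \<le> 1" using \<epsilon>(1) by (intro power_le_one) auto
    then show "\<eta> \<le> 1" by (simp add: \<eta>_def)
  qed
  define \<mu> where "\<mu> = cis (arccos (1 - \<eta>))"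
  have mu: "cmod \<mu> = 1" "Re \<mu> = 1 - \<eta>" using \<eta> by (auto simp: \<mu>_def)
  define d where "d = cmod (\<mu> - 1)"
  have d2: "d\<^sup>2 = (min \<epsilon> 1 / 2)\<^sup>2"
    unfolding d_def unit_dist_square[OF mu(1)] mu(2) by (simp add: \<eta>_def power_divide)
  have "d = min \<epsilon> 1 / 2"
    by (rule power2_eq_imp_eq[OF d2]) (use \<epsilon>(1) in \<open>simp_all add: d_def\<close>)
  then have d: "0 < d" "d < \<epsilon>" using \<epsilon>(1) by auto
  then have "\<mu> \<notin> spectrum_on B N L" by (intro \<epsilon>) (auto simp: d_def)
  then obtain K' where K': "\<forall>f\<in>B. N f \<le> K' * N (\<lambda>x. \<mu> * f x - L f x)"
    unfolding spectrum_on_def by blast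
  define K where "K = max K' 1"
  have K: "1 \<le> K" "N f \<le> K * N (\<lambda>x. \<mu> * f x - L f x)" if "f \<in> B" for f
  proof -
    have "K' * N (\<lambda>x. \<mu> * f x - L f x) \<le> K * N (\<lambda>x. \<mu> * f x - L f x)"
      using that by (intro mult_right_mono N_nonneg diff_mem scale_mem L_memI) (auto simp: K_def)
    then show "N f \<le> K * N (\<lambda>x. \<mu> * f x - L f x)" using K' that by force
  qed (simp add: K_def)
  have K1: "1 \<le> K" by (simp add: K_def)
  \<comment> \<open>The first two entries keep the disc around \<open>\<mu>\<close> away from 1 and
    within distance \<open>\<epsilon>\<close> of 1; the third makes the perturbation
    \<open>(\<mu> - z) * f\<close> absorbable with constant 1/2.\<close>
  define \<delta> where "\<delta> = min (min (d / 2) ((\<epsilon> - d) / 2)) (1 / (2 * K))"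
  have \<delta>: "0 < \<delta>" "\<delta> < d" "\<delta> + d < \<epsilon>" "\<delta> * K \<le> 1 / 2"
  proof -
    show "0 < \<delta>" using d K1 by (simp add: \<delta>_def)
    have "\<delta> \<le> d / 2" "\<delta> \<le> (\<epsilon> - d) / 2" "\<delta> \<le> 1 / (2 * K)"
      unfolding \<delta>_def by (rule min.coboundedI1 min.cobounded1 min.cobounded2)+
    then show "\<delta> < d" "\<delta> + d < \<epsilon>" "\<delta> * K \<le> 1 / 2" using d K1 by (auto simp: field_simps)
  qed
  \<comment> \<open>Each \<open>z\<close> off the spectrum has its own resolvent constant, whereas
    the averaging needs a single one. Perturbing from \<open>\<mu>\<close> gives
    \<open>2 * K\<close> on the entire arc.\<close>
  have arc_surj: "\<exists>f\<in>B. eq_ae (\<lambda>x. z * f x - L f x) g"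
    and arc_bound: "f \<in> B \<Longrightarrow> N f \<le> 2 * K * N (\<lambda>x. z * f x - L f x)"
    if z: "cmod (z - \<mu>) \<le> \<delta>" and g: "g \<in> B" for z f g
  proof -
    have "d \<le> cmod (z - \<mu>) + cmod (z - 1)"
      unfolding d_def using norm_triangle_ineq4[of "z - 1" "z - \<mu>"] by (simp add: add.commute)
    then have "z \<noteq> 1" using z \<delta>(2) by auto
    moreover have "cmod (z - 1) \<le> cmod (z - \<mu>) + d"
      unfolding d_def using norm_triangle_ineq[of "z - \<mu>" "\<mu> - 1"] by simp
    then have "cmod (z - 1) < \<epsilon>" using z \<delta>(3) by simp
    ultimately have "z \<notin> spectrum_on B N L" by (rule \<epsilon>(2))
    then show "\<exists>f\<in>B. eq_ae (\<lambda>x. z * f x - L f x) g" using g unfolding spectrum_on_def by blast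
    assume f: "f \<in> B"
    have zf: "(\<lambda>x. z * f x - L f x) \<in> B" "(\<lambda>x. (\<mu> - z) * f x) \<in> B"
      using f by (auto intro!: diff_mem scale_mem L_memI)
    have "N f \<le> K * N (\<lambda>x. \<mu> * f x - L f x)" by (rule K(2)[OF f])
    also have "(\<lambda>x. \<mu> * f x - L f x) = (\<lambda>x. (z * f x - L f x) + (\<mu> - z) * f x)"
      by (auto simp: algebra_simps)
    also have "N \<dots> \<le> N (\<lambda>x. z * f x - L f x) + cmod (\<mu> - z) * N f"
      using N_add[OF zf] N_scale[OF f] by simp
    also have "cmod (\<mu> - z) * N f \<le> \<delta> * N f"
      using z N_nonneg[OF f] by (intro mult_right_mono) (simp_all add: norm_minus_commute)
    finally have "N f \<le> K * (N (\<lambda>x. z * f x - L f x) + \<delta> * N f)" using K1 by simp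
    also have "\<dots> = K * N (\<lambda>x. z * f x - L f x) + (\<delta> * K) * N f" by (simp add: algebra_simps)
    also have "(\<delta> * K) * N f \<le> (1 / 2) * N f" using \<delta>(4) N_nonneg[OF f] by (rule mult_right_mono)
    finally show "N f \<le> 2 * K * N (\<lambda>x. z * f x - L f x)" by simp
  qed
  \<comment> \<open>For unit \<open>w\<close>, \<open>\<kappa> \<le> Re w\<close> holds exactly when
    \<open>cmod (w - 1) \<le> \<delta>\<close>. Since
    \<open>gap = (M + 1) * \<delta>\<^sup>2 / 2 - 1\<close>, taking \<open>M\<close> above
    \<open>2 / \<delta>\<^sup>2\<close> makes the gap positive.\<close>
  define \<kappa> where "\<kappa> = 1 - \<delta>\<^sup>2 / 2"
  obtain M :: nat where M: "2 / \<delta>\<^sup>2 < real M" using reals_Archimedean2 by blast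
  define gap where "gap = real M - \<kappa> * real (Suc M)"
  have gap: "0 < gap"
  proof -
    have "2 < real (Suc M) * \<delta>\<^sup>2" using M \<delta>(1) by (simp add: field_simps) (smt (verit) zero_less_power)
    then show ?thesis by (simp add: gap_def \<kappa>_def algebra_simps)
  qed
  \<comment> \<open>Disjointness is needed up to index \<open>Suc M\<close>, one beyond the pieces
    of \<open>f\<close>, because \<open>f (T x)\<close> involves \<open>b (Suc M) x\<close>.\<close>
  have "\<not> (AE x in mI. (T ^^ fact (Suc M)) x = x)" by (intro nonper) simp
  then obtain J where J: "is_interval J" "J \<subseteq> {0..1}" "0 < length_of J"
    and noret: "\<And>k y. 1 \<le> k \<Longrightarrow> k \<le> Suc M \<Longrightarrow> y \<in> J \<Longrightarrow> (T ^^ k) y \<notin> J"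
    by (rule small_nonreturning_interval) blast
  define b where "b = (\<lambda>k x. indicator J ((T ^^ k) x) :: real)"
  have b01: "b k x = 0 \<or> b k x = 1" for k x by (auto simp: b_def indicator_def)
  have bT: "b k ((T ^^ i) x) = b (k + i) x" for k i x by (simp add: b_def funpow_add)
  have b_disj: "b p x * b q x = (if p = q then b p x else 0)" if "p \<le> Suc M" "q \<le> Suc M" for p q x
  proof -
    have *: "b p x * b q x = 0" if "p < q" "q \<le> Suc M" for p q
    proof -
      have "(T ^^ q) x = (T ^^ (q - p)) ((T ^^ p) x)"
        using that by (simp add: funpow_add[symmetric, unfolded o_def fun_eq_iff, rule_format])
      then show ?thesis using noret[of "q - p" "(T ^^ p) x"] that by (auto simp: b_def indicator_def)
    qed
    show ?thesis using *[of p q] *[of q p] that b01[of p x]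
      by (cases p q rule: linorder_cases) (auto simp: mult.commute)
  qed
  \<comment> \<open>An approximate eigenfunction of composition with \<open>T\<close>:
    \<open>f (T x)\<close> agrees with \<open>cnj \<mu> * f x\<close> except on the two end pieces
    \<open>b 0\<close> and \<open>b (Suc M)\<close>.\<close>
  define f where "f = (\<lambda>x. \<Sum>p<Suc M. \<mu> ^ p * of_real (b p x))"
  have fB: "f \<in> B"
  proof -
    have "(\<lambda>x. complex_of_real (b p x)) \<in> B" for p
      using indicator_comp(1)[OF J(1,2), of p] by (simp add: b_def of_real_indicator)
    then show ?thesis unfolding f_def by (intro sum_mem scale_mem)
  qed
  have f_le: "cmod (f x) \<le> real (Suc M)" for x
  proof -
    have "cmod (f x) \<le> (\<Sum>p<Suc M. cmod (\<mu> ^ p * of_real (b p x)))" unfolding f_def by (rule norm_sum)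
    also have "\<dots> \<le> (\<Sum>p<Suc M. 1)"
      using b01 by (intro sum_mono) (simp add: norm_mult norm_power mu, metis abs_0 abs_1 order_refl zero_le_one)
    finally show ?thesis by simp
  qed
  have muc: "\<mu> * cnj \<mu> = 1" using mu(1) complex_norm_square[of \<mu>] by simp
  have muc_pow: "\<mu> ^ p * cnj \<mu> ^ p = 1" for p by (simp add: power_mult_distrib[symmetric] muc)
  have f_sq: "f x * cnj (f x) = of_real (\<Sum>p<Suc M. b p x)" for x
  proof -
    have "f x * cnj (f x) = (\<Sum>p<Suc M. \<Sum>q<Suc M. (\<mu> ^ p * of_real (b p x)) * (cnj \<mu> ^ q * of_real (b q x)))"
      unfolding f_def cnj_sum sum_product by (simp only: complex_cnj_mult complex_cnj_power complex_cnj_complex_of_real)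
    also have "\<dots> = (\<Sum>p<Suc M. \<Sum>q<Suc M. if p = q then of_real (b p x) else 0)"
    proof (intro sum.cong refl)
      fix p q assume "p \<in> {..<Suc M}" "q \<in> {..<Suc M}"
      then have "of_real (b p x) * of_real (b q x) = (if p = q then of_real (b p x) else (0::complex))"
        using b_disj[of p q x] by (auto simp flip: of_real_mult)
      then have eq: "(\<mu> ^ p * of_real (b p x)) * (cnj \<mu> ^ q * of_real (b q x)) =
          \<mu> ^ p * cnj \<mu> ^ q * (if p = q then of_real (b p x) else (0::complex))" by (simp only: mult_ac)
      show "(\<mu> ^ p * of_real (b p x)) * (cnj \<mu> ^ q * of_real (b q x)) =
          (if p = q then of_real (b p x) else (0::complex))"
        unfolding eq by (cases "p = q") (simp_all only: muc_pow if_True if_False mult_1_left mult_zero_right)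
    qed
    also have "\<dots> = (\<Sum>p<Suc M. of_real (b p x))" by (intro sum.cong refl) simp
    finally show ?thesis by simp
  qed
  \<comment> \<open>The end pieces find no partner, so \<open>M\<close> of the \<open>M + 1\<close>
    pieces survive, all with the common phase \<open>\<mu>\<close>; dividing this phase out is why
    \<open>V\<close> is taken at \<open>\<mu> * w q\<close>.\<close>
  have f_corr: "f x * cnj (f (T x)) = \<mu> * of_real (\<Sum>q<M. b (Suc q) x)" for x
  proof -
    have fT: "f (T x) = (\<Sum>q<Suc M. \<mu> ^ q * of_real (b (Suc q) x))"
      unfolding f_def using bT[of _ 1 x] by simp
    have "f x * cnj (f (T x)) = (\<Sum>p<Suc M. \<Sum>q<Suc M. (\<mu> ^ p * of_real (b p x)) * (cnj \<mu> ^ q * of_real (b (Suc q) x)))"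
      unfolding fT unfolding f_def cnj_sum sum_product by (simp only: complex_cnj_mult complex_cnj_power complex_cnj_complex_of_real)
    also have "\<dots> = (\<Sum>q<Suc M. \<Sum>p<Suc M. (\<mu> ^ p * of_real (b p x)) * (cnj \<mu> ^ q * of_real (b (Suc q) x)))"
      by (rule sum.swap)
    also have "\<dots> = (\<Sum>q<Suc M. \<Sum>p<Suc M. if p = Suc q then \<mu> * of_real (b (Suc q) x) else 0)"
    proof (intro sum.cong refl)
      fix q p assume "q \<in> {..<Suc M}" "p \<in> {..<Suc M}"
      then have "of_real (b p x) * of_real (b (Suc q) x) = (if p = Suc q then of_real (b (Suc q) x) else (0::complex))"
        using b_disj[of p "Suc q" x] by (auto simp flip: of_real_mult)
      then have eq: "(\<mu> ^ p * of_real (b p x)) * (cnj \<mu> ^ q * of_real (b (Suc q) x)) =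
          \<mu> ^ p * cnj \<mu> ^ q * (if p = Suc q then of_real (b (Suc q) x) else (0::complex))" by (simp only: mult_ac)
      have pow: "\<mu> ^ Suc q * cnj \<mu> ^ q = \<mu>" using muc_pow[of q] by (simp add: mult.assoc)
      show "(\<mu> ^ p * of_real (b p x)) * (cnj \<mu> ^ q * of_real (b (Suc q) x)) =
          (if p = Suc q then \<mu> * of_real (b (Suc q) x) else (0::complex))"
        unfolding eq by (cases "p = Suc q") (simp_all only: pow if_True if_False mult_zero_right simp_thms)
    qed
    also have "\<dots> = (\<Sum>q<Suc M. if q < M then \<mu> * of_real (b (Suc q) x) else 0)"
      by (intro sum.cong refl) (simp add: sum.delta del: sum.lessThan_Suc)
    also have "\<dots> = (\<Sum>q<M. \<mu> * of_real (b (Suc q) x))" by simp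
    finally show ?thesis by (simp add: sum_distrib_left)
  qed
  obtain K1' where K1': "0 < K1'" "\<forall>f\<in>B. L1_norm f \<le> K1' * N f" using L1_bound by blast
  define C1 where "C1 = 4 * real (Suc M) * (K1' * (2 * K * (2 * K * N f)))"
  have C1: "0 \<le> C1" using K1 K1' N_nonneg[OF fB] by (simp add: C1_def)
  have ineq: "real l * (length_of J * gap) \<le> \<delta>\<^sup>2 / 2 * C1 + \<kappa> * real (Suc M) * length_of J" for l
  proof -
    define R where "R = Suc (Suc l)"
    define w where "w = (\<lambda>q. cis (2 * pi * real q / real R))"
    define V where "V = (\<lambda>q x. \<Sum>j<Suc l. (\<mu> * w q) ^ j * f ((T ^^ Suc j) x))"
    have fint: "integrable mI (\<lambda>x. f ((T ^^ k) x))" for k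
      using integral_comp_power[OF integrable_mem[OF fB]] by blast
    have Vint: "integrable mI (V q)" for q
      unfolding V_def by (intro Bochner_Integration.integrable_sum integrable_mult_right fint)
    have w1: "cmod (w q) = 1" for q by (simp add: w_def)
    have V_le: "cmod (V q x) \<le> real (Suc l) * real (Suc M)" for q x
    proof -
      have "cmod (V q x) \<le> (\<Sum>j<Suc l. cmod ((\<mu> * w q) ^ j * f ((T ^^ Suc j) x)))"
        unfolding V_def by (rule norm_sum)
      also have "\<dots> \<le> (\<Sum>j<Suc l. real (Suc M))"
        using f_le by (intro sum_mono) (simp add: norm_mult norm_power mu w1 del: funpow.simps)
      finally show ?thesis by simp
    qed
    have V2int: "integrable mI (\<lambda>x. (cmod (V q x))\<^sup>2)" for q
    proof (rule integrable_mI_bounded)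
      show "(\<lambda>x. (cmod (V q x))\<^sup>2) \<in> borel_measurable mI"
        using borel_measurable_integrable[OF Vint] by measurable
      show "norm ((cmod (V q x))\<^sup>2) \<le> (real (Suc l) * real (Suc M))\<^sup>2" for x
        using V_le by (simp add: power_mono)
    qed
    have pointwise: "(\<Sum>q<R. (Re (w q) - \<kappa>) * (cmod (V q x))\<^sup>2) =
        real R * ((\<Sum>i<l. \<Sum>q<M. b (Suc q + Suc i) x) - \<kappa> * (\<Sum>i<Suc l. \<Sum>p<Suc M. b (p + Suc i) x))" for x
    proof -
      define v where "v = (\<lambda>j. \<mu> ^ j * f ((T ^^ Suc j) x))"
      have "V q x = (\<Sum>j<Suc l. w q ^ j * v j)" for q
        unfolding V_def v_def by (intro sum.cong refl) (simp only: power_mult_distrib mult_ac)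
      then have "(\<Sum>q<R. (Re (w q) - \<kappa>) * (cmod (V q x))\<^sup>2) =
        real R * (Re (\<Sum>i<l. v i * cnj (v (Suc i))) - \<kappa> * (\<Sum>i<Suc l. (cmod (v i))\<^sup>2))"
        unfolding w_def R_def by (simp only: weighted_parseval)
      also have "(\<Sum>i<l. v i * cnj (v (Suc i))) = of_real (\<Sum>i<l. \<Sum>q<M. b (Suc q + Suc i) x)"
      proof -
        have "v i * cnj (v (Suc i)) = of_real (\<Sum>q<M. b (Suc q + Suc i) x)" for i
        proof -
          have "v i * cnj (v (Suc i)) = (\<mu> ^ i * cnj \<mu> ^ i) * cnj \<mu> * (f ((T ^^ Suc i) x) * cnj (f (T ((T ^^ Suc i) x))))"
            by (simp add: v_def)
          also have "\<dots> = (\<mu> * cnj \<mu>) * of_real (\<Sum>q<M. b (Suc q) ((T ^^ Suc i) x))"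
            unfolding f_corr muc_pow by (simp only: mult_1_left mult_ac)
          also have "\<dots> = of_real (\<Sum>q<M. b (Suc q + Suc i) x)" by (simp only: muc mult_1_left bT)
          finally show ?thesis .
        qed
        then show ?thesis by (simp only: of_real_sum)
      qed
      also have "(\<Sum>i<Suc l. (cmod (v i))\<^sup>2) = (\<Sum>i<Suc l. \<Sum>p<Suc M. b (p + Suc i) x)"
      proof (intro sum.cong refl)
        fix i
        have "complex_of_real ((cmod (v i))\<^sup>2) = v i * cnj (v i)" by (rule complex_norm_square)
        also have "\<dots> = (\<mu> ^ i * cnj \<mu> ^ i) * (f ((T ^^ Suc i) x) * cnj (f ((T ^^ Suc i) x)))"
          by (simp only: v_def complex_cnj_mult complex_cnj_power mult_ac)
        also have "\<dots> = of_real (\<Sum>p<Suc M. b (p + Suc i) x)"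
          by (simp only: muc_pow f_sq bT mult_1_left)
        finally show "(cmod (v i))\<^sup>2 = (\<Sum>p<Suc M. b (p + Suc i) x)" by (simp only: of_real_eq_iff)
      qed
      finally show ?thesis by (simp only: Re_complex_of_real)
    qed
    have bint: "integrable mI (b k)" "(\<integral>x. b k x \<partial>mI) = length_of J" for k
      unfolding b_def using integral_indicator_comp[OF J(1,2)] by auto
    have "(\<Sum>q<R. (Re (w q) - \<kappa>) * (\<integral>x. (cmod (V q x))\<^sup>2 \<partial>mI)) =
        (\<integral>x. (\<Sum>q<R. (Re (w q) - \<kappa>) * (cmod (V q x))\<^sup>2) \<partial>mI)"
      using V2int by (subst Bochner_Integration.integral_sum) auto
    also have "\<dots> = real R * (\<integral>x. (\<Sum>i<l. \<Sum>q<M. b (Suc q + Suc i) x) - \<kappa> * (\<Sum>i<Suc l. \<Sum>p<Suc M. b (p + Suc i) x) \<partial>mI)"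
      unfolding pointwise by (rule integral_mult_right_zero)
    also have "\<dots> = real R * ((\<Sum>i<l. \<Sum>q<M. length_of J) - \<kappa> * (\<Sum>i<Suc l. \<Sum>p<Suc M. length_of J))"
    proof -
      have 1: "integrable mI (\<lambda>x. \<Sum>i<l. \<Sum>q<M. b (Suc q + Suc i) x)"
        "integrable mI (\<lambda>x. \<Sum>i<Suc l. \<Sum>p<Suc M. b (p + Suc i) x)"
        by (intro Bochner_Integration.integrable_sum bint)+
      have 2: "(\<integral>x. (\<Sum>i<l. \<Sum>q<M. b (Suc q + Suc i) x) \<partial>mI) = (\<Sum>i<l. \<Sum>q<M. length_of J)"
        "(\<integral>x. (\<Sum>i<Suc l. \<Sum>p<Suc M. b (p + Suc i) x) \<partial>mI) = (\<Sum>i<Suc l. \<Sum>p<Suc M. length_of J)"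
        by (simp_all only: Bochner_Integration.integral_sum Bochner_Integration.integrable_sum bint)
      show ?thesis
        by (subst Bochner_Integration.integral_diff[OF 1(1) integrable_mult_right[OF 1(2)]])
          (simp only: integral_mult_right_zero 2)
    qed
    finally have eq: "(\<Sum>q<R. (Re (w q) - \<kappa>) * (\<integral>x. (cmod (V q x))\<^sup>2 \<partial>mI)) =
        real R * (real l * real M * length_of J - \<kappa> * (real (Suc l) * real (Suc M) * length_of J))"
      by (simp only: sum_constant card_lessThan mult.assoc)
    have term_le: "(Re (w q) - \<kappa>) * (\<integral>x. (cmod (V q x))\<^sup>2 \<partial>mI) \<le> \<delta>\<^sup>2 / 2 * C1" for q
    proof (cases "\<kappa> \<le> Re (w q)")
      case True
      have "(cmod (\<mu> * w q - \<mu>))\<^sup>2 = (cmod (w q - 1))\<^sup>2"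
        using mu(1) by (simp add: norm_mult right_diff_distrib[of \<mu> "w q" 1, symmetric, simplified])
      also have "\<dots> \<le> \<delta>\<^sup>2" unfolding unit_dist_square[OF w1] using True by (simp add: \<kappa>_def)
      finally have arc: "cmod (\<mu> * w q - \<mu>) \<le> \<delta>" using \<delta>(1) by (simp add: power2_le_iff_abs_le)
      have "(\<integral>x. (cmod (V q x))\<^sup>2 \<partial>mI) \<le> C1"
        unfolding V_def C1_def
      proof (rule resolvent_correlation_bound[OF inj])
        show "cmod (\<mu> * w q) = 1" by (simp add: norm_mult mu w1)
        show "0 \<le> 2 * K" "0 \<le> K1'" using K1 K1' by auto
      qed (use arc_surj[OF arc] arc_bound[OF arc fB] K1' fB f_le in auto)
      moreover have "Re (w q) - \<kappa> \<le> \<delta>\<^sup>2 / 2"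
        using complex_Re_le_cmod[of "w q"] by (simp add: w1 \<kappa>_def)
      ultimately show ?thesis using True by (intro mult_mono) auto
    next
      case False
      then have "(Re (w q) - \<kappa>) * (\<integral>x. (cmod (V q x))\<^sup>2 \<partial>mI) \<le> 0"
        by (intro mult_nonpos_nonneg) auto
      also have "0 \<le> \<delta>\<^sup>2 / 2 * C1" using C1 by simp
      finally show ?thesis .
    qed
    have "real R * (real l * real M * length_of J - \<kappa> * (real (Suc l) * real (Suc M) * length_of J)) \<le>
        (\<Sum>q<R. \<delta>\<^sup>2 / 2 * C1)"
      unfolding eq[symmetric] by (intro sum_mono term_le)
    also have "\<dots> = real R * (\<delta>\<^sup>2 / 2 * C1)" by simp
    finally have "real l * real M * length_of J - \<kappa> * (real (Suc l) * real (Suc M) * length_of J) \<le> \<delta>\<^sup>2 / 2 * C1"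
      by (simp add: R_def)
    then show ?thesis by (simp add: gap_def algebra_simps)
  qed
  obtain l :: nat where "\<delta>\<^sup>2 / 2 * C1 + \<kappa> * real (Suc M) * length_of J < real l * (length_of J * gap)"
    using ex_less_of_nat_mult[of "length_of J * gap"] J(3) gap by (metis mult_pos_pos)
  then show False using ineq[of l] by linarith
qed

text \<open>In the injective case the radius is at least 1, which suffices because
  \<open>Theta_infty P T (1 - s)\<close> is at least 1.\<close>

lemma ess_spectral_radius_lower_bound:
  assumes "s < \<beta>"
  shows "1 / Theta_infty P T (1 - s) \<le> ess_spectral_radius B N L"
proof (cases "inj_on T X")
  case True
  have "1 \<le> Theta_infty P T (1 - s)" using s_pos s_less_1 by (intro Theta_root_limit) auto
  then have "1 / Theta_infty P T (1 - s) \<le> 1" by simp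
  then show ?thesis using ess_spectral_radius_injective[OF True] by linarith
next
  case False
  then show ?thesis using assms by (rule ess_spectral_radius_noninjective)
qed

end

theorem theorem1:
  fixes P :: "real set set" and T :: "real \<Rightarrow> real" and \<beta> s C :: real
    and B :: "(real \<Rightarrow> complex) set" and N :: "(real \<Rightarrow> complex) \<Rightarrow> real"
  assumes "interval_partition P"
    and "\<forall>x\<in>\<Union>P. T x \<in> {0..1}"
    and "0 < \<beta>"
    and "\<forall>J\<in>P. \<exists>g. (\<forall>x\<in>J. g x = T x) \<and> holder_diffeo (1 + \<beta>) (closure J) g"
    and "preserves_lebesgue P T"
    and "banach_function_space B N"
    and "\<forall>f\<in>B. transfer_op P T f \<in> B"
    and "\<exists>K. \<forall>f\<in>B. N (transfer_op P T f) \<le> K * N f"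
    and "0 \<le> C" and "0 < s" and "s < 1"
    and "\<forall>J. is_interval J \<and> J \<subseteq> {0..1} \<longrightarrow>
           (indicator J :: real \<Rightarrow> complex) \<in> B \<and>
           N (indicator J) \<le> C * length_of J powr (1 - s)"
  shows "besov_space s \<subseteq> B \<and>
         (\<exists>K. \<forall>\<psi>\<in>besov_space s. N \<psi> \<le> K * besov_norm s \<psi>) \<and>
         (s < \<beta> \<longrightarrow>
            ess_spectral_radius B N (transfer_op P T) \<ge> 1 / Theta_infty P T (1 - s) \<and>
            (\<not> inj_on T (\<Union>P) \<longrightarrow>
               (\<forall>z. cmod z < 1 / Theta_infty P T (1 - s) \<longrightarrow>
                  is_eigenvalue B (transfer_op P T) z \<and>
                  \<not> fin_dim_ae (eigenspace B (transfer_op P T) z))))"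
proof -
  interpret transfer_space P T \<beta> B N C s
    by unfold_locales (use assms in simp_all)
  show ?thesis
    using besov_embedding ess_spectral_radius_lower_bound infinite_small_eigenspaces(1,2) by blast
qed

end
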